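(* Let $p\in\mathbb{N}\setminus\{0,1\}$ and $\beta>0$. For $m\in[-1,1]$ define $$S^{p,\beta}_1(m)=\sum_{k=0}^{p-1}\binom{p-1}{k}\left(\frac{1-m}{2}\right)^k\left(\frac{1+m}{2}\right)^{p-1-k}e^{-2\beta\left(\frac{2k+1-p}{p}\right)_+},$$ $$S^{p,\beta}_2(m)=\sum_{k=0}^{p-1}\binom{p-1}{k}\left(\frac{1-m}{2}\right)^k\left(\frac{1+m}{2}\right)^{p-1-k}e^{-2\beta\left(\frac{p-1-2k}{p}\right)_+},$$ $$f_p(\beta,m)=\left(S^{p,\beta}_1(m)-S^{p,\beta}_2(m)\right)-m\left(S^{p,\beta}_1(m)+S^{p,\beta}_2(m)\right).$$ Let $(m_{N,p}(n))_{n\ge 0}$ be the magnetization of the Curie-Weiss dynamics with $N$ spins and random batches of size $p$ at inverse temperature $\beta$ (defined in the context). Then: 1. If $m_{N,p}(0)$ converges in law to $m_0\in[-1,1]$ as $N\to\infty$, the time-rescaled process $M^{(N,p)}_t=m_{N,p}(\lfloor Nt\rfloor)$, $t\ge 0$, converges weakly as $N\to\infty$ to the solution of the ODE $$\frac{d}{dt}m(t)=f_p(\beta,m(t)),\qquad m(0)=m_0.$$ For every $\beta>0$, $0$ is an equilibrium state of this ODE. 2. For $p\in\{2,3\}$ (and every $\beta>0$), $0$ is the unique equilibrium state in $[-1,1]$ of this ODE, and it is stable. 3. For every $p\ge 4$ there exists $\beta_{c,p}$ such that for all $\beta>\beta_{c,p}$ the equilibrium state $0$ is unstable, and for all $\beta\le\beta_{c,p}$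 it is stable. Furthermore, as $p\to\infty$, $$\beta_{c,p}=1+\sqrt{\frac{2}{p\pi}}+o\left(\frac{1}{\sqrt p}\right).$$
   Context: Notation: $x_+=\max(x,0)$. Curie-Weiss dynamics with random batches. Let $N\ge p\ge 2$ be integers, $\beta>0$ (inverse temperature) and $\Omega_N=\{-1,1\}^N$. For $\sigma\in\Omega_N$ and a subset $\mathcal{C}\subset\{1,\dots,N\}$ with $p$ elements put $$H_{N,p}(\sigma,\mathcal{C})=-\frac{1}{2p}\sum_{j,k\in\mathcal{C}}\sigma_j\sigma_k .$$ $(\sigma^p(n))_{n\ge0}$ is the Markov chain on $\Omega_N$ with the following evolution. At each discrete time step, an index $i$ is chosen uniformly in $\{1,\dots,N\}$; let $\sigma'$ be the configuration with $\sigma'_j=\sigma^p(n)_j$ for $j\ne i$ and $\sigma'_i=-\sigma^p(n)_i$. A subset $\mathcal{C}^{i,p}\subset\{1,\dots,N\}$ of size $p$ containing $i$ is sampled uniformly among all such subsets, and $\sigma'$ is accepted as $\sigma^p(n+1)$ with probability $\exp\left(-\beta\left(H_{N,p}(\sigma',\mathcal{C}^{i,p})-H_{N,p}(\sigma^p(n),\mathcal{C}^{i,p})\right)_+\right)$; otherwise $\sigma^p(n+1)=\sigma^p(n)$. The magnetization is $m_{N,p}(n)=\frac1N\sum_{i=1}^N\sigma^p_i(n)\in[-1,1]$; it is itself a Markov chain. Weak convergence of processes is convergence in law in the Skorokhod space of càdlàg functions on $[0,\infty)$. An equilibrium state is a point $m\in[-1,1]$ with $f_p(\beta,m)=0$;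 stable/unstable have their usual meaning for equilibria of an autonomous scalar ODE.
   Formalization: At β=β_{c,p} only stability of the linearized equation is claimed, since for p=5 the state 0 is Lyapunov unstable there; Lyapunov stability at β_{c,p} is not claimed for p=4 either, where it holds. For β<β_{c,p} and β>β_{c,p} Lyapunov stability and instability are proved. *)

theory Defs
  imports "HOL-Probability.Probability" "HOL-Library.Landau_Symbols"
begin

section \<open>The dynamics with random batches\<close>

definition spin_configs :: "nat \<Rightarrow> (nat \<Rightarrow> real) set" where
  "spin_configs N = {1..N} \<rightarrow>\<^sub>E {-1, 1}"

definition batch_hamiltonian :: "nat \<Rightarrow> (nat \<Rightarrow> real) \<Rightarrow> nat set \<Rightarrow> real" where
  "batch_hamiltonian p \<sigma> C = - (1 / (2 * real p)) * (\<Sum>j\<in>C. \<Sum>k\<in>C. \<sigma> j * \<sigma> k)"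

definition batch_step :: "nat \<Rightarrow> nat \<Rightarrow> real \<Rightarrow> (nat \<Rightarrow> real) \<Rightarrow> (nat \<Rightarrow> real) pmf" where
  "batch_step N p \<beta> \<sigma> =
    do {
      i \<leftarrow> pmf_of_set {1..N};
      C \<leftarrow> pmf_of_set {C. C \<subseteq> {1..N} \<and> card C = p \<and> i \<in> C};
      let \<sigma>' = \<sigma>(i := - \<sigma> i);
      accept \<leftarrow> bernoulli_pmf
        (exp (- \<beta> * max (batch_hamiltonian p \<sigma>' C - batch_hamiltonian p \<sigma> C) 0));
      return_pmf (if accept then \<sigma>' else \<sigma>)
    }"

text \<open>
  A homogeneous Markov chain on a countable state space \<open>S\<close> with one-step transition law
  \<open>K\<close> and arbitrary initial law. The identity below is the Markov property without division:
  it also covers paths of probability zero.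
\<close>

definition markov_chain ::
  "'a measure \<Rightarrow> 's set \<Rightarrow> ('s \<Rightarrow> 's pmf) \<Rightarrow> (nat \<Rightarrow> 'a \<Rightarrow> 's) \<Rightarrow> bool" where
  "markov_chain P S K X \<longleftrightarrow>
    prob_space P \<and>
    (\<forall>n. X n \<in> P \<rightarrow>\<^sub>M count_space S) \<and>
    (\<forall>n s. (\<forall>i. s i \<in> S) \<longrightarrow>
      measure P {\<omega> \<in> space P. \<forall>i\<le>Suc n. X i \<omega> = s i} =
      measure P {\<omega> \<in> space P. \<forall>i\<le>n. X i \<omega> = s i} * pmf (K (s n)) (s (Suc n)))"

definition magnetization :: "nat \<Rightarrow> (nat \<Rightarrow> real) \<Rightarrow> real" where
  "magnetization N \<sigma> = (\<Sum>i\<in>{1..N}. \<sigma> i) / real N"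

text \<open>Paths are functions on \<open>[0, \<infinity>)\<close>, made extensional so that equality is equality on
  \<open>[0, \<infinity>)\<close>.\<close>

definition rescaled_magnetization ::
  "nat \<Rightarrow> (nat \<Rightarrow> 'a \<Rightarrow> nat \<Rightarrow> real) \<Rightarrow> 'a \<Rightarrow> real \<Rightarrow> real" where
  "rescaled_magnetization N \<sigma> \<omega> =
    (\<lambda>t\<in>{0..}. magnetization N (\<sigma> (nat \<lfloor>real N * t\<rfloor>) \<omega>))"


section \<open>The Skorokhod space and weak convergence\<close>

definition cadlag_paths :: "(real \<Rightarrow> real) set" where
  "cadlag_paths = {x \<in> extensional {0..}.
     (\<forall>t\<ge>0. (x \<longlongrightarrow> x t) (at_right t)) \<and> (\<forall>t>0. \<exists>l. (x \<longlongrightarrow> l) (at_left t))}"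

text \<open>
  The metric below is the usual (Ethier--Kurtz) metric of the \<open>J\<^sub>1\<close> topology on cadlag
  functions on \<open>[0, \<infinity>)\<close>: time changes \<open>\<lambda>\<close> are bi-Lipschitz increasing bijections of
  \<open>[0, \<infinity>)\<close>, their size is the supremum of the absolute log-slopes, and paths are compared
  after being stopped at time \<open>u\<close>, with \<open>u\<close> integrated out against \<open>exp (-u)\<close>.
\<close>

definition log_slopes :: "(real \<Rightarrow> real) \<Rightarrow> real set" where
  "log_slopes l = {\<bar>ln ((l s - l t) / (s - t))\<bar> | s t. 0 \<le> t \<and> t < s}"

definition time_changes :: "(real \<Rightarrow> real) set" where
  "time_changes =
    {l. strict_mono_on {0..} l \<and> l ` {0..} = {0..} \<and> bdd_above (log_slopes l)}"

definition stopped_dist ::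
  "(real \<Rightarrow> real) \<Rightarrow> (real \<Rightarrow> real) \<Rightarrow> (real \<Rightarrow> real) \<Rightarrow> real \<Rightarrow> real" where
  "stopped_dist x y l u = (SUP t\<in>{0..}. min 1 \<bar>x (min t u) - y (min (l t) u)\<bar>)"

definition skorokhod_dist :: "(real \<Rightarrow> real) \<Rightarrow> (real \<Rightarrow> real) \<Rightarrow> real" where
  "skorokhod_dist x y =
    (INF l\<in>time_changes.
      max (Sup (log_slopes l)) (LBINT u:{0..}. exp (- u) * stopped_dist x y l u))"

definition skorokhod_topology :: "(real \<Rightarrow> real) topology" where
  "skorokhod_topology = topology (\<lambda>U. U \<subseteq> cadlag_paths \<and>
     (\<forall>x\<in>U. \<exists>r>0. {y \<in> cadlag_paths. skorokhod_dist x y < r} \<subseteq> U))"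

lemma openin_skorokhod_topology:
  "openin skorokhod_topology U \<longleftrightarrow> U \<subseteq> cadlag_paths \<and>
     (\<forall>x\<in>U. \<exists>r>0. {y \<in> cadlag_paths. skorokhod_dist x y < r} \<subseteq> U)"
proof -
  let ?Q = "\<lambda>U. U \<subseteq> cadlag_paths \<and>
     (\<forall>x\<in>U. \<exists>r>0. {y \<in> cadlag_paths. skorokhod_dist x y < r} \<subseteq> U)"
  have "istopology ?Q"
    unfolding istopology_def
  proof (intro conjI allI impI)
    fix S T assume S: "?Q S" and T: "?Q T"
    then show "S \<inter> T \<subseteq> cadlag_paths" by auto
    show "\<forall>x\<in>S \<inter> T. \<exists>r>0. {y \<in> cadlag_paths. skorokhod_dist x y < r} \<subseteq> S \<inter> T"
    proof
      fix x assume "x \<in> S \<inter> T"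
      then have x: "x \<in> S" "x \<in> T" by auto
      obtain r1 where r1: "r1 > 0" "{y \<in> cadlag_paths. skorokhod_dist x y < r1} \<subseteq> S"
        using S x(1) by meson
      obtain r2 where r2: "r2 > 0" "{y \<in> cadlag_paths. skorokhod_dist x y < r2} \<subseteq> T"
        using T x(2) by meson
      from r1 r2 show "\<exists>r>0. {y \<in> cadlag_paths. skorokhod_dist x y < r} \<subseteq> S \<inter> T"
        by (intro exI[of _ "min r1 r2"]) auto
    qed
  next
    fix K assume K: "\<forall>S\<in>K. ?Q S"
    then show "\<Union>K \<subseteq> cadlag_paths" by auto
    show "\<forall>x\<in>\<Union>K. \<exists>r>0. {y \<in> cadlag_paths. skorokhod_dist x y < r} \<subseteq> \<Union>K"
    proof
      fix x assume "x \<in> \<Union>K"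
      then obtain S where S: "S \<in> K" "x \<in> S" by auto
      with K obtain r where "r > 0" "{y \<in> cadlag_paths. skorokhod_dist x y < r} \<subseteq> S"
        by meson
      with S show "\<exists>r>0. {y \<in> cadlag_paths. skorokhod_dist x y < r} \<subseteq> \<Union>K"
        by (intro exI[of _ r]) auto
    qed
  qed
  then show ?thesis
    unfolding skorokhod_topology_def by (simp add: topology_inverse')
qed

lemma topspace_skorokhod_topology: "topspace skorokhod_topology = cadlag_paths"
proof
  show "topspace skorokhod_topology \<subseteq> cadlag_paths"
    using openin_topspace[of skorokhod_topology] unfolding openin_skorokhod_topology by blast
  have "openin skorokhod_topology cadlag_paths"
    unfolding openin_skorokhod_topology by (auto intro: exI[of _ 1])
  then show "cadlag_paths \<subseteq> topspace skorokhod_topology"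
    by (rule openin_subset)
qed

definition borel_of_topology :: "'b topology \<Rightarrow> 'b measure" where
  "borel_of_topology T = sigma (topspace T) {U. openin T U}"

definition weak_conv_on :: "'b topology \<Rightarrow> (nat \<Rightarrow> 'b measure) \<Rightarrow> 'b measure \<Rightarrow> bool" where
  "weak_conv_on T Ms M \<longleftrightarrow>
    (\<forall>F. continuous_map T euclideanreal F \<and> bounded (F ` topspace T) \<longrightarrow>
      (\<lambda>n. \<integral>x. F x \<partial>(Ms n)) \<longlonglongrightarrow> (\<integral>x. F x \<partial>M))"


section \<open>The limiting differential equation\<close>

definition S1 :: "nat \<Rightarrow> real \<Rightarrow> real \<Rightarrow> real" where
  "S1 p \<beta> m = (\<Sum>k=0..p-1. real ((p-1) choose k) * ((1 - m) / 2) ^ k * ((1 + m) / 2) ^ (p-1-k)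
      * exp (- 2 * \<beta> * max ((2 * real k + 1 - real p) / real p) 0))"

definition S2 :: "nat \<Rightarrow> real \<Rightarrow> real \<Rightarrow> real" where
  "S2 p \<beta> m = (\<Sum>k=0..p-1. real ((p-1) choose k) * ((1 - m) / 2) ^ k * ((1 + m) / 2) ^ (p-1-k)
      * exp (- 2 * \<beta> * max ((real p - 1 - 2 * real k) / real p) 0))"

definition drift :: "nat \<Rightarrow> real \<Rightarrow> real \<Rightarrow> real" where
  "drift p \<beta> m = (S1 p \<beta> m - S2 p \<beta> m) - m * (S1 p \<beta> m + S2 p \<beta> m)"

text \<open>Forward solutions, on \<open>[0, \<infinity>)\<close>, of \<open>x' = f x\<close> with values in the state space
  \<open>I\<close>; the derivative at time \<open>0\<close> is one-sided.\<close>

definition ode_solution :: "(real \<Rightarrow> real) \<Rightarrow> real set \<Rightarrow> (real \<Rightarrow> real) \<Rightarrow> bool" where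
  "ode_solution f I x \<longleftrightarrow>
    (\<forall>t\<ge>0. x t \<in> I \<and> (x has_real_derivative f (x t)) (at t within {0..}))"

definition equilibrium :: "nat \<Rightarrow> real \<Rightarrow> real \<Rightarrow> bool" where
  "equilibrium p \<beta> m \<longleftrightarrow> m \<in> {-1..1} \<and> drift p \<beta> m = 0"

definition lyapunov_stable :: "(real \<Rightarrow> real) \<Rightarrow> real set \<Rightarrow> real \<Rightarrow> bool" where
  "lyapunov_stable f I a \<longleftrightarrow>
    (\<forall>\<epsilon>>0. \<exists>\<delta>>0. \<forall>x. ode_solution f I x \<and> \<bar>x 0 - a\<bar> < \<delta> \<longrightarrow> (\<forall>t\<ge>0. \<bar>x t - a\<bar> < \<epsilon>))"

text \<open>
  Stability of the linearization \<open>y' = f'(a) y\<close> at the equilibrium \<open>a\<close>. It agrees with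
  Lyapunov stability of \<open>a\<close> itself unless \<open>f'(a) = 0\<close>, where the linearized equation is
  (neutrally) stable while \<open>a\<close> may be stable or unstable for the full equation. For the drift
  above with \<open>p = 5\<close> and \<open>\<beta>\<close> such that \<open>f'(0) = 0\<close>, the cubic coefficient at \<open>0\<close> is positive and
  \<open>0\<close> is Lyapunov unstable.
\<close>

definition linearly_stable :: "(real \<Rightarrow> real) \<Rightarrow> real \<Rightarrow> bool" where
  "linearly_stable f a \<longleftrightarrow> lyapunov_stable (\<lambda>y. deriv f a * y) UNIV 0"

end

theory Submission
  imports Defs "HOL-Real_Asymp.Real_Asymp"
begin

text \<open>
  Part 1, the fluid limit. In one step only one spin may flip, so the magnetization moves by at
  most \<open>2 / N\<close>. Its expected increment is \<open>drift p \<beta> m / N\<close> up to \<open>O(1 / N\<^sup>2)\<close>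
  (lemma \<open>expected_increment\<close>): flipping spin \<open>i\<close> in a batch costs the energy
  \<open>(2 / p) \<sigma>\<^sub>i \<Sum>\<^sub>j \<sigma>\<^sub>j\<close>, where \<open>j\<close> runs over the other members of the batch, and the number of
  minus spins among them is hypergeometric, hence within \<open>O(1 / N)\<close> of the binomial law that
  appears in \<open>S1\<close> and \<open>S2\<close>. On the time scale \<open>n = N t\<close> the squared distance between the
  magnetization and the solution of the differential equation therefore satisfies a discrete Gronwall
  inequality in the mean (lemma \<open>msd_bound\<close>), and it tends to \<open>0\<close> at every fixed time. The chain
  and the solution are both Lipschitz in time, so closeness at finitely many times gives closeness on
  \<open>[0, T]\<close> (lemma \<open>closeness\<close>). As the limit is a single continuous path, uniform closeness on compact time intervals suffices for weak convergence, with
  the identity as time change (lemma \<open>weak_conv_to_deterministic_path\<close>).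

  The differential equation is scalar with a polynomial drift that points inwards at \<open>-1\<close> and \<open>1\<close>.
  Existence comes from a weighted Picard contraction, and the qualitative statements all come from one
  barrier principle (lemma \<open>barrier_upper\<close>).

  Part 2. For \<open>p = 2\<close> and \<open>p = 3\<close> the drift is \<open>-m\<close> times a function that is positive on \<open>[-1, 1]\<close>.

  Part 3. The derivative of the drift at \<open>0\<close> is a positive multiple of \<open>slope p \<beta>\<close>, a sum over
  \<open>k\<close> in which only the terms with a negative coefficient depend on \<open>\<beta>\<close>, each through a decaying
  exponential. So the slope increases strictly from \<open>-2\<^bsup>p-1\<^esup>\<close> at \<open>\<beta> = 0\<close> to the limit given by the terms
  with \<open>2 k \<le> p - 1\<close>, which is positive as soon as \<open>p \<ge> 4\<close>; \<open>critical_beta p\<close> is its zero. For the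
  asymptotics, symmetrize: with \<open>q = p - 1\<close>, \<open>b = 2 \<beta> / p\<close> and \<open>Z\<close> the absolute value of a sum of \<open>q\<close>
  independent signs,
  \<open>2 slope p \<beta> / 2\<^sup>q = E (Z (1 - exp (- b Z)) - (1 + exp (- b Z)))\<close>.
  Expanding the exponentials and inserting \<open>E Z\<^sup>2 = q\<close>, \<open>E Z \<sim> \<surd>(2 q / \<pi>)\<close> (Wallis) and
  \<open>E Z\<^sup>3 \<sim> 2 q E Z\<close> shows that at \<open>\<beta> = 1 + x / \<surd>p\<close> this is \<open>2 (x - \<surd>(2 / \<pi>)) / \<surd>p\<close> to leading
  order (lemma \<open>slope_asymptotics\<close>). Its sign then locates the zero.
\<close>

section \<open>Scalar differential equations\<close>

text \<open>
  After the last time at which \<open>x \<le> c\<close>, a function that exceeds \<open>c\<close> stays for a while strictly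
  between \<open>c\<close> and \<open>d\<close>, where it cannot increase. Only the sign of the derivative in a thin layer above
  \<open>c\<close> enters; this makes the lemma usable both for the invariance of an interval and for local
  stability.
\<close>

lemma barrier_upper:
  fixes x x' :: "real \<Rightarrow> real"
  assumes der: "\<And>t. t \<ge> 0 \<Longrightarrow> (x has_real_derivative x' t) (at t within {0..})"
    and start: "x 0 \<le> c" and "c < d"
    and sgn: "\<And>t. t \<ge> 0 \<Longrightarrow> c < x t \<Longrightarrow> x t < d \<Longrightarrow> x' t \<le> 0"
    and "t \<ge> 0"
  shows "x t \<le> c"
proof (rule ccontr)
  assume "\<not> x t \<le> c"
  then have t: "x t > c" by simp
  have cont: "continuous_on {0..} x"
    using der by (auto simp: continuous_on_eq_continuous_within intro: DERIV_continuous)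
  define A where "A = {s \<in> {0..t}. x s \<le> c}"
  have cont_t: "continuous_on {0..t} x"
    by (rule continuous_on_subset[OF cont]) auto
  have "closed A"
  proof -
    have "A = x -` {..c} \<inter> {0..t}" by (auto simp: A_def)
    moreover have "closed (x -` {..c} \<inter> {0..t})"
      by (subst Int_commute) (intro continuous_closed_preimage cont_t closed_atMost closed_atLeastAtMost)
    ultimately show ?thesis by simp
  qed
  define s where "s = Sup A"
  have A: "A \<noteq> {}" "bdd_above A"
    using start \<open>t \<ge> 0\<close> by (auto simp: A_def intro!: bdd_aboveI[of _ t])
  then have "s \<in> A" unfolding s_def using \<open>closed A\<close> closed_contains_Sup by blast
  then have s: "0 \<le> s" "s \<le> t" "x s \<le> c" by (auto simp: A_def)
  with t have "s < t" by (metis not_le order_le_less)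
  have above: "x u > c" if "s < u" "u \<le> t" for u
  proof (rule ccontr)
    assume "\<not> x u > c"
    then have "u \<in> A" using that s by (auto simp: A_def)
    then have "u \<le> s" unfolding s_def using A(2) by (rule cSup_upper)
    with that show False by simp
  qed
  have "(x \<longlongrightarrow> x s) (at s within {0..})"
    using cont s by (auto simp: continuous_on_def)
  then have "\<forall>\<^sub>F u in at s within {0..}. x u < d"
    using s \<open>c < d\<close> by (intro order_tendstoD(2)[of _ "x s"]) auto
  then obtain e where e: "e > 0" "\<And>u. u \<in> {0..} \<Longrightarrow> u \<noteq> s \<Longrightarrow> dist u s < e \<Longrightarrow> x u < d"
    unfolding eventually_at by auto
  define u where "u = min t (s + e / 2)"
  have u: "s < u" "u \<le> t" "u < s + e" using e \<open>s < t\<close> by (auto simp: u_def min_def)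
  have "x s \<ge> x u"
  proof (rule DERIV_nonpos_imp_decreasing_open[where f = x and a = s and b = u])
    show "continuous_on {s..u} x" by (rule continuous_on_subset[OF cont]) (use s in auto)
    fix r assume r: "s < r" "r < u"
    have "at r within {0..} = at r"
      by (rule at_within_interior) (use r s in auto)
    then have "(x has_real_derivative x' r) (at r)"
      using der[of r] r s by simp
    moreover have "x' r \<le> 0"
      using sgn[of r] above[of r] e(2)[of r] r u s by (auto simp: dist_real_def)
    ultimately show "\<exists>y. (x has_real_derivative y) (at r) \<and> y \<le> 0" by blast
  qed (use u in simp)
  with above[of u] u s show False by simp
qed

lemma barrier_lower:
  fixes x x' :: "real \<Rightarrow> real"
  assumes der: "\<And>t. t \<ge> 0 \<Longrightarrow> (x has_real_derivative x' t) (at t within {0..})"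
    and start: "c \<le> x 0" and "d < c"
    and sgn: "\<And>t. t \<ge> 0 \<Longrightarrow> d < x t \<Longrightarrow> x t < c \<Longrightarrow> x' t \<ge> 0"
    and "t \<ge> 0"
  shows "c \<le> x t"
  using barrier_upper[of "\<lambda>t. - x t" "\<lambda>t. - x' t" "- c" "- d" t] assms
  by (auto intro!: DERIV_minus)

text \<open>
  The substitution \<open>x t = exp (2 L t) * y t\<close> turns the Picard operator into a contraction with factor
  \<open>1 / 2\<close> on the bounded continuous functions, so that Banach's theorem gives the solution on all of
  \<open>[0, \<infinity>)\<close> at once. The bound on \<open>g\<close> keeps the operator within bounded
  functions. Functions on \<open>[0, \<infinity>)\<close> are extended to the real line through \<open>max 0 t\<close>.
\<close>

lemma picard_lindelof_global:
  fixes g :: "real \<Rightarrow> real"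
  assumes lip: "\<And>a b. \<bar>g a - g b\<bar> \<le> L * \<bar>a - b\<bar>"
    and bd: "\<And>a. \<bar>g a\<bar> \<le> G" and "L > 0"
  obtains x where "x 0 = x0" "\<And>t. t \<ge> 0 \<Longrightarrow> (x has_real_derivative g (x t)) (at t within {0..})"
proof -
  have g_cont: "continuous_on UNIV g"
  proof (rule lipschitz_on_continuous_on[of L])
    show "L-lipschitz_on UNIV g"
      using lip \<open>L > 0\<close> by (auto intro!: lipschitz_onI simp: dist_real_def)
  qed
  define I where "I y t = integral {0..t} (\<lambda>s. g (exp (2 * L * s) * y s))" for y :: "real \<Rightarrow> real" and t
  define \<Phi> where "\<Phi> y t = exp (- 2 * L * max 0 t) * (x0 + I y (max 0 t))" for y :: "real \<Rightarrow> real" and t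
  have int_cont: "continuous_on A (\<lambda>s. g (exp (2 * L * s) * y s))" if "continuous_on UNIV y" for y A
    by (rule continuous_on_compose2[OF g_cont])
       (auto intro!: continuous_intros continuous_on_subset[OF that])
  have I_der: "(I y has_real_derivative g (exp (2 * L * t) * y t)) (at t within {0..b})"
    if "continuous_on UNIV y" "t \<in> {0..b}" for y t b
    unfolding I_def by (rule integral_has_real_derivative[OF int_cont[OF that(1)] that(2)])
  have I_cont: "continuous_on {0..b} (I y)" if "continuous_on UNIV y" for y b
    using I_der[OF that] by (meson DERIV_continuous continuous_on_eq_continuous_within)
  have I_cont': "continuous_on {0..} (I y)" if "continuous_on UNIV y" for y
  proof -
    have "continuous (at t within {0..}) (I y)" if "t \<ge> 0" for t
    proof -
      have "continuous (at t within {0..t+1}) (I y)"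
        using I_cont[OF \<open>continuous_on UNIV y\<close>, of "t+1"] \<open>t \<ge> 0\<close>
        by (auto simp: continuous_on_eq_continuous_within)
      moreover have "at t within {0..t+1} = at t within {0..}"
        by (rule at_within_nhd[of _ "{..<t+1}"]) auto
      ultimately show ?thesis by simp
    qed
    then show ?thesis by (auto simp: continuous_on_eq_continuous_within)
  qed
  have I_bound: "\<bar>I y t\<bar> \<le> G * t" if "continuous_on UNIV y" "t \<ge> 0" for y t
  proof -
    have "norm (I y t) \<le> integral {0..t} (\<lambda>s. G)"
      unfolding I_def
      by (rule integral_norm_bound_integral)
         (auto intro!: integrable_continuous_interval int_cont that bd)
    then show ?thesis using that by (simp add: mult.commute)
  qed
  have mem: "\<Phi> y \<in> bcontfun" if "continuous_on UNIV y" for y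
    unfolding bcontfun_def
  proof safe
    have "continuous_on UNIV (\<lambda>t. I y (max 0 t))"
      by (rule continuous_on_compose2[OF I_cont'[OF that]]) (auto intro!: continuous_intros simp: le_max_iff_disj)
    then show "continuous_on UNIV (\<Phi> y)"
      unfolding \<Phi>_def by (intro continuous_intros)
    have "\<bar>\<Phi> y t\<bar> \<le> \<bar>x0\<bar> + G / (2 * L)" for t
    proof -
      define u where "u = max 0 t"
      have u: "u \<ge> 0" by (simp add: u_def)
      have G: "G \<ge> 0" using bd[of 0] by linarith
      have e1: "exp (- 2 * L * u) \<le> 1" using u \<open>L > 0\<close> by simp
      have "2 * L * u \<le> exp (2 * L * u)" using exp_ge_add_one_self[of "2*L*u"] by linarith
      then have "u \<le> exp (2 * L * u) / (2 * L)"
        using \<open>L > 0\<close> by (simp add: field_simps)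
      then have "exp (- 2 * L * u) * u \<le> exp (- 2 * L * u) * (exp (2 * L * u) / (2 * L))"
        by (intro mult_left_mono) auto
      also have "\<dots> = 1 / (2 * L)" by (simp flip: exp_add)
      finally have e2: "exp (- 2 * L * u) * u \<le> 1 / (2 * L)" .
      have "\<bar>\<Phi> y t\<bar> = exp (- 2 * L * u) * \<bar>x0 + I y u\<bar>"
        by (simp add: \<Phi>_def u_def abs_mult)
      also have "\<dots> \<le> exp (- 2 * L * u) * (\<bar>x0\<bar> + G * u)"
        using I_bound[OF that u] by (intro mult_left_mono) (auto intro: order.trans[OF abs_triangle_ineq])
      also have "\<dots> = exp (- 2 * L * u) * \<bar>x0\<bar> + G * (exp (- 2 * L * u) * u)"
        by (simp add: algebra_simps)
      also have "\<dots> \<le> 1 * \<bar>x0\<bar> + G * (1 / (2 * L))"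
        by (intro add_mono mult_right_mono mult_left_mono e1 e2 G) auto
      finally show ?thesis by simp
    qed
    then show "bounded (range (\<Phi> y))"
      by (intro boundedI) auto
  qed
  define F where "F y = Bcontfun (\<Phi> (apply_bcontfun y))" for y :: "real \<Rightarrow>\<^sub>C real"
  have F_apply: "apply_bcontfun (F y) = \<Phi> (apply_bcontfun y)" for y
    unfolding F_def by (rule Bcontfun_inverse) (auto intro: mem)
  have contr: "dist (F y) (F z) \<le> 1 / 2 * dist y z" for y z
  proof (rule dist_bound)
    fix t :: real
    define u where "u = max 0 t"
    have u: "u \<ge> 0" by (simp add: u_def)
    define D where "D = dist y z"
    have D: "\<bar>y s - z s\<bar> \<le> D" for s
      using dist_bounded[of y s z] by (simp add: dist_real_def D_def)
    have ftc: "((\<lambda>s. L * exp (2 * L * s) * D) has_integral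
        (exp (2 * L * u) * D / 2 - exp (2 * L * 0) * D / 2)) {0..u}"
      using u \<open>L > 0\<close> by (intro fundamental_theorem_of_calculus)
        (auto intro!: derivative_eq_intros simp flip: has_real_derivative_iff_has_vector_derivative)
    have "norm (I y u - I z u) \<le> integral {0..u} (\<lambda>s. L * exp (2 * L * s) * D)"
      unfolding I_def
    proof (subst integral_diff[symmetric])
      show "norm (integral {0..u} (\<lambda>s. g (exp (2 * L * s) * y s) - g (exp (2 * L * s) * z s)))
        \<le> integral {0..u} (\<lambda>s. L * exp (2 * L * s) * D)"
      proof (rule integral_norm_bound_integral)
        fix s
        have "\<bar>g (exp (2 * L * s) * y s) - g (exp (2 * L * s) * z s)\<bar>
            \<le> L * \<bar>exp (2 * L * s) * y s - exp (2 * L * s) * z s\<bar>" by (rule lip)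
        also have "\<dots> = L * (exp (2 * L * s) * \<bar>y s - z s\<bar>)"
          by (simp add: abs_mult flip: right_diff_distrib)
        also have "\<dots> \<le> L * (exp (2 * L * s) * D)"
          using D \<open>L > 0\<close> by (intro mult_left_mono) auto
        finally show "norm (g (exp (2 * L * s) * y s) - g (exp (2 * L * s) * z s))
            \<le> L * exp (2 * L * s) * D" by (simp add: mult.assoc)
      qed (auto intro!: integrable_continuous_interval continuous_intros int_cont)
    qed (auto intro!: integrable_continuous_interval int_cont)
    also have "\<dots> = (exp (2 * L * u) - 1) * D / 2"
      unfolding integral_unique[OF ftc] by (simp add: field_simps)
    finally have "\<bar>I y u - I z u\<bar> \<le> (exp (2 * L * u) - 1) * D / 2" by simp
    then have "exp (- 2 * L * u) * \<bar>I y u - I z u\<bar> \<le> exp (- 2 * L * u) * ((exp (2 * L * u) - 1) * D / 2)"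
      by (intro mult_left_mono) auto
    also have "\<dots> = (1 - exp (- 2 * L * u)) * D / 2"
      by (simp add: algebra_simps flip: exp_add)
    also have "\<dots> \<le> 1 * D / 2"
      using D[of 0] by (intro divide_right_mono mult_right_mono) auto
    finally have "exp (- 2 * L * u) * \<bar>I y u - I z u\<bar> \<le> D / 2" by simp
    moreover have "\<Phi> y t - \<Phi> z t = exp (- 2 * L * u) * (I y u - I z u)"
      by (simp add: \<Phi>_def u_def algebra_simps)
    ultimately show "dist (F y t) (F z t) \<le> 1 / 2 * dist y z"
      by (simp add: F_apply dist_real_def D_def abs_mult)
  qed
  have "\<exists>!y. F y = y"
    by (rule banach_fix_type[of "1/2"]) (use contr in auto)
  then obtain y where y: "F y = y" by blast
  define x where "x t = exp (2 * L * t) * y t" for t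
  have x_eq: "x t = x0 + I y t" if "t \<ge> 0" for t
  proof -
    have "y t = exp (- 2 * L * t) * (x0 + I y t)"
      using arg_cong[OF y, of "\<lambda>y. apply_bcontfun y t"] that by (simp add: F_apply \<Phi>_def)
    then show ?thesis unfolding x_def by (simp add: mult.assoc[symmetric] flip: exp_add)
  qed
  show ?thesis
  proof (rule that)
    show "x 0 = x0" using x_eq[of 0] by (simp add: I_def)
    fix t :: real assume t: "t \<ge> 0"
    have "(I y has_real_derivative g (x t)) (at t within {0..t+1})"
      using I_der[of y t "t+1"] t by (simp add: x_def)
    moreover have "at t within {0..t+1} = at t within {0..}"
      by (rule at_within_nhd[of _ "{..<t+1}"]) auto
    ultimately have "((\<lambda>t. x0 + I y t) has_real_derivative g (x t)) (at t within {0..})"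
      by (auto intro!: derivative_eq_intros)
    then show "(x has_real_derivative g (x t)) (at t within {0..})"
      by (rule has_field_derivative_transform_within[OF _ zero_less_one]) (use t x_eq in auto)
  qed
qed

text \<open>
  Freezing \<open>f\<close> at its boundary values outside \<open>[-1, 1]\<close> makes it globally Lipschitz and bounded. As
  \<open>f\<close> points inwards at both ends, the solution of the modified equation never leaves the interval,
  where the two equations agree.
\<close>

lemma ode_solution_exists:
  assumes lip: "\<And>a b. a \<in> {-1..1} \<Longrightarrow> b \<in> {-1..1} \<Longrightarrow> \<bar>f a - f b\<bar> \<le> L * \<bar>a - b\<bar>"
    and "L > 0" and inward: "f (-1) \<ge> 0" "f 1 \<le> 0" and "x0 \<in> {-1..1}"
  obtains x where "ode_solution f {-1..1} x" "x 0 = x0"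
proof -
  define clamp where "clamp a = max (-1) (min 1 a)" for a :: real
  have clamp: "clamp a \<in> {-1..1}" "\<bar>clamp a - clamp b\<bar> \<le> \<bar>a - b\<bar>" for a b
    by (auto simp: clamp_def)
  have clamp_id: "clamp a = a" if "a \<in> {-1..1}" for a using that by (auto simp: clamp_def)
  have 1: "\<bar>f (clamp a) - f (clamp b)\<bar> \<le> L * \<bar>a - b\<bar>" for a b
  proof -
    have "\<bar>f (clamp a) - f (clamp b)\<bar> \<le> L * \<bar>clamp a - clamp b\<bar>"
      by (intro lip clamp)
    also have "\<dots> \<le> L * \<bar>a - b\<bar>" using clamp(2) \<open>L > 0\<close> by (intro mult_left_mono) auto
    finally show ?thesis .
  qed
  have 2: "\<bar>f (clamp a)\<bar> \<le> \<bar>f 0\<bar> + L" for a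
  proof -
    have "\<bar>f (clamp a) - f 0\<bar> \<le> L * \<bar>clamp a - 0\<bar>" using lip[of "clamp a" 0] clamp(1)[of a] by auto
    also have "\<dots> \<le> L * 1" using clamp(1)[of a] \<open>L > 0\<close> by (intro mult_left_mono) auto
    finally show ?thesis by linarith
  qed
  obtain x where x: "x 0 = x0"
    "\<And>t. t \<ge> 0 \<Longrightarrow> (x has_real_derivative f (clamp (x t))) (at t within {0..})"
    using picard_lindelof_global[of "\<lambda>a. f (clamp a)" L "\<bar>f 0\<bar> + L" x0] 1 2 \<open>L > 0\<close> by blast
  have hi: "x t \<le> 1" if "t \<ge> 0" for t
    by (rule barrier_upper[where x = x and t = t and d = 2 and x' = "\<lambda>t. f (clamp (x t))"])
       (use x assms that in \<open>auto simp: clamp_def\<close>)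
  have lo: "-1 \<le> x t" if "t \<ge> 0" for t
    by (rule barrier_lower[where x = x and t = t and d = "-2" and x' = "\<lambda>t. f (clamp (x t))"])
       (use x assms that in \<open>auto simp: clamp_def\<close>)
  have "ode_solution f {-1..1} x"
    unfolding ode_solution_def
  proof safe
    fix t :: real assume "t \<ge> 0"
    then show "x t \<in> {-1..1}" using hi lo by auto
    with x(2)[OF \<open>t \<ge> 0\<close>] show "(x has_real_derivative f (x t)) (at t within {0..})"
      by (simp add: clamp_id)
  qed
  with x(1) that show ?thesis by blast
qed

text \<open>
  Gronwall's argument: \<open>exp (- 2 L t) (x t - y t)\<^sup>2\<close> is nonincreasing and starts at \<open>0\<close>.
\<close>

lemma ode_solution_unique:
  assumes lip: "\<And>a b. a \<in> I \<Longrightarrow> b \<in> I \<Longrightarrow> \<bar>f a - f b\<bar> \<le> L * \<bar>a - b\<bar>"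
    and x: "ode_solution f I x" and y: "ode_solution f I y" and "x 0 = y 0" and "t \<ge> 0"
  shows "x t = y t"
proof -
  define w where "w t = exp (- 2 * L * t) * (x t - y t)\<^sup>2" for t
  define w' where "w' t = exp (- 2 * L * t) * (2 * (x t - y t) * (f (x t) - f (y t)) - 2 * L * (x t - y t)\<^sup>2)" for t
  have "w t \<le> 0"
  proof (rule barrier_upper[where x = w and t = t and d = 1 and x' = w'])
    show "(w has_real_derivative w' t) (at t within {0..})" if "t \<ge> 0" for t
    proof -
      have "(x has_real_derivative f (x t)) (at t within {0..})"
        "(y has_real_derivative f (y t)) (at t within {0..})"
        using x y that by (auto simp: ode_solution_def)
      then show ?thesis
        unfolding w_def w'_def by (auto intro!: derivative_eq_intros simp: algebra_simps power2_eq_square)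
    qed
    fix t :: real assume "t \<ge> 0"
    then have "\<bar>f (x t) - f (y t)\<bar> \<le> L * \<bar>x t - y t\<bar>"
      using x y by (intro lip) (auto simp: ode_solution_def)
    then have "\<bar>x t - y t\<bar> * \<bar>f (x t) - f (y t)\<bar> \<le> \<bar>x t - y t\<bar> * (L * \<bar>x t - y t\<bar>)"
      by (intro mult_left_mono) auto
    then have "(x t - y t) * (f (x t) - f (y t)) \<le> L * (x t - y t)\<^sup>2"
      using abs_ge_self[of "(x t - y t) * (f (x t) - f (y t))"]
      by (simp add: power2_eq_square abs_mult mult_ac)
    then have "2 * (x t - y t) * (f (x t) - f (y t)) - 2 * L * (x t - y t)\<^sup>2 \<le> 0"
      unfolding mult.assoc by linarith
    then show "w' t \<le> 0" unfolding w'_def by (intro mult_nonneg_nonpos) auto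
  qed (use assms in \<open>auto simp: w_def\<close>)
  then have "(x t - y t)\<^sup>2 \<le> 0" by (simp add: w_def mult_le_0_iff)
  then show ?thesis by simp
qed

subsection \<open>Stability of the equilibrium at the origin\<close>

lemma lyapunov_stable_if_inward:
  assumes "e > 0" and inward: "\<And>y. y \<in> I \<Longrightarrow> \<bar>y\<bar> < e \<Longrightarrow> y * f y \<le> 0"
  shows "lyapunov_stable f I 0"
  unfolding lyapunov_stable_def
proof (intro allI impI)
  fix \<epsilon> :: real assume "\<epsilon> > 0"
  define d where "d = min e \<epsilon>"
  have d: "d > 0" "d \<le> e" "d \<le> \<epsilon>" using assms \<open>\<epsilon> > 0\<close> by (auto simp: d_def)
  show "\<exists>\<delta>>0. \<forall>x. ode_solution f I x \<and> \<bar>x 0 - 0\<bar> < \<delta> \<longrightarrow> (\<forall>t\<ge>0. \<bar>x t - 0\<bar> < \<epsilon>)"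
  proof (intro exI[of _ "d / 2"] conjI allI impI)
    fix x and t :: real
    assume x: "ode_solution f I x \<and> \<bar>x 0 - 0\<bar> < d / 2" and t: "t \<ge> 0"
    then have sol: "x t \<in> I" "(x has_real_derivative f (x t)) (at t within {0..})" if "t \<ge> 0" for t
      using that by (auto simp: ode_solution_def)
    have in_t: "x t * f (x t) \<le> 0" if "t \<ge> 0" "\<bar>x t\<bar> < d" for t
      using inward[of "x t"] sol(1)[of t] that d by auto
    have "x t \<le> d / 2"
    proof (rule barrier_upper[where x = x and t = t and d = d and x' = "\<lambda>t. f (x t)"])
      fix t :: real assume "t \<ge> 0" "d / 2 < x t" "x t < d"
      with in_t[of t] d show "f (x t) \<le> 0" by (auto simp: mult_le_0_iff)
    qed (use x sol d t in auto)
    moreover have "- (d / 2) \<le> x t"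
    proof (rule barrier_lower[where x = x and t = t and d = "- d" and x' = "\<lambda>t. f (x t)"])
      fix t :: real assume "t \<ge> 0" "- d < x t" "x t < - (d / 2)"
      with in_t[of t] d show "f (x t) \<ge> 0" by (auto simp: mult_le_0_iff)
    qed (use x sol d t in auto)
    ultimately show "\<bar>x t - 0\<bar> < \<epsilon>" using d by auto
  qed (use d in auto)
qed

text \<open>
  A solution that starts at \<open>a > 0\<close> and remains within \<open>e\<close> never falls below \<open>a\<close>, since its derivative
  is nonnegative there; so its speed is at least \<open>c * a\<close> for ever, and it cannot remain within
  \<open>e\<close>. Without the existence of solutions every point would be stable.
\<close>

lemma not_lyapunov_stable_if_repelling:
  assumes "e > 0" "c > 0" and rep: "\<And>y. y \<in> I \<Longrightarrow> 0 < y \<Longrightarrow> y < e \<Longrightarrow> f y \<ge> c * y"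
    and ex: "\<And>y. 0 < y \<Longrightarrow> y < e \<Longrightarrow> \<exists>x. ode_solution f I x \<and> x 0 = y"
  shows "\<not> lyapunov_stable f I 0"
proof
  assume "lyapunov_stable f I 0"
  then obtain \<delta> where \<delta>: "\<delta> > 0"
    "\<And>x t. ode_solution f I x \<Longrightarrow> \<bar>x 0\<bar> < \<delta> \<Longrightarrow> t \<ge> 0 \<Longrightarrow> \<bar>x t\<bar> < e"
    using \<open>e > 0\<close> unfolding lyapunov_stable_def diff_zero by blast
  define a where "a = min \<delta> e / 2"
  have a: "a > 0" "a < \<delta>" "a < e" using \<delta>(1) \<open>e > 0\<close> by (auto simp: a_def)
  obtain x where x: "ode_solution f I x" "x 0 = a" using ex a by blast
  have small: "\<bar>x t\<bar> < e" if "t \<ge> 0" for t using \<delta>(2)[OF x(1)] x(2) a that by auto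
  have sol: "x t \<in> I" "(x has_real_derivative f (x t)) (at t within {0..})" if "t \<ge> 0" for t
    using x(1) that by (auto simp: ode_solution_def)
  have low: "f (x t) \<ge> c * x t" if "t \<ge> 0" "x t > 0" for t
    using rep[of "x t"] small[of t] sol(1)[of t] that by auto
  have ge_a: "a \<le> x t" if "t \<ge> 0" for t
  proof (rule barrier_lower[where x = x and t = t and d = 0 and x' = "\<lambda>t. f (x t)"])
    fix t :: real assume t: "t \<ge> 0" "0 < x t"
    have "0 \<le> c * x t" using t \<open>c > 0\<close> by simp
    also have "\<dots> \<le> f (x t)" using low t by blast
    finally show "0 \<le> f (x t)" .
  qed (use x a sol that in auto)
  have grow: "a \<le> x t - c * a * t" if "t \<ge> 0" for t
  proof (rule barrier_lower[where t = t and d = "a - 1" and x = "\<lambda>t. x t - c * a * t" and x' = "\<lambda>t. f (x t) - c * a"])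
    fix t :: real assume t: "t \<ge> 0"
    show "((\<lambda>t. x t - c * a * t) has_real_derivative f (x t) - c * a) (at t within {0..})"
      using sol(2)[OF t] by (auto intro!: derivative_eq_intros)
    have "c * a \<le> c * x t" using ge_a[OF t] \<open>c > 0\<close> by simp
    also have "\<dots> \<le> f (x t)" using low ge_a[OF t] a t by auto
    finally show "f (x t) - c * a \<ge> 0" by simp
  qed (use x that in auto)
  have "e / (c * a) \<ge> 0" using \<open>e > 0\<close> \<open>c > 0\<close> a by simp
  from grow[OF this] small[OF this] a \<open>c > 0\<close> show False by (simp add: field_simps)
qed

text \<open>
  In the neutral case \<open>c = 0\<close> all solutions are constant, so the origin is stable.
\<close>

lemma lyapunov_stable_linear_iff: "lyapunov_stable (\<lambda>y. c * y) UNIV 0 \<longleftrightarrow> c \<le> 0"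
proof
  assume st: "lyapunov_stable (\<lambda>y. c * y) UNIV 0"
  show "c \<le> 0"
  proof (rule ccontr)
    assume "\<not> c \<le> 0"
    then have "\<not> lyapunov_stable (\<lambda>y. c * y) UNIV 0"
    proof (intro not_lyapunov_stable_if_repelling[of 1 c])
      fix y :: real
      have "ode_solution (\<lambda>y. c * y) UNIV (\<lambda>t. y * exp (c * t))"
        unfolding ode_solution_def by (auto intro!: derivative_eq_intros)
      then show "\<exists>x. ode_solution (\<lambda>y. c * y) UNIV x \<and> x 0 = y"
        by (intro exI[of _ "\<lambda>t. y * exp (c * t)"]) auto
    qed auto
    with st show False by simp
  qed
next
  assume "c \<le> 0"
  then show "lyapunov_stable (\<lambda>y. c * y) UNIV 0"
    by (intro lyapunov_stable_if_inward[of 1]) (auto simp: mult_le_0_iff zero_le_mult_iff)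
qed

lemma linearly_stable_iff: "linearly_stable f a \<longleftrightarrow> deriv f a \<le> 0"
  unfolding linearly_stable_def by (rule lyapunov_stable_linear_iff)

lemma slope_close_to_derivative:
  fixes f :: "real \<Rightarrow> real"
  assumes "(f has_real_derivative c) (at 0)" "f 0 = 0" "r > 0"
  obtains e where "e > 0" "\<And>y. \<bar>y\<bar> < e \<Longrightarrow> \<bar>f y - c * y\<bar> \<le> r * \<bar>y\<bar>"
proof -
  have "((\<lambda>h. f h / h) \<longlongrightarrow> c) (at 0)"
    using assms(1,2) by (simp add: has_field_derivative_iff)
  then obtain e where e: "e > 0" "\<And>y. y \<noteq> 0 \<Longrightarrow> \<bar>y\<bar> < e \<Longrightarrow> \<bar>f y / y - c\<bar> < r"
    using \<open>r > 0\<close> unfolding tendsto_iff eventually_at dist_real_def diff_zero by blast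
  show ?thesis
  proof (rule that[OF e(1)])
    fix y assume y: "\<bar>y\<bar> < e"
    show "\<bar>f y - c * y\<bar> \<le> r * \<bar>y\<bar>"
    proof (cases "y = 0")
      case False
      have "f y - c * y = (f y / y - c) * y" using False by (simp add: field_simps)
      then have "\<bar>f y - c * y\<bar> = \<bar>f y / y - c\<bar> * \<bar>y\<bar>" by (simp add: abs_mult)
      also have "\<dots> \<le> r * \<bar>y\<bar>" using e(2)[OF False y] by (intro mult_right_mono) auto
      finally show ?thesis .
    qed (use assms in simp)
  qed
qed

lemma lyapunov_stable_if_deriv_neg:
  assumes "(f has_real_derivative c) (at 0)" "f 0 = 0" "c < 0"
  shows "lyapunov_stable f I 0"
proof -
  obtain e where e: "e > 0" "\<And>y. \<bar>y\<bar> < e \<Longrightarrow> \<bar>f y - c * y\<bar> \<le> - c * \<bar>y\<bar>"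
    using slope_close_to_derivative[OF assms(1,2), of "- c"] assms(3) by auto
  show ?thesis
  proof (rule lyapunov_stable_if_inward[OF e(1)])
    fix y assume "\<bar>y\<bar> < e"
    from e(2)[OF this] show "y * f y \<le> 0"
      using \<open>c < 0\<close> by (cases "y \<ge> 0") (auto simp: mult_le_0_iff abs_le_iff)
  qed
qed

lemma not_lyapunov_stable_if_deriv_pos:
  assumes "(f has_real_derivative c) (at 0)" "f 0 = 0" "c > 0" "\<epsilon> > 0"
    and ex: "\<And>y. 0 < y \<Longrightarrow> y < \<epsilon> \<Longrightarrow> \<exists>x. ode_solution f I x \<and> x 0 = y"
  shows "\<not> lyapunov_stable f I 0"
proof -
  obtain e where e: "e > 0" "\<And>y. \<bar>y\<bar> < e \<Longrightarrow> \<bar>f y - c * y\<bar> \<le> c / 2 * \<bar>y\<bar>"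
    using slope_close_to_derivative[OF assms(1,2), of "c/2"] assms(3) by auto
  show ?thesis
  proof (rule not_lyapunov_stable_if_repelling[of "min e \<epsilon>" "c / 2"])
    fix y assume "0 < y" "y < min e \<epsilon>"
    with e(2)[of y] show "c / 2 * y \<le> f y" by (auto simp: abs_if split: if_splits)
  qed (use assms e in auto)
qed

section \<open>One step of the dynamics\<close>

subsection \<open>Sampling without replacement\<close>

lemma card_subsets_with_intersection:
  assumes "finite U" "M \<subseteq> U" "k \<le> q"
  shows "card {D. D \<subseteq> U \<and> card D = q \<and> card (D \<inter> M) = k}
    = (card M choose k) * (card (U - M) choose (q - k))"
proof -
  have fin: "finite M" "finite (U - M)" using assms finite_subset by auto
  let ?X = "{X. X \<subseteq> M \<and> card X = k} \<times> {Y. Y \<subseteq> U - M \<and> card Y = q - k}"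
  have "bij_betw (\<lambda>(X, Y). X \<union> Y) ?X {D. D \<subseteq> U \<and> card D = q \<and> card (D \<inter> M) = k}"
  proof (rule bij_betw_byWitness[where f' = "\<lambda>D. (D \<inter> M, D - M)"])
    show "(\<lambda>(X, Y). X \<union> Y) ` ?X \<subseteq> {D. D \<subseteq> U \<and> card D = q \<and> card (D \<inter> M) = k}"
    proof safe
      fix X Y assume XY: "X \<subseteq> M" "Y \<subseteq> U - M" "card Y = q - card X" "k = card X"
      have "finite X" "finite Y" using XY fin finite_subset by metis+
      then have "card (X \<union> Y) = card X + card Y"
        using XY by (intro card_Un_disjoint) auto
      then show "card (X \<union> Y) = q" using XY assms by simp
      have "(X \<union> Y) \<inter> M = X" using XY by auto
      then show "card ((X \<union> Y) \<inter> M) = card X" by simp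
    qed (use assms in auto)
    show "(\<lambda>D. (D \<inter> M, D - M)) ` {D. D \<subseteq> U \<and> card D = q \<and> card (D \<inter> M) = k} \<subseteq> ?X"
    proof safe
      fix D assume D: "D \<subseteq> U" "q = card D" "k = card (D \<inter> M)"
      then have "finite D" using assms finite_subset by auto
      then show "card (D - M) = card D - card (D \<inter> M)"
        by (simp add: card_Diff_subset_Int)
    qed auto
  qed auto
  then have "card {D. D \<subseteq> U \<and> card D = q \<and> card (D \<inter> M) = k} = card ?X"
    by (rule bij_betw_same_card[symmetric])
  also have "\<dots> = (card M choose k) * (card (U - M) choose (q - k))"
    using fin by (simp add: card_cartesian_product n_subsets)
  finally show ?thesis .
qed

text \<open>
  The number \<open>a\<close> is the size of a spin class in a population of \<open>N\<close> from which one spin has been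
  set aside; the class has size \<open>c \<in> {a, a + 1}\<close> in the full population.
\<close>

lemma falling_factorial_approx:
  fixes c :: real and N :: nat
  assumes "N > 0" "k \<le> N" "a \<le> N" "real a \<le> c" "c \<le> real a + 1" "c \<le> N"
  shows "\<bar>(\<Prod>i<k. (real a - real i) / N) - (c / N) ^ k\<bar> \<le> k * k / N"
proof -
  have "norm ((\<Prod>i<k. (real a - real i) / N) - (\<Prod>i<k. c / N))
      \<le> (\<Sum>i<k. norm ((real a - real i) / N - c / N))"
  proof (rule norm_prod_diff)
    fix i assume "i \<in> {..<k}"
    then have "\<bar>real a - real i\<bar> \<le> real N" using assms by auto
    then show "norm ((real a - real i) / N) \<le> 1" using assms by (simp add: divide_simps)
    show "norm (c / N) \<le> 1" using assms by (simp add: divide_simps)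
  qed
  also have "\<dots> \<le> (\<Sum>i<k. real k / N)"
  proof (rule sum_mono)
    fix i assume "i \<in> {..<k}"
    then have "\<bar>real a - real i - c\<bar> \<le> real k" using assms by auto
    then show "norm ((real a - real i) / N - c / N) \<le> real k / N"
      using assms by (simp add: divide_right_mono flip: diff_divide_distrib)
  qed
  finally show ?thesis by simp
qed

text \<open>
  The hypergeometric law is compared with the binomial one. The former gives \<open>k\<close> the weight
  \<open>(q choose k) F a k F b (q - k) / F (a + b) q\<close>, where \<open>F n k\<close> is the falling factorial
  \<open>n (n - 1) \<dots> (n - k + 1)\<close> divided by \<open>N\<^sup>k\<close>; each of the three factors differs from the power that it
  approximates by at most \<open>q\<^sup>2 / N\<close>. The binomial parameter \<open>c / N\<close> refers to the population before
  one element is set aside, hence the two possible values of \<open>c\<close>.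
\<close>

lemma sampling_without_replacement_approx:
  fixes w :: "nat \<Rightarrow> real" and c :: nat
  assumes U: "finite U" "card U + 1 = N" and M: "M \<subseteq> U"
    and c: "card M \<le> c" "c \<le> card M + 1" and q: "q \<le> card U" and w: "\<And>k. \<bar>w k\<bar> \<le> 1"
  shows "\<bar>(\<Sum>D | D \<subseteq> U \<and> card D = q. w (card (D \<inter> M))) / (card U choose q)
      - (\<Sum>k\<le>q. (q choose k) * (c / N) ^ k * (1 - c / N) ^ (q - k) * w k)\<bar>
    \<le> (real q + 1 + 2 * 2 ^ q) * q\<^sup>2 / N"
proof -
  define a b where "a = card M" and "b = card (U - M)"
  have finM: "finite M" using U M finite_subset by auto
  have ab: "a + b = card U" using U M finM card_mono[OF U(1) M]
    by (simp add: a_def b_def card_Diff_subset)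
  have N: "N > 0" "q < N" "a \<le> N" "b \<le> N" "c \<le> N" using U q ab c by (auto simp: a_def)
  define F where "F n k = (\<Prod>i<k. (real n - real i) / N)" for n k :: nat
  have choose_F: "real (n choose k) * fact k = F n k * real N ^ k" for n k
    using N by (simp add: F_def binomial_gbinomial gbinomial_prod_rev prod_dividef
        atLeast0LessThan power_mult_distrib)
  define h where "h k = real ((a choose k) * (b choose (q - k))) / (card U choose q)" for k
  have pos: "(card U choose q) > 0" using q by simp
  define T where "T k = {D. D \<subseteq> U \<and> card D = q \<and> card (D \<inter> M) = k}" for k
  have finT: "finite {D. D \<subseteq> U \<and> card D = q}" using U by simp
  have card_T: "card (T k) = (a choose k) * (b choose (q - k))" if "k \<le> q" for k
    using card_subsets_with_intersection[OF U(1) M that] by (simp add: T_def a_def b_def)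
  have h_bounds: "0 \<le> h k" "h k \<le> 1" if "k \<le> q" for k
  proof -
    show "0 \<le> h k" by (simp add: h_def)
    have "card (T k) \<le> card {D. D \<subseteq> U \<and> card D = q}"
      by (rule card_mono[OF finT]) (auto simp: T_def)
    also have "\<dots> = card U choose q" using n_subsets[OF U(1)] .
    finally have "real (card (T k)) \<le> real (card U choose q)" by simp
    then show "h k \<le> 1" using pos unfolding h_def card_T[OF that, symmetric] by simp
  qed
  have "(\<Sum>D | D \<subseteq> U \<and> card D = q. w (card (D \<inter> M)))
      = (\<Sum>k\<le>q. \<Sum>D | D \<in> {D. D \<subseteq> U \<and> card D = q} \<and> card (D \<inter> M) = k. w (card (D \<inter> M)))"
  proof (rule sum.group[symmetric, OF finT])
    show "(\<lambda>D. card (D \<inter> M)) ` {D. D \<subseteq> U \<and> card D = q} \<subseteq> {..q}"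
      using U(1) by (auto intro!: card_mono intro: finite_subset)
  qed simp
  also have "\<dots> = (\<Sum>k\<le>q. real (card (T k)) * w k)"
    by (intro sum.cong refl) (auto simp: T_def conj_assoc)
  finally have lhs: "(\<Sum>D | D \<subseteq> U \<and> card D = q. w (card (D \<inter> M))) / (card U choose q)
      = (\<Sum>k\<le>q. h k * w k)"
    by (simp add: sum_divide_distrib h_def card_T)
  define B where "B k = (c / N) ^ k * (1 - c / N) ^ (q - k)" for k
  have F1: "\<bar>F (card U) q - 1\<bar> \<le> q\<^sup>2 / N"
    using falling_factorial_approx[of N q "card U" "real N"] N U
    by (simp add: F_def power2_eq_square)
  have term_bound: "\<bar>h k - (q choose k) * B k\<bar> \<le> q\<^sup>2 / N + (q choose k) * (2 * q\<^sup>2 / N)" if k: "k \<le> q" for k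
  proof -
    have kk: "real k * real k / N \<le> q\<^sup>2 / N"
      using k by (intro divide_right_mono) (auto simp: power2_eq_square intro!: mult_mono)
    have kk': "real (q - k) * real (q - k) / N \<le> q\<^sup>2 / N"
      by (intro divide_right_mono) (auto simp: power2_eq_square intro!: mult_mono)
    have Fa: "\<bar>F a k - (c / N) ^ k\<bar> \<le> q\<^sup>2 / N"
      unfolding F_def
      by (rule order.trans[OF falling_factorial_approx kk]) (use N c k in \<open>auto simp: a_def\<close>)
    have cN: "1 - c / N = (real N - real c) / N" using N by (simp add: divide_simps)
    have Fb: "\<bar>F b (q - k) - (1 - c / N) ^ (q - k)\<bar> \<le> q\<^sup>2 / N"
      unfolding F_def cN
      by (rule order.trans[OF falling_factorial_approx kk']) (use N c k ab U in \<open>auto simp: a_def\<close>)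
    have Fa1: "\<bar>F a k\<bar> \<le> 1"
    proof -
      have "\<bar>F a k\<bar> = (\<Prod>i<k. \<bar>(real a - real i) / N\<bar>)" unfolding F_def by (rule abs_prod)
      also have "\<dots> \<le> 1"
        using N k by (intro prod_le_1) (auto simp: divide_simps)
      finally show ?thesis .
    qed
    have c1: "\<bar>(1 - c / N) ^ (q - k)\<bar> \<le> 1"
      unfolding power_abs using N by (intro power_le_one) (auto simp: divide_simps)
    have "F a k * F b (q - k) - B k
        = F a k * (F b (q - k) - (1 - c / N) ^ (q - k)) + (F a k - (c / N) ^ k) * (1 - c / N) ^ (q - k)"
      by (simp add: B_def algebra_simps)
    also have "\<bar>\<dots>\<bar> \<le> 1 * (q\<^sup>2 / N) + (q\<^sup>2 / N) * 1"
      by (intro order.trans[OF abs_triangle_ineq] add_mono; unfold abs_mult;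
          intro mult_mono Fa Fb Fa1 c1) auto
    finally have FB: "\<bar>F a k * F b (q - k) - B k\<bar> \<le> 2 * q\<^sup>2 / N" by simp
    have hF: "h k * F (card U) q = (q choose k) * (F a k * F b (q - k))"
    proof -
      have "fact q = real (q choose k) * fact k * fact (q - k)"
        using binomial_fact_lemma[OF k] by (metis (no_types) mult.assoc mult.commute of_nat_fact of_nat_mult)
      then have "real ((a choose k) * (b choose (q - k))) * fact q
        = (q choose k) * (real (a choose k) * fact k) * (real (b choose (q - k)) * fact (q - k))"
        by simp
      also have "\<dots> = (q choose k) * (F a k * F b (q - k)) * (real N ^ k * real N ^ (q - k))"
        unfolding choose_F by (simp add: mult_ac)
      also have "real N ^ k * real N ^ (q - k) = real N ^ q" using k by (simp flip: power_add)
      finally have e1: "real ((a choose k) * (b choose (q - k))) * fact q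
        = (q choose k) * (F a k * F b (q - k)) * real N ^ q" .
      have e2: "real (card U choose q) * fact q = F (card U) q * real N ^ q" by (rule choose_F)
      have "h k * (real (card U choose q) * fact q) = real ((a choose k) * (b choose (q - k))) * fact q"
        using pos by (simp add: h_def)
      then show ?thesis unfolding e1 e2 using N by simp
    qed
    have "h k - (q choose k) * B k = h k * (1 - F (card U) q)
        + (q choose k) * (F a k * F b (q - k) - B k)"
      using hF by (simp add: algebra_simps)
    also have "\<bar>\<dots>\<bar> \<le> 1 * (q\<^sup>2 / N) + (q choose k) * (2 * q\<^sup>2 / N)"
      using h_bounds[OF k] F1 FB
      by (intro order.trans[OF abs_triangle_ineq] add_mono; unfold abs_mult; intro mult_mono) auto
    finally show ?thesis by simp
  qed
  have "\<bar>(\<Sum>k\<le>q. h k * w k) - (\<Sum>k\<le>q. (q choose k) * B k * w k)\<bar>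
      = \<bar>\<Sum>k\<le>q. (h k - (q choose k) * B k) * w k\<bar>"
    by (simp add: sum_subtractf left_diff_distrib)
  also have "\<dots> \<le> (\<Sum>k\<le>q. (q\<^sup>2 / N + (q choose k) * (2 * q\<^sup>2 / N)) * 1)"
    using term_bound w
    by (intro order.trans[OF sum_abs] sum_mono; unfold abs_mult; intro mult_mono)
       (auto intro: order.trans[OF abs_ge_zero])
  also have "\<dots> = (real q + 1) * (q\<^sup>2 / N) + real (\<Sum>k\<le>q. q choose k) * (2 * q\<^sup>2 / N)"
    unfolding of_nat_sum sum_distrib_right sum.distrib mult_1_right by simp
  also have "\<dots> = (real q + 1 + 2 * 2 ^ q) * q\<^sup>2 / N"
    unfolding choose_row_sum using N by (simp add: field_simps)
  finally show ?thesis unfolding lhs by (simp add: B_def mult.assoc)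
qed

subsection \<open>Expectations over one step\<close>

definition batches :: "nat \<Rightarrow> nat \<Rightarrow> nat \<Rightarrow> nat set set" where
  "batches N p i = {C. C \<subseteq> {1..N} \<and> card C = p \<and> i \<in> C}"

definition flip :: "nat \<Rightarrow> (nat \<Rightarrow> real) \<Rightarrow> nat \<Rightarrow> real" where
  "flip i \<sigma> = \<sigma>(i := - \<sigma> i)"

definition acceptance :: "nat \<Rightarrow> real \<Rightarrow> (nat \<Rightarrow> real) \<Rightarrow> nat \<Rightarrow> nat set \<Rightarrow> real" where
  "acceptance p \<beta> \<sigma> i C =
    exp (- \<beta> * max (batch_hamiltonian p (flip i \<sigma>) C - batch_hamiltonian p \<sigma> C) 0)"

text \<open>
  A uniform batch containing \<open>i\<close> is \<open>i\<close> together with a uniform set of \<open>p - 1\<close> other spins.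
\<close>

lemma batches_eq_image:
  assumes "i \<in> {1..N}" "p \<ge> 1"
  shows "batches N p i = insert i ` {D. D \<subseteq> {1..N} - {i} \<and> card D = p - 1}"
proof safe
  fix C assume C: "C \<in> batches N p i"
  then have "finite C" "i \<in> C" by (auto simp: batches_def intro: finite_subset)
  then have "C = insert i (C - {i})" "card (C - {i}) = card C - 1" by auto
  then show "C \<in> insert i ` {D. D \<subseteq> {1..N} - {i} \<and> card D = p - 1}"
    using C by (intro image_eqI[of _ _ "C - {i}"]) (auto simp: batches_def)
next
  fix D assume D: "D \<subseteq> {1..N} - {i}" "card D = p - 1"
  then have "finite D" "i \<notin> D" by (auto intro: finite_subset)
  then show "insert i D \<in> batches N p i" using D assms by (auto simp: batches_def)
qed

lemma sum_batches:
  assumes "i \<in> {1..N}" "p \<ge> 1"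
  shows "(\<Sum>C\<in>batches N p i. f C) = (\<Sum>D | D \<subseteq> {1..N} - {i} \<and> card D = p - 1. f (insert i D))"
proof -
  have "inj_on (insert i) {D. D \<subseteq> {1..N} - {i} \<and> card D = p - 1}"
  proof (rule inj_onI)
    fix x y assume "x \<in> {D. D \<subseteq> {1..N} - {i} \<and> card D = p - 1}"
      "y \<in> {D. D \<subseteq> {1..N} - {i} \<and> card D = p - 1}" and eq: "insert i x = insert i y"
    then have "i \<notin> x" "i \<notin> y" by auto
    with eq show "x = y" by (simp add: insert_ident)
  qed
  then show ?thesis unfolding batches_eq_image[OF assms] by (simp add: sum.reindex)
qed

lemma card_batches:
  assumes "i \<in> {1..N}" "p \<ge> 1"
  shows "card (batches N p i) = (N - 1) choose (p - 1)"
  using sum_batches[OF assms, of "\<lambda>_. 1 :: nat"] assms by (simp add: n_subsets)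

lemma finite_batches [simp]: "finite (batches N p i)"
  unfolding batches_def by (rule finite_subset[of _ "Pow {1..N}"]) auto

lemma batches_nonempty:
  assumes "i \<in> {1..N}" "1 \<le> p" "p \<le> N"
  shows "batches N p i \<noteq> {}"
proof -
  have "card (batches N p i) > 0" unfolding card_batches[OF assms(1,2)] using assms by simp
  then show ?thesis by auto
qed

lemma acceptance_bounds: "\<beta> \<ge> 0 \<Longrightarrow> 0 \<le> acceptance p \<beta> \<sigma> i C \<and> acceptance p \<beta> \<sigma> i C \<le> 1"
  by (auto simp: acceptance_def mult_nonneg_nonneg)

lemma batch_step_altdef:
  "batch_step N p \<beta> \<sigma> = pmf_of_set {1..N} \<bind> (\<lambda>i. pmf_of_set (batches N p i) \<bind>
     (\<lambda>C. bernoulli_pmf (acceptance p \<beta> \<sigma> i C) \<bind>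
       (\<lambda>accept. return_pmf (if accept then flip i \<sigma> else \<sigma>))))"
  unfolding batch_step_def batches_def acceptance_def flip_def Let_def ..

lemma expectation_batch_step:
  fixes \<phi> :: "(nat \<Rightarrow> real) \<Rightarrow> real"
  assumes "1 \<le> p" "p \<le> N" "\<beta> \<ge> 0"
  shows "measure_pmf.expectation (batch_step N p \<beta> \<sigma>) \<phi> =
    (\<Sum>i\<in>{1..N}. (\<Sum>C\<in>batches N p i. \<phi> \<sigma> + acceptance p \<beta> \<sigma> i C * (\<phi> (flip i \<sigma>) - \<phi> \<sigma>))
      / card (batches N p i)) / N"
proof -
  have inner: "measure_pmf.expectation (bernoulli_pmf (acceptance p \<beta> \<sigma> i C) \<bind>
       (\<lambda>accept. return_pmf (if accept then flip i \<sigma> else \<sigma>))) \<phi>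
     = \<phi> \<sigma> + acceptance p \<beta> \<sigma> i C * (\<phi> (flip i \<sigma>) - \<phi> \<sigma>)" for i C
  proof (subst pmf_expectation_bind[of UNIV])
    show "(\<Sum>a\<in>UNIV. pmf (bernoulli_pmf (acceptance p \<beta> \<sigma> i C)) a *\<^sub>R
        measure_pmf.expectation (return_pmf (if a then flip i \<sigma> else \<sigma>)) \<phi>)
      = \<phi> \<sigma> + acceptance p \<beta> \<sigma> i C * (\<phi> (flip i \<sigma>) - \<phi> \<sigma>)"
      using acceptance_bounds[OF assms(3), of p \<sigma> i C] by (simp add: UNIV_bool algebra_simps)
  qed auto
  have middle: "measure_pmf.expectation (pmf_of_set (batches N p i) \<bind>
       (\<lambda>C. bernoulli_pmf (acceptance p \<beta> \<sigma> i C) \<bind>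
       (\<lambda>accept. return_pmf (if accept then flip i \<sigma> else \<sigma>)))) \<phi>
     = (\<Sum>C\<in>batches N p i. \<phi> \<sigma> + acceptance p \<beta> \<sigma> i C * (\<phi> (flip i \<sigma>) - \<phi> \<sigma>))
      / card (batches N p i)" if "i \<in> {1..N}" for i
    using batches_nonempty[OF that assms(1,2)]
    by (subst pmf_expectation_bind_pmf_of_set)
       (auto simp: inner divide_inverse mult.commute sum_distrib_right sum_distrib_left)
  have fin: "finite (set_pmf (pmf_of_set (batches N p i) \<bind>
       (\<lambda>C. bernoulli_pmf (acceptance p \<beta> \<sigma> i C) \<bind>
       (\<lambda>accept. return_pmf (if accept then flip i \<sigma> else \<sigma>)))))" if "i \<in> {1..N}" for i
    using batches_nonempty[OF that assms(1,2)] by auto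
  show ?thesis unfolding batch_step_altdef
    using assms fin
    by (subst pmf_expectation_bind_pmf_of_set)
       (auto simp: middle divide_inverse mult.commute sum_distrib_left sum_distrib_right)
qed

lemma set_pmf_batch_step:
  assumes "1 \<le> p" "p \<le> N" "\<sigma>' \<in> set_pmf (batch_step N p \<beta> \<sigma>)"
  shows "\<sigma>' = \<sigma> \<or> (\<exists>i\<in>{1..N}. \<sigma>' = flip i \<sigma>)"
proof -
  have ne: "set_pmf (pmf_of_set {1..N}) = {1..N}" using assms by (intro set_pmf_of_set) auto
  show ?thesis using assms(3) unfolding batch_step_altdef
    by (auto simp only: set_bind_pmf ne set_return_pmf UN_iff singleton_iff split: if_splits)
qed

lemma finite_spin_configs [simp]: "finite (spin_configs N)"
  unfolding spin_configs_def by (intro finite_PiE) auto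

lemma flip_spin_configs: "\<sigma> \<in> spin_configs N \<Longrightarrow> i \<in> {1..N} \<Longrightarrow> flip i \<sigma> \<in> spin_configs N"
  by (fastforce simp: spin_configs_def flip_def PiE_iff extensional_def)

lemma spin_value: "\<sigma> \<in> spin_configs N \<Longrightarrow> i \<in> {1..N} \<Longrightarrow> \<sigma> i = -1 \<or> \<sigma> i = 1"
  by (auto simp: spin_configs_def PiE_iff)

lemma magnetization_bounds:
  assumes "\<sigma> \<in> spin_configs N"
  shows "magnetization N \<sigma> \<in> {-1..1}"
proof (cases "N = 0")
  case False
  have "\<bar>\<Sum>i\<in>{1..N}. \<sigma> i\<bar> \<le> (\<Sum>i\<in>{1..N}. 1)"
    using spin_value[OF assms] by (intro order.trans[OF sum_abs] sum_mono) force
  then have "\<bar>magnetization N \<sigma>\<bar> \<le> 1"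
    using False by (simp add: magnetization_def divide_simps)
  then show ?thesis by auto
qed (simp add: magnetization_def)

lemma magnetization_flip:
  assumes "i \<in> {1..N}"
  shows "magnetization N (flip i \<sigma>) - magnetization N \<sigma> = - 2 * \<sigma> i / N"
proof -
  have "(\<Sum>j\<in>{1..N}. flip i \<sigma> j) = flip i \<sigma> i + (\<Sum>j\<in>{1..N} - {i}. flip i \<sigma> j)"
    using assms by (intro sum.remove) auto
  also have "(\<Sum>j\<in>{1..N} - {i}. flip i \<sigma> j) = (\<Sum>j\<in>{1..N} - {i}. \<sigma> j)"
    by (intro sum.cong) (auto simp: flip_def)
  also have "\<dots> = (\<Sum>j\<in>{1..N}. \<sigma> j) - \<sigma> i"
    using assms by (simp add: sum_diff1)
  finally show ?thesis
    by (simp add: magnetization_def flip_def flip: diff_divide_distrib)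
qed

lemma batch_step_support:
  assumes "1 \<le> p" "p \<le> N" "\<sigma> \<in> spin_configs N" "\<sigma>' \<in> set_pmf (batch_step N p \<beta> \<sigma>)"
  shows "\<sigma>' \<in> spin_configs N \<and> \<bar>magnetization N \<sigma>' - magnetization N \<sigma>\<bar> \<le> 2 / N"
proof -
  consider "\<sigma>' = \<sigma>" | i where "i \<in> {1..N}" "\<sigma>' = flip i \<sigma>"
    using set_pmf_batch_step[OF assms(1,2,4)] by auto
  then show ?thesis
  proof cases
    case 2
    then show ?thesis
      using spin_value[OF assms(3) 2(1)] flip_spin_configs[OF assms(3) 2(1)]
        magnetization_flip[OF 2(1), of \<sigma>] by auto
  qed (use assms in simp)
qed

subsection \<open>The expected increment of the magnetization\<close>

text \<open>
  The acceptance probability for flipping a minus spin when \<open>k\<close> of the other \<open>p - 1\<close> spins of its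
  batch are minus. Its counterpart for a plus spin is \<open>accept_down\<close>.
\<close>

definition accept_up :: "nat \<Rightarrow> real \<Rightarrow> nat \<Rightarrow> real" where
  "accept_up p \<beta> k = exp (- 2 * \<beta> * max ((2 * real k + 1 - real p) / real p) 0)"

definition accept_down :: "nat \<Rightarrow> real \<Rightarrow> nat \<Rightarrow> real" where
  "accept_down p \<beta> k = exp (- 2 * \<beta> * max ((real p - 1 - 2 * real k) / real p) 0)"

text \<open>
  The energy of a batch is \<open>- S\<^sup>2 / (2 p)\<close> with \<open>S\<close> the sum of its spins, and the flip changes \<open>S\<close> by
  \<open>- 2 \<sigma>\<^sub>i\<close>.
\<close>

lemma energy_flip:
  assumes "finite D" "i \<notin> D" "(\<sigma> i)\<^sup>2 = 1"
  shows "batch_hamiltonian p (flip i \<sigma>) (insert i D) - batch_hamiltonian p \<sigma> (insert i D)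
    = 2 * \<sigma> i * (\<Sum>j\<in>D. \<sigma> j) / p"
proof -
  have sq: "batch_hamiltonian p \<tau> C = - (1 / (2 * real p)) * (\<Sum>j\<in>C. \<tau> j)\<^sup>2" for \<tau> C
    unfolding batch_hamiltonian_def power2_eq_square sum_product ..
  have s1: "(\<Sum>j\<in>insert i D. flip i \<sigma> j) = (\<Sum>j\<in>D. \<sigma> j) - \<sigma> i"
  proof -
    have "(\<Sum>j\<in>D. flip i \<sigma> j) = (\<Sum>j\<in>D. \<sigma> j)"
      using assms by (intro sum.cong) (auto simp: flip_def)
    then show ?thesis using assms by (simp add: flip_def)
  qed
  have s2: "(\<Sum>j\<in>insert i D. \<sigma> j) = (\<Sum>j\<in>D. \<sigma> j) + \<sigma> i" using assms by simp
  show ?thesis unfolding sq s1 s2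
    by (cases "p = 0") (auto simp: field_simps power2_eq_square)
qed

lemma acceptance_eq:
  assumes \<sigma>: "\<sigma> \<in> spin_configs N" and i: "i \<in> {1..N}"
    and D: "D \<subseteq> {1..N} - {i}" "card D = p - 1" and "p \<ge> 1"
  defines "k \<equiv> card (D \<inter> ({j \<in> {1..N}. \<sigma> j = -1} - {i}))"
  shows "acceptance p \<beta> \<sigma> i (insert i D) =
    (if \<sigma> i = -1 then accept_up p \<beta> k else accept_down p \<beta> k)"
proof -
  have D': "finite D" "i \<notin> D" using D by (auto intro: finite_subset)
  have sum_count: "(\<Sum>j\<in>D. 1 - 2 * (if j \<in> K then 1 else 0)) = real (card D) - 2 * real (card (D \<inter> K))"
    for K :: "nat set"
    using D' by (simp add: sum_subtractf sum.If_cases flip: sum_distrib_left)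
  have "(\<Sum>j\<in>D. \<sigma> j) = (\<Sum>j\<in>D. 1 - 2 * (if j \<in> {j \<in> {1..N}. \<sigma> j = -1} - {i} then 1 else 0))"
  proof (intro sum.cong refl)
    fix j assume "j \<in> D"
    then have "j \<in> {1..N}" "j \<noteq> i" using D by auto
    then show "\<sigma> j = 1 - 2 * (if j \<in> {j \<in> {1..N}. \<sigma> j = -1} - {i} then 1 else 0)"
      using spin_value[OF \<sigma>, of j] by auto
  qed
  also have "\<dots> = real (card D) - 2 * real k"
    unfolding k_def by (rule sum_count)
  finally have S: "(\<Sum>j\<in>D. \<sigma> j) = real p - 1 - 2 * real k"
    using D \<open>p \<ge> 1\<close> by (simp add: of_nat_diff)
  have "(\<sigma> i)\<^sup>2 = 1" using spin_value[OF \<sigma> i] by auto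
  then have "acceptance p \<beta> \<sigma> i (insert i D) =
      exp (- \<beta> * max (2 * \<sigma> i * (real p - 1 - 2 * real k) / p) 0)"
    unfolding acceptance_def energy_flip[OF D', of \<sigma>, OF \<open>(\<sigma> i)\<^sup>2 = 1\<close>] S by simp
  then have acc: "acceptance p \<beta> \<sigma> i (insert i D) =
      exp (- \<beta> * max (2 * (\<sigma> i * (real p - 1 - 2 * real k) / p)) 0)"
    by (simp add: mult.assoc)
  have max2: "max (2 * x) 0 = 2 * max x 0" for x :: real by auto
  have neg: "-1 * (real p - 1 - 2 * real k) = 2 * real k + 1 - real p" by simp
  from spin_value[OF \<sigma> i] show ?thesis
  proof
    assume s: "\<sigma> i = -1"
    show ?thesis unfolding acc max2 unfolding s neg accept_up_def by simp
  next
    assume s: "\<sigma> i = 1"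
    show ?thesis unfolding acc max2 unfolding s accept_down_def by simp
  qed
qed

definition sampling_error :: "nat \<Rightarrow> real" where
  "sampling_error p = 2 * (real (p - 1) + 1 + 2 * 2 ^ (p - 1)) * (real (p - 1))\<^sup>2"

text \<open>
  A flip of spin \<open>i\<close> changes the magnetization by \<open>- 2 \<sigma>\<^sub>i / N\<close>. Up to the sampling error, the flip of
  a minus spin is accepted with probability \<open>S1 p \<beta> m\<close>, that of a plus spin with \<open>S2 p \<beta> m\<close>; since
  the two classes have the densities \<open>(1 - m) / 2\<close> and \<open>(1 + m) / 2\<close>, the average is the drift.
\<close>

lemma expected_increment:
  assumes p: "1 \<le> p" "p \<le> N" and "\<beta> \<ge> 0" and \<sigma>: "\<sigma> \<in> spin_configs N"
  defines "m \<equiv> magnetization N \<sigma>"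
  shows "\<bar>measure_pmf.expectation (batch_step N p \<beta> \<sigma>) (\<lambda>\<tau>. magnetization N \<tau> - m)
      - drift p \<beta> m / N\<bar> \<le> sampling_error p / (real N)\<^sup>2"
proof -
  define M where "M = {j \<in> {1..N}. \<sigma> j = -1}"
  define c where "c = card M"
  define q where "q = p - 1"
  have N: "N > 0" using p by simp
  have M: "finite M" "M \<subseteq> {1..N}" by (auto simp: M_def)
  have cN: "c \<le> N" using card_mono[of "{1..N}" M] M by (simp add: c_def)
  have "(\<Sum>i\<in>{1..N}. \<sigma> i) = (\<Sum>i\<in>{1..N}. 1 - 2 * (if i \<in> M then 1 else 0))"
    using spin_value[OF \<sigma>] by (intro sum.cong) (auto simp: M_def)
  also have "\<dots> = real N - 2 * real c"
    using M by (simp add: sum_subtractf c_def sum.If_cases Int_absorb1 flip: sum_distrib_left)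
  finally have m: "m = 1 - 2 * (c / N)" using N by (simp add: m_def magnetization_def field_simps)
  define E where "E = (real q + 1 + 2 * 2 ^ q) * (real q)\<^sup>2 / N"
  define h where "h i = (\<Sum>C\<in>batches N p i. acceptance p \<beta> \<sigma> i C) / card (batches N p i)" for i
  define s where "s i = (if i \<in> M then S1 p \<beta> m else S2 p \<beta> m)" for i
  have h: "\<bar>h i - s i\<bar> \<le> E" if i: "i \<in> {1..N}" for i
  proof -
    let ?w = "if i \<in> M then accept_up p \<beta> else accept_down p \<beta>"
    have hi: "h i = (\<Sum>D | D \<subseteq> {1..N} - {i} \<and> card D = q. ?w (card (D \<inter> (M - {i}))))
        / (card ({1..N} - {i}) choose q)"
      unfolding h_def sum_batches[OF i p(1)] card_batches[OF i p(1)] q_def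
      using i acceptance_eq[OF \<sigma> i _ _ p(1), of _ \<beta>]
      by (intro arg_cong2[of _ _ _ _ "(/)"] sum.cong) (auto simp: M_def)
    have si: "s i = (\<Sum>k\<le>q. (q choose k) * (c / N) ^ k * (1 - c / N) ^ (q - k) * ?w k)"
    proof -
      have "(1 - m) / 2 = c / N" "(1 + m) / 2 = 1 - c / N" unfolding m by auto
      note eqs = this
      show ?thesis
        unfolding s_def S1_def S2_def eqs accept_up_def accept_down_def q_def atLeast0AtMost
        by (cases "i \<in> M") simp_all
    qed
    have w1: "\<bar>?w k\<bar> \<le> 1" for k
      using \<open>\<beta> \<ge> 0\<close> by (auto simp: accept_up_def accept_down_def)
    show ?thesis unfolding E_def hi si
    proof (intro sampling_without_replacement_approx)
      show "card (M - {i}) \<le> c" "c \<le> card (M - {i}) + 1"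
        using M by (auto simp: c_def card_Diff_singleton_if)
      show "card ({1..N} - {i}) + 1 = N" "q \<le> card ({1..N} - {i})"
        using i p by (auto simp: q_def)
    qed (use M w1 in auto)
  qed
  have "measure_pmf.expectation (batch_step N p \<beta> \<sigma>) (\<lambda>\<tau>. magnetization N \<tau> - m)
    = (\<Sum>i\<in>{1..N}. h i * (- 2 * \<sigma> i / N)) / N"
    unfolding expectation_batch_step[OF p \<open>\<beta> \<ge> 0\<close>]
  proof (rule arg_cong[where f = "\<lambda>x. x / real N"], rule sum.cong[OF refl])
    fix i assume i: "i \<in> {1..N}"
    have "magnetization N \<sigma> - m + acceptance p \<beta> \<sigma> i C *
        (magnetization N (flip i \<sigma>) - m - (magnetization N \<sigma> - m))
      = acceptance p \<beta> \<sigma> i C * (- 2 * \<sigma> i / N)" for C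
      using magnetization_flip[OF i, of \<sigma>] by (simp add: m_def)
    then show "(\<Sum>C\<in>batches N p i. magnetization N \<sigma> - m + acceptance p \<beta> \<sigma> i C *
        (magnetization N (flip i \<sigma>) - m - (magnetization N \<sigma> - m))) / card (batches N p i)
      = h i * (- 2 * \<sigma> i / N)"
      unfolding h_def by (simp only: sum_distrib_right times_divide_eq_left)
  qed
  also have "\<dots> = (\<Sum>i\<in>{1..N}. (h i - s i) * (- 2 * \<sigma> i / N)) / N
      + (\<Sum>i\<in>{1..N}. s i * (- 2 * \<sigma> i / N)) / N"
    by (simp only: left_diff_distrib sum_subtractf flip: add_divide_distrib) simp
  also have "(\<Sum>i\<in>{1..N}. s i * (- 2 * \<sigma> i / N)) = drift p \<beta> m"
  proof -
    have "(\<Sum>i\<in>{1..N}. s i * (- 2 * \<sigma> i / N)) =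
        (\<Sum>i\<in>{1..N}. if i \<in> M then 2 * S1 p \<beta> m / N else - 2 * S2 p \<beta> m / N)"
      using spin_value[OF \<sigma>] by (intro sum.cong) (auto simp: s_def M_def)
    also have "\<dots> = c * (2 * S1 p \<beta> m / N) + (real N - real c) * (- 2 * S2 p \<beta> m / N)"
    proof -
      have "{1..N} \<inter> M = M" "{1..N} \<inter> - M = {1..N} - M" using M by auto
      then show ?thesis using M cN card_Diff_subset[OF M(1,2)]
        by (simp add: sum.If_cases c_def of_nat_diff del: mult_minus_left)
    qed
    also have "\<dots> = (c / N) * (2 * S1 p \<beta> m) - (1 - c / N) * (2 * S2 p \<beta> m)"
      using N by (simp add: field_simps)
    also have "\<dots> = drift p \<beta> m"
    proof -
      have "c / N = (1 - m) / 2" unfolding m by simp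
      then show ?thesis unfolding drift_def by (simp only:) (simp add: field_simps)
    qed
    finally show ?thesis by simp
  qed
  finally have "\<bar>measure_pmf.expectation (batch_step N p \<beta> \<sigma>) (\<lambda>\<tau>. magnetization N \<tau> - m)
      - drift p \<beta> m / N\<bar> = \<bar>\<Sum>i\<in>{1..N}. (h i - s i) * (- 2 * \<sigma> i / N)\<bar> / N"
    by simp
  also have "\<dots> \<le> (\<Sum>i\<in>{1..N}. E * (2 / N)) / N"
  proof (intro divide_right_mono order.trans[OF sum_abs] sum_mono)
    fix i assume i: "i \<in> {1..N}"
    have "\<bar>- 2 * \<sigma> i / N\<bar> \<le> 2 / N" using spin_value[OF \<sigma> i] by auto
    then show "\<bar>(h i - s i) * (- 2 * \<sigma> i / N)\<bar> \<le> E * (2 / N)"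
      unfolding abs_mult using h[OF i] by (intro mult_mono) auto
  qed simp
  also have "\<dots> = sampling_error p / (real N)\<^sup>2"
    using N by (simp add: E_def sampling_error_def q_def power2_eq_square)
  finally show ?thesis .
qed

section \<open>Convergence to a deterministic path in the Skorokhod topology\<close>

lemma integral_exp_tail:
  "has_bochner_integral lborel (\<lambda>u. indicator {a..} u * exp (- u)) (exp (- a :: real))"
proof (rule has_bochner_integral_nn_integral)
  have "(\<integral>\<^sup>+u. ennreal (exp (- u)) * indicator {a..} u \<partial>lborel) = ennreal (0 - (- exp (- a)))"
  proof (rule nn_integral_FTC_atLeast)
    show "((\<lambda>u::real. - exp (- u)) has_real_derivative exp (- x)) (at x)" for x
      by (auto intro!: derivative_eq_intros)
    have "((\<lambda>u::real. - exp (- u)) \<longlongrightarrow> - 0) at_top"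
      by (intro tendsto_minus filterlim_compose[OF exp_at_bot] filterlim_uminus_at_bot_at_top)
    then show "((\<lambda>u::real. - exp (- u)) \<longlongrightarrow> 0) at_top" by simp
  qed auto
  also have "(\<lambda>u::real. ennreal (exp (- u)) * indicator {a..} u)
      = (\<lambda>u. ennreal (indicator {a..} u * exp (- u)))"
    by (auto split: split_indicator)
  finally show "(\<integral>\<^sup>+u. ennreal (indicator {a..} u * exp (- u)) \<partial>lborel) = ennreal (exp (- a))"
    by simp
qed auto

lemma log_slopes_nonneg:
  assumes "bdd_above (log_slopes l)"
  shows "0 \<le> Sup (log_slopes l)"
proof -
  have "\<bar>ln ((l 1 - l 0) / (1 - 0))\<bar> \<in> log_slopes l"
    unfolding log_slopes_def by (intro CollectI exI[of _ "1::real"] exI[of _ "0::real"]) auto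
  then have "\<bar>ln ((l 1 - l 0) / (1 - 0))\<bar> \<le> Sup (log_slopes l)"
    using assms by (rule cSup_upper)
  then show ?thesis by linarith
qed

lemma log_slopes_id: "log_slopes (\<lambda>t. t) = {0}"
proof -
  have "\<bar>ln ((s - t) / (s - t))\<bar> = 0" if "t < s" for s t :: real using that by simp
  moreover have "\<exists>s t :: real. 0 \<le> t \<and> t < s" by (rule exI[of _ 1], rule exI[of _ 0]) simp
  ultimately show ?thesis unfolding log_slopes_def by fastforce
qed

lemma id_time_change: "(\<lambda>t. t) \<in> time_changes"
  by (auto simp: time_changes_def log_slopes_id strict_mono_on_def)

text \<open>
  The identity is an admissible time change of size \<open>0\<close>. With it the paths differ by at most \<open>\<delta>\<close>
  up to time \<open>T\<close>, and beyond \<open>T\<close> the truncation at \<open>1\<close> and the weight \<open>exp (- u)\<close> leave at most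
  \<open>exp (- T)\<close>.
\<close>

lemma skorokhod_dist_le:
  assumes close: "\<And>t. 0 \<le> t \<Longrightarrow> t \<le> T \<Longrightarrow> \<bar>x t - y t\<bar> \<le> \<delta>" and "0 \<le> \<delta>" "0 \<le> T"
  shows "skorokhod_dist x y \<le> \<delta> + exp (- T)"
proof -
  let ?d = "stopped_dist x y (\<lambda>t. t)"
  define f where "f u = indicator {0..} u *\<^sub>R (exp (- u) * ?d u)" for u :: real
  define g where "g u = \<delta> * (indicator {0..} u * exp (- u)) + indicator {T..} u * exp (- u)" for u :: real
  have d1: "?d u \<le> 1" for u
    unfolding stopped_dist_def by (rule cSUP_least) auto
  have d2: "?d u \<le> \<delta>" if "0 \<le> u" "u \<le> T" for u
    unfolding stopped_dist_def by (rule cSUP_least) (use that close in \<open>auto intro!: min.coboundedI2\<close>)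
  have g: "has_bochner_integral lborel g (\<delta> * exp (- 0) + exp (- T))"
    unfolding g_def
    by (intro has_bochner_integral_add has_bochner_integral_mult_right integral_exp_tail)
  have fg: "f u \<le> g u" for u
  proof (cases "u < 0")
    case False
    show ?thesis
    proof (cases "u < T")
      case True
      then show ?thesis using False d2[of u] by (simp add: f_def g_def)
    next
      case F: False
      \<comment> \<open>beyond \<open>T\<close> only the truncation at \<open>1\<close> is available\<close>
      have "f u \<le> exp (- u) * 1"
        using False d1[of u] unfolding f_def by simp
      also have "\<dots> \<le> g u" using False F \<open>0 \<le> \<delta>\<close> by (simp add: g_def)
      finally show ?thesis .
    qed
  qed (use assms in \<open>simp add: f_def g_def\<close>)
  have "integral\<^sup>L lborel f \<le> \<delta> + exp (- T)"
  proof (cases "integrable lborel f")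
    case True
    then have "integral\<^sup>L lborel f \<le> integral\<^sup>L lborel g"
      using g fg by (intro integral_mono) (auto simp: has_bochner_integral_iff)
    then show ?thesis using g by (simp add: has_bochner_integral_iff)
  next
    case False
    \<comment> \<open>the integral of a non-integrable function is \<open>0\<close> by convention, so the bound
        also covers a \<open>stopped_dist\<close> that is not measurable in \<open>u\<close>\<close>
    then show ?thesis using \<open>0 \<le> \<delta>\<close> by (simp add: not_integrable_integral_eq)
  qed
  moreover have "skorokhod_dist x y
      \<le> max (Sup (log_slopes (\<lambda>t. t))) (LBINT u:{0..}. exp (- u) * ?d u)"
    unfolding skorokhod_dist_def
  proof (rule cINF_lower[OF _ id_time_change])
    show "bdd_below ((\<lambda>l. max (Sup (log_slopes l)) (LBINT u:{0..}. exp (- u) * stopped_dist x y l u))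
        ` time_changes)"
      using log_slopes_nonneg by (intro bdd_belowI2[of _ 0]) (auto simp: time_changes_def le_max_iff_disj)
  qed
  moreover have "0 \<le> \<delta> + exp (- T)" using \<open>0 \<le> \<delta>\<close> by (intro add_nonneg_nonneg) auto
  ultimately show ?thesis
    unfolding log_slopes_id set_lebesgue_integral_def f_def[symmetric] by simp
qed

lemma sets_borel_of_topology:
  "sets (borel_of_topology T) = sigma_sets (topspace T) {U. openin T U}"
  unfolding borel_of_topology_def by (rule sets_measure_of) (auto dest: openin_subset)

lemma space_borel_of_topology: "space (borel_of_topology T) = topspace T"
  unfolding borel_of_topology_def by (rule space_measure_of) (auto dest: openin_subset)

lemma space_skorokhod: "space (borel_of_topology skorokhod_topology) = cadlag_paths"
  by (simp add: space_borel_of_topology topspace_skorokhod_topology)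

lemma continuous_map_borel_measurable:
  assumes "continuous_map T euclideanreal F"
  shows "F \<in> borel_measurable (borel_of_topology T)"
proof (rule borel_measurableI)
  fix S :: "real set" assume "open S"
  then have "openin T {x \<in> topspace T. F x \<in> S}"
    using assms by (simp add: continuous_map_def)
  moreover have "F -` S \<inter> space (borel_of_topology T) = {x \<in> topspace T. F x \<in> S}"
    by (auto simp: space_borel_of_topology)
  ultimately show "F -` S \<inter> space (borel_of_topology T) \<in> sets (borel_of_topology T)"
    by (auto simp: sets_borel_of_topology)
qed

text \<open>
  A Skorokhod neighbourhood contains a neighbourhood for uniform closeness on a compact interval.
\<close>

lemma continuous_map_skorokhod_nhd:
  assumes "continuous_map skorokhod_topology euclideanreal F" "x \<in> cadlag_paths" "\<epsilon> > 0"
  obtains T \<delta> where "T \<ge> 0" "\<delta> > 0"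
    "\<And>y. y \<in> cadlag_paths \<Longrightarrow> (\<And>t. 0 \<le> t \<Longrightarrow> t \<le> T \<Longrightarrow> \<bar>y t - x t\<bar> \<le> \<delta>) \<Longrightarrow> \<bar>F y - F x\<bar> < \<epsilon>"
proof -
  let ?U = "{y \<in> cadlag_paths. F y \<in> ball (F x) \<epsilon>}"
  have "openin skorokhod_topology ?U"
    using openin_continuous_map_preimage[OF assms(1), of "ball (F x) \<epsilon>"]
    by (simp add: topspace_skorokhod_topology)
  moreover have "x \<in> ?U" using assms by simp
  ultimately obtain r where r: "r > 0" "{y \<in> cadlag_paths. skorokhod_dist x y < r} \<subseteq> ?U"
    unfolding openin_skorokhod_topology by blast
  define T where "T = max 0 (- ln (r / 3))"
  have T: "T \<ge> 0" "exp (- T) \<le> r / 3"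
  proof -
    have "exp (- T) \<le> exp (ln (r / 3))" unfolding T_def by (subst exp_le_cancel_iff) auto
    then show "exp (- T) \<le> r / 3" using r by simp
  qed (simp add: T_def)
  show ?thesis
  proof (rule that[of T "r / 3"])
    fix y assume y: "y \<in> cadlag_paths" "\<And>t. 0 \<le> t \<Longrightarrow> t \<le> T \<Longrightarrow> \<bar>y t - x t\<bar> \<le> r / 3"
    then have "skorokhod_dist x y \<le> r / 3 + exp (- T)"
      using T r by (intro skorokhod_dist_le) (auto simp: abs_minus_commute)
    also have "\<dots> < r" using T r by simp
    finally have "y \<in> ?U" using r y by auto
    then show "\<bar>F y - F x\<bar> < \<epsilon>" by (simp add: dist_real_def abs_minus_commute)
  qed (use T r in auto)
qed

text \<open>
  Convergence in probability, uniformly on compact intervals, to one fixed path implies weak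
  convergence. The exceptional events \<open>A N\<close> need only contain the set where the paths are far apart, so
  that they can be chosen in terms of countably many times.
\<close>

lemma weak_conv_to_deterministic_path:
  fixes X :: "nat \<Rightarrow> 'a \<Rightarrow> real \<Rightarrow> real"
  assumes prob: "\<And>N. N \<ge> N0 \<Longrightarrow> prob_space (P N)"
    and meas: "\<And>N. N \<ge> N0 \<Longrightarrow> X N \<in> P N \<rightarrow>\<^sub>M borel_of_topology skorokhod_topology"
    and x: "x \<in> cadlag_paths"
    and close: "\<And>T \<delta>. T \<ge> 0 \<Longrightarrow> \<delta> > 0 \<Longrightarrow> \<exists>A. (\<forall>N\<ge>N0. A N \<in> sets (P N)) \<and>
      (\<lambda>N. measure (P N) (A N)) \<longlonglongrightarrow> 0 \<and>
      (\<forall>\<^sub>F N in sequentially. \<forall>\<omega>\<in>space (P N) - A N. \<forall>t\<in>{0..T}. \<bar>X N \<omega> t - x t\<bar> \<le> \<delta>)"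
  shows "weak_conv_on skorokhod_topology
    (\<lambda>N. distr (P N) (borel_of_topology skorokhod_topology) (X N))
    (return (borel_of_topology skorokhod_topology) x)"
  unfolding weak_conv_on_def
proof safe
  fix F assume F: "continuous_map skorokhod_topology euclideanreal F"
    and bdd: "bounded (F ` topspace skorokhod_topology)"
  let ?B = "borel_of_topology skorokhod_topology"
  obtain C where C: "\<And>y. y \<in> cadlag_paths \<Longrightarrow> \<bar>F y\<bar> \<le> C"
    using bdd by (auto simp: bounded_iff topspace_skorokhod_topology)
  have C0: "C \<ge> 0" using C[OF x] by linarith
  have Fm: "F \<in> borel_measurable ?B" by (rule continuous_map_borel_measurable[OF F])
  have "(\<lambda>N. \<integral>y. F y \<partial>distr (P N) ?B (X N)) \<longlonglongrightarrow> F x"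
  proof (rule LIMSEQ_I)
    fix \<epsilon> :: real assume "\<epsilon> > 0"
    then obtain T \<delta> where T: "T \<ge> 0" "\<delta> > 0" and near: "\<And>y. y \<in> cadlag_paths \<Longrightarrow>
        (\<And>t. 0 \<le> t \<Longrightarrow> t \<le> T \<Longrightarrow> \<bar>y t - x t\<bar> \<le> \<delta>) \<Longrightarrow> \<bar>F y - F x\<bar> < \<epsilon> / 2"
      using continuous_map_skorokhod_nhd[OF F x, of "\<epsilon> / 2"] by (metis half_gt_zero)
    obtain A where A: "\<And>N. N \<ge> N0 \<Longrightarrow> A N \<in> sets (P N)" "(\<lambda>N. measure (P N) (A N)) \<longlonglongrightarrow> 0"
      "\<forall>\<^sub>F N in sequentially. \<forall>\<omega>\<in>space (P N) - A N. \<forall>t\<in>{0..T}. \<bar>X N \<omega> t - x t\<bar> \<le> \<delta>"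
      using close[OF T] by blast
    have "\<forall>\<^sub>F N in sequentially. measure (P N) (A N) < \<epsilon> / (4 * C + 1)"
      using A(2) \<open>\<epsilon> > 0\<close> C0 by (intro order_tendstoD(2)) auto
    then have "\<forall>\<^sub>F N in sequentially. norm ((\<integral>y. F y \<partial>distr (P N) ?B (X N)) - F x) < \<epsilon>"
      using A(3) eventually_ge_at_top[of N0]
    proof eventually_elim
      case (elim N)
      interpret prob_space "P N" using elim prob by simp
      have [measurable]: "X N \<in> P N \<rightarrow>\<^sub>M ?B" "A N \<in> sets (P N)" "F \<in> borel_measurable ?B"
        using elim meas A Fm by auto
      have Xc: "X N \<omega> \<in> cadlag_paths" if "\<omega> \<in> space (P N)" for \<omega>
        using measurable_space[OF meas[OF elim(3)] that] by (simp add: space_skorokhod)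
      have int: "integrable (P N) (\<lambda>\<omega>. F (X N \<omega>))"
        by (rule integrable_const_bound[of _ C]) (use C Xc in auto)
      have "(\<integral>y. F y \<partial>distr (P N) ?B (X N)) - F x = (\<integral>\<omega>. F (X N \<omega>) \<partial>P N) - (\<integral>\<omega>. F x \<partial>P N)"
        by (subst integral_distr) (auto simp: prob_space)
      also have "\<dots> = (\<integral>\<omega>. F (X N \<omega>) - F x \<partial>P N)"
        using int by (subst Bochner_Integration.integral_diff) auto
      also have "norm \<dots> \<le> (\<integral>\<omega>. \<epsilon> / 2 + 2 * C * indicator (A N) \<omega> \<partial>P N)"
      proof (rule order.trans[OF integral_norm_bound integral_mono])
        show "integrable (P N) (\<lambda>\<omega>. norm (F (X N \<omega>) - F x))" using int by auto
        show "integrable (P N) (\<lambda>\<omega>. \<epsilon> / 2 + 2 * C * indicator (A N) \<omega>)"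
          by (rule integrable_const_bound[of _ "\<epsilon> / 2 + 2 * C"])
             (use \<open>\<epsilon> > 0\<close> C0 in \<open>auto split: split_indicator\<close>)
        fix \<omega> assume \<omega>: "\<omega> \<in> space (P N)"
        show "norm (F (X N \<omega>) - F x) \<le> \<epsilon> / 2 + 2 * C * indicator (A N) \<omega>"
        proof (cases "\<omega> \<in> A N")
          case True
          have "\<bar>F (X N \<omega>) - F x\<bar> \<le> C + C"
            using C[OF Xc[OF \<omega>]] C[OF x] by linarith
          then show ?thesis using True \<open>\<epsilon> > 0\<close> by simp
        next
          case False
          then have "\<bar>F (X N \<omega>) - F x\<bar> < \<epsilon> / 2"
            using elim(2) \<omega> by (intro near[OF Xc[OF \<omega>]]) auto
          then show ?thesis using False by simp
        qed
      qed
      also have "\<dots> = \<epsilon> / 2 + 2 * C * measure (P N) (A N)"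
      proof -
        have "integrable (P N) (\<lambda>\<omega>. 2 * C * indicator (A N) \<omega> :: real)"
          by (rule integrable_const_bound[of _ "2 * C"]) (use C0 in \<open>auto split: split_indicator\<close>)
        then show ?thesis by (subst Bochner_Integration.integral_add) (auto simp: prob_space)
      qed
      also have "\<dots> \<le> \<epsilon> / 2 + 2 * C * (\<epsilon> / (4 * C + 1))"
        using elim(1) C0 by (intro add_left_mono mult_left_mono) auto
      also have "\<dots> < \<epsilon>"
        using C0 \<open>\<epsilon> > 0\<close> by (simp add: field_simps)
      finally show ?case .
    qed
    then show "\<exists>no. \<forall>N\<ge>no. norm ((\<integral>y. F y \<partial>distr (P N) ?B (X N)) - F x) < \<epsilon>"
      by (simp add: eventually_sequentially)
  qed
  moreover have "(\<integral>y. F y \<partial>return ?B x) = F x"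
    using x Fm by (intro integral_return) (auto simp: space_skorokhod)
  ultimately show "(\<lambda>N. \<integral>y. F y \<partial>distr (P N) ?B (X N)) \<longlonglongrightarrow> (\<integral>y. F y \<partial>return ?B x)" by simp
qed

subsection \<open>Step paths\<close>

definition step_path :: "nat \<Rightarrow> (nat \<Rightarrow> real) \<Rightarrow> real \<Rightarrow> real" where
  "step_path N v = (\<lambda>t\<in>{0..}. v (nat \<lfloor>real N * t\<rfloor>))"

text \<open>
  The floor function is constant to the right of every point, and to the left of \<open>t\<close> it takes
  the value \<open>\<lceil>N t\<rceil> - 1\<close>.
\<close>

lemma step_path_cadlag:
  assumes "N > 0"
  shows "step_path N v \<in> cadlag_paths"
  unfolding cadlag_paths_def
proof (intro CollectI conjI allI impI)
  show "step_path N v \<in> extensional {0..}" by (simp add: step_path_def)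
  show "(step_path N v \<longlongrightarrow> step_path N v t) (at_right t)" if t: "t \<ge> 0" for t
  proof -
    have "t < (\<lfloor>real N * t\<rfloor> + 1) / N" using \<open>N > 0\<close> by (simp add: field_simps) linarith
    then have "\<forall>\<^sub>F s in at_right t. s < (\<lfloor>real N * t\<rfloor> + 1) / N"
      by (rule order_tendstoD(2)[OF tendsto_ident_at])
    moreover have "\<forall>\<^sub>F s in at_right t. t < s" by (simp add: eventually_at_right_less)
    ultimately have "\<forall>\<^sub>F s in at_right t. step_path N v s = step_path N v t"
    proof eventually_elim
      case (elim s)
      have "real N * s < \<lfloor>real N * t\<rfloor> + 1" using elim \<open>N > 0\<close> by (simp add: field_simps)
      moreover have "real N * t \<le> real N * s" using elim \<open>N > 0\<close> by simp
      then have "\<lfloor>real N * t\<rfloor> \<le> real N * s" by linarith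
      ultimately have "\<lfloor>real N * s\<rfloor> = \<lfloor>real N * t\<rfloor>" by (intro floor_unique) auto
      then show ?case using t elim by (simp add: step_path_def)
    qed
    then show ?thesis by (rule tendsto_eventually)
  qed
  show "\<exists>l. (step_path N v \<longlongrightarrow> l) (at_left t)" if t: "t > 0" for t
  proof -
    define k where "k = \<lceil>real N * t\<rceil> - 1"
    have k: "k < real N * t" "real N * t \<le> k + 1" "k \<ge> 0"
      using \<open>N > 0\<close> t by (auto simp: k_def) linarith+
    have "k / N < t" using k \<open>N > 0\<close> by (simp add: field_simps)
    then have "\<forall>\<^sub>F s in at_left t. k / N < s"
      by (rule order_tendstoD(1)[OF tendsto_ident_at])
    moreover have "\<forall>\<^sub>F s in at_left t. s < t" by (simp add: eventually_at_filter)
    ultimately have "\<forall>\<^sub>F s in at_left t. step_path N v s = v (nat k)"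
    proof eventually_elim
      case (elim s)
      have "k < real N * s" using elim \<open>N > 0\<close> by (simp add: field_simps)
      moreover have "real N * s < real N * t" using elim \<open>N > 0\<close> by simp
      ultimately have "\<lfloor>real N * s\<rfloor> = k" using k by (intro floor_unique) auto
      moreover have "0 \<le> k / N" using k by simp
      then have "s \<ge> 0" using elim by linarith
      ultimately show ?case by (simp add: step_path_def)
    qed
    then show ?thesis by (intro exI[of _ "v (nat k)"] tendsto_eventually)
  qed
qed

lemma continuous_cadlag:
  assumes "continuous_on {0..} m"
  shows "restrict m {0..} \<in> cadlag_paths"
  unfolding cadlag_paths_def
proof (intro CollectI conjI allI impI)
  have lim: "(restrict m {0..} \<longlongrightarrow> restrict m {0..} t) (at t within {0..})" if "t \<ge> 0" for t
  proof -
    have "(m \<longlongrightarrow> m t) (at t within {0..})" using assms that by (auto simp: continuous_on_def)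
    moreover have "\<forall>\<^sub>F s in at t within {0..}. m s = restrict m {0..} s"
      by (auto simp: eventually_at_filter)
    ultimately have "(restrict m {0..} \<longlongrightarrow> m t) (at t within {0..})"
      by (rule Lim_transform_eventually)
    then show ?thesis using that by simp
  qed
  show "(restrict m {0..} \<longlongrightarrow> restrict m {0..} t) (at_right t)" if "t \<ge> 0" for t
    by (rule tendsto_within_subset[OF lim[OF that]]) (use that in auto)
  show "\<exists>l. (restrict m {0..} \<longlongrightarrow> l) (at_left t)" if "t > 0" for t
  proof -
    have "at t within {0..} = at t" by (rule at_within_interior) (use that in auto)
    then have "(restrict m {0..} \<longlongrightarrow> restrict m {0..} t) (at t)" using lim[of t] that by simp
    then have "(restrict m {0..} \<longlongrightarrow> restrict m {0..} t) (at_left t)"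
      by (rule tendsto_within_subset) auto
    then show ?thesis by blast
  qed
qed auto

text \<open>
  Two step paths that agree up to index \<open>n\<close> are within Skorokhod distance \<open>exp (- n / N)\<close>. Hence the
  set of sequences whose step path lies in a given open set is a union of cylinders, and there are only
  countably many cylinders over a countable state space.
\<close>

lemma measurable_step_path:
  assumes Y: "\<And>n. Y n \<in> M \<rightarrow>\<^sub>M count_space S" and S: "countable S" and "N > 0"
  shows "(\<lambda>\<omega>. step_path N (\<lambda>n. v (Y n \<omega>))) \<in> M \<rightarrow>\<^sub>M borel_of_topology skorokhod_topology"
  unfolding borel_of_topology_def
proof (rule measurable_measure_of)
  show "{U. openin skorokhod_topology U} \<subseteq> Pow (topspace skorokhod_topology)"
    by (auto dest: openin_subset)
  show "(\<lambda>\<omega>. step_path N (\<lambda>n. v (Y n \<omega>))) \<in> space M \<rightarrow> topspace skorokhod_topology"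
    using step_path_cadlag[OF \<open>N > 0\<close>] by (simp add: topspace_skorokhod_topology)
  fix U assume "U \<in> {U. openin skorokhod_topology U}"
  then have U: "U \<subseteq> cadlag_paths"
    "\<And>x. x \<in> U \<Longrightarrow> \<exists>r>0. {y \<in> cadlag_paths. skorokhod_dist x y < r} \<subseteq> U"
    unfolding openin_skorokhod_topology by auto
  define good where "good n s \<longleftrightarrow> (\<forall>u. (\<forall>i\<le>n. u i = v (s i)) \<longrightarrow> step_path N u \<in> U)"
    for n :: nat and s
  define I where "I = (SIGMA n:UNIV. {s \<in> {..n} \<rightarrow>\<^sub>E S. good n s})"
  define cyl where "cyl = (\<lambda>(n::nat, s). {\<omega> \<in> space M. \<forall>i\<le>n. Y i \<omega> = s i})"
  have "countable I" unfolding I_def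
  proof (rule countable_SIGMA)
    fix n :: nat
    have "countable ({..n} \<rightarrow>\<^sub>E S)" using S by (intro countable_PiE) auto
    then show "countable {s \<in> {..n} \<rightarrow>\<^sub>E S. good n s}" by (rule countable_subset[rotated]) auto
  qed simp
  have "(\<lambda>\<omega>. step_path N (\<lambda>n. v (Y n \<omega>))) -` U \<inter> space M = (\<Union>c\<in>I. cyl c)"
  proof (intro equalityI subsetI)
    fix \<omega> assume "\<omega> \<in> (\<lambda>\<omega>. step_path N (\<lambda>n. v (Y n \<omega>))) -` U \<inter> space M"
    then have \<omega>: "\<omega> \<in> space M" "step_path N (\<lambda>n. v (Y n \<omega>)) \<in> U" by auto
    then obtain r where r: "r > 0"
      "{y \<in> cadlag_paths. skorokhod_dist (step_path N (\<lambda>n. v (Y n \<omega>))) y < r} \<subseteq> U"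
      using U by blast
    obtain n :: nat where n: "n > real N * - ln r" using reals_Archimedean2 by blast
    \<comment> \<open>\<open>n\<close> is so large that agreement up to \<open>n\<close> forces distance below \<open>r\<close>\<close>
    have "- (n / N) < ln r" using n \<open>N > 0\<close> by (simp add: field_simps)
    then have "exp (- (n / N)) < exp (ln r)" by (subst exp_less_cancel_iff)
    then have e: "exp (- (n / N)) < r" using r by simp
    define s where "s = restrict (\<lambda>i. Y i \<omega>) {..n}"
    have "good n s" unfolding good_def
    proof safe
      fix u assume u: "\<forall>i\<le>n. u i = v (s i)"
      have "skorokhod_dist (step_path N (\<lambda>n. v (Y n \<omega>))) (step_path N u) \<le> 0 + exp (- (n / N))"
      proof (rule skorokhod_dist_le)
        fix t :: real assume t: "0 \<le> t" "t \<le> n / N"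
        have "real N * t \<le> n" using t \<open>N > 0\<close> by (simp add: field_simps)
        then have "nat \<lfloor>real N * t\<rfloor> \<le> n" by linarith
        then show "\<bar>step_path N (\<lambda>n. v (Y n \<omega>)) t - step_path N u t\<bar> \<le> 0"
          using u t by (simp add: step_path_def s_def)
      qed auto
      then show "step_path N u \<in> U" using r e step_path_cadlag[OF \<open>N > 0\<close>, of u] by auto
    qed
    moreover have "s \<in> {..n} \<rightarrow>\<^sub>E S"
      using measurable_space[OF Y \<omega>(1)] by (auto simp: s_def)
    moreover have "\<omega> \<in> cyl (n, s)" using \<omega> by (auto simp: cyl_def s_def)
    ultimately have "(n, s) \<in> I" "\<omega> \<in> cyl (n, s)" by (simp_all add: I_def)
    then show "\<omega> \<in> (\<Union>c\<in>I. cyl c)" by (rule UN_I)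
  next
    fix \<omega> assume "\<omega> \<in> (\<Union>c\<in>I. cyl c)"
    then obtain n s where "good n s" "\<omega> \<in> space M" "\<And>i. i \<le> n \<Longrightarrow> Y i \<omega> = s i"
      by (auto simp: I_def cyl_def)
    then show "\<omega> \<in> (\<lambda>\<omega>. step_path N (\<lambda>n. v (Y n \<omega>))) -` U \<inter> space M"
      unfolding good_def by simp
  qed
  moreover have "cyl c \<in> sets M" if "c \<in> I" for c
  proof -
    from that
    obtain n s where c: "c = (n, s)" "s \<in> {..n} \<rightarrow>\<^sub>E S" by (force simp: I_def)
    have "{\<omega> \<in> space M. Y i \<omega> = s i} \<in> sets M" if "i \<le> n" for i
    proof -
      have "Y i -` {s i} \<inter> space M \<in> sets M"
        using c that by (intro measurable_sets[OF Y]) auto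
      also have "Y i -` {s i} \<inter> space M = {\<omega> \<in> space M. Y i \<omega> = s i}" by auto
      finally show ?thesis .
    qed
    then have "(\<Inter>i\<in>{..n}. {\<omega> \<in> space M. Y i \<omega> = s i}) \<in> sets M"
      by (intro sets.finite_INT) auto
    also have "(\<Inter>i\<in>{..n}. {\<omega> \<in> space M. Y i \<omega> = s i}) = cyl c"
      unfolding c(1) cyl_def by auto
    finally show "cyl c \<in> sets M" .
  qed
  then have "(\<Union>c\<in>I. cyl c) \<in> sets M"
    using \<open>countable I\<close> by (intro sets.countable_UN' image_subsetI)
  ultimately show "(\<lambda>\<omega>. step_path N (\<lambda>n. v (Y n \<omega>))) -` U \<inter> space M \<in> sets M"
    by simp
qed

section \<open>From the chain to the differential equation\<close>

subsection \<open>Expectations along a Markov chain\<close>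

text \<open>
  The Markov property is stated through the probabilities of finite paths, so the expectation is
  expanded over all paths up to time \<open>n\<close>, of which there are finitely many.
\<close>

lemma markov_chain_integral_step:
  fixes h :: "'s \<Rightarrow> 's \<Rightarrow> real"
  assumes mc: "markov_chain P S K X" and S: "finite S"
    and closed: "\<And>s. s \<in> S \<Longrightarrow> set_pmf (K s) \<subseteq> S"
  shows "(\<integral>\<omega>. h (X n \<omega>) (X (Suc n) \<omega>) \<partial>P)
    = (\<integral>\<omega>. measure_pmf.expectation (K (X n \<omega>)) (h (X n \<omega>)) \<partial>P)"
proof -
  interpret prob_space P using mc by (simp add: markov_chain_def)
  have X: "X i \<in> P \<rightarrow>\<^sub>M count_space S" for i using mc by (simp add: markov_chain_def)
  have XS: "X i \<omega> \<in> S" if "\<omega> \<in> space P" for i \<omega>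
    using measurable_space[OF X that] by simp
  have ev: "{\<omega> \<in> space P. X i \<omega> = a} \<in> sets P" for i a
  proof -
    have "X i -` ({a} \<inter> S) \<inter> space P \<in> sets P" by (intro measurable_sets[OF X]) auto
    also have "X i -` ({a} \<inter> S) \<inter> space P = {\<omega> \<in> space P. X i \<omega> = a}" using XS by auto
    finally show ?thesis .
  qed
  define cyl where "cyl n c = {\<omega> \<in> space P. \<forall>i\<le>n. X i \<omega> = c i}" for n :: nat and c
  have cyl_sets: "cyl n c \<in> sets P" for n c
  proof -
    have "(\<Inter>i\<in>{..n}. {\<omega> \<in> space P. X i \<omega> = c i}) \<in> sets P"
      using ev by (intro sets.finite_INT) auto
    also have "(\<Inter>i\<in>{..n}. {\<omega> \<in> space P. X i \<omega> = c i}) = cyl n c" by (auto simp: cyl_def)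
    finally show ?thesis .
  qed
  define paths where "paths = {..n} \<rightarrow>\<^sub>E S"
  have fin: "finite paths" unfolding paths_def using S by (intro finite_PiE) auto
  have expand: "(\<Sum>c\<in>paths. f c * indicator (cyl n c) \<omega>) = f (\<lambda>i\<in>{..n}. X i \<omega>)"
    if \<omega>: "\<omega> \<in> space P" for f :: "(nat \<Rightarrow> 's) \<Rightarrow> real" and \<omega>
  proof -
    have "(\<Sum>c\<in>paths. f c * indicator (cyl n c) \<omega>)
        = (\<Sum>c\<in>paths. if c = (\<lambda>i\<in>{..n}. X i \<omega>) then f c else 0)"
    proof (rule sum.cong[OF refl])
      fix c assume "c \<in> paths"
      then have "\<omega> \<in> cyl n c \<longleftrightarrow> c = (\<lambda>i\<in>{..n}. X i \<omega>)"
        using \<omega> by (auto simp: cyl_def paths_def PiE_iff extensional_def fun_eq_iff)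
      then show "f c * indicator (cyl n c) \<omega> = (if c = (\<lambda>i\<in>{..n}. X i \<omega>) then f c else 0)"
        by (simp add: indicator_def)
    qed
    also have "\<dots> = f (\<lambda>i\<in>{..n}. X i \<omega>)"
      using XS[OF \<omega>] fin by (subst sum.delta) (auto simp: paths_def)
    finally show ?thesis .
  qed
  have int_ind: "integrable P (\<lambda>\<omega>. r * indicator A \<omega> :: real)" if "A \<in> sets P" for A r
    using that by (intro integrable_mult_right integrable_real_indicator) (auto simp: emeasure_eq_measure)
  \<comment> \<open>a path up to time \<open>n\<close>, continued by \<open>s\<close>\<close>
  define e where "e c s = (\<lambda>i. if i \<le> n then c i else s)" for c :: "nat \<Rightarrow> 's" and s
  have step: "prob (cyl (Suc n) (e c s)) = prob (cyl n c) * pmf (K (c n)) s"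
    if "c \<in> paths" "s \<in> S" for c s
  proof -
    have "\<forall>i. e c s i \<in> S" using that by (auto simp: e_def paths_def PiE_iff)
    moreover have "\<forall>n s. (\<forall>i. s i \<in> S) \<longrightarrow>
      measure P {\<omega> \<in> space P. \<forall>i\<le>Suc n. X i \<omega> = s i} =
      measure P {\<omega> \<in> space P. \<forall>i\<le>n. X i \<omega> = s i} * pmf (K (s n)) (s (Suc n))"
      using mc unfolding markov_chain_def by blast
    ultimately have "prob (cyl (Suc n) (e c s)) = prob (cyl n (e c s)) * pmf (K (e c s n)) (e c s (Suc n))"
      unfolding cyl_def by blast
    also have "cyl n (e c s) = cyl n c" by (auto simp: cyl_def e_def)
    finally show ?thesis by (simp add: e_def)
  qed
  have "(\<integral>\<omega>. h (X n \<omega>) (X (Suc n) \<omega>) \<partial>P)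
    = (\<integral>\<omega>. (\<Sum>c\<in>paths. \<Sum>s\<in>S. h (c n) s * indicator (cyl (Suc n) (e c s)) \<omega>) \<partial>P)"
  proof (rule Bochner_Integration.integral_cong[OF refl])
    fix \<omega> assume \<omega>: "\<omega> \<in> space P"
    have "(\<Sum>c\<in>paths. \<Sum>s\<in>S. h (c n) s * indicator (cyl (Suc n) (e c s)) \<omega>)
        = (\<Sum>c\<in>paths. h (c n) (X (Suc n) \<omega>) * indicator (cyl n c) \<omega>)"
    proof (rule sum.cong[OF refl])
      fix c assume "c \<in> paths"
      have "\<omega> \<in> cyl (Suc n) (e c s) \<longleftrightarrow> \<omega> \<in> cyl n c \<and> s = X (Suc n) \<omega>" for s
        by (auto simp: cyl_def e_def le_Suc_eq)
      then have "(\<Sum>s\<in>S. h (c n) s * indicator (cyl (Suc n) (e c s)) \<omega>)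
          = (\<Sum>s\<in>S. if s = X (Suc n) \<omega> then h (c n) s * indicator (cyl n c) \<omega> else 0)"
        by (intro sum.cong) (auto simp: indicator_def)
      also have "\<dots> = h (c n) (X (Suc n) \<omega>) * indicator (cyl n c) \<omega>"
        using XS[OF \<omega>] S by (subst sum.delta) auto
      finally show "(\<Sum>s\<in>S. h (c n) s * indicator (cyl (Suc n) (e c s)) \<omega>)
          = h (c n) (X (Suc n) \<omega>) * indicator (cyl n c) \<omega>" .
    qed
    also have "\<dots> = h (X n \<omega>) (X (Suc n) \<omega>)" by (subst expand[OF \<omega>]) simp
    finally show "h (X n \<omega>) (X (Suc n) \<omega>)
      = (\<Sum>c\<in>paths. \<Sum>s\<in>S. h (c n) s * indicator (cyl (Suc n) (e c s)) \<omega>)" by simp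
  qed
  also have "\<dots> = (\<Sum>c\<in>paths. \<Sum>s\<in>S. h (c n) s * prob (cyl (Suc n) (e c s)))"
    using cyl_sets int_ind
    by (simp add: Bochner_Integration.integral_sum Bochner_Integration.integrable_sum Int_absorb2 sets.sets_into_space)
  also have "\<dots> = (\<Sum>c\<in>paths. prob (cyl n c) * measure_pmf.expectation (K (c n)) (h (c n)))"
  proof (rule sum.cong[OF refl])
    fix c assume c: "c \<in> paths"
    then have "set_pmf (K (c n)) \<subseteq> S" by (intro closed) (auto simp: paths_def)
    then have "measure_pmf.expectation (K (c n)) (h (c n)) = (\<Sum>s\<in>S. h (c n) s * pmf (K (c n)) s)"
      using S by (intro integral_measure_pmf_real) auto
    then show "(\<Sum>s\<in>S. h (c n) s * prob (cyl (Suc n) (e c s)))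
        = prob (cyl n c) * measure_pmf.expectation (K (c n)) (h (c n))"
      using step[OF c] by (simp add: sum_distrib_left mult_ac)
  qed
  also have "\<dots> = (\<integral>\<omega>. (\<Sum>c\<in>paths. measure_pmf.expectation (K (c n)) (h (c n)) * indicator (cyl n c) \<omega>) \<partial>P)"
    using cyl_sets int_ind
    by (simp add: Bochner_Integration.integral_sum Int_absorb2 sets.sets_into_space mult.commute)
  also have "\<dots> = (\<integral>\<omega>. measure_pmf.expectation (K (X n \<omega>)) (h (X n \<omega>)) \<partial>P)"
    by (rule Bochner_Integration.integral_cong[OF refl]) (simp add: expand)
  finally show ?thesis .
qed

lemma ode_mean_value:
  assumes "ode_solution f I m" "0 \<le> a" "a < b"
  obtains \<xi> where "a < \<xi>" "\<xi> < b" "m b - m a = (b - a) * f (m \<xi>)"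
proof -
  have der: "(m has_real_derivative f (m t)) (at t within {0..})" if "t \<ge> 0" for t
    using assms that by (auto simp: ode_solution_def)
  have "\<exists>\<xi>. a < \<xi> \<and> \<xi> < b \<and> m b - m a = (*) (f (m \<xi>)) (b - a)"
  proof (rule mvt[OF \<open>a < b\<close>])
    show "continuous_on {a..b} m"
      unfolding continuous_on_eq_continuous_within
      using assms by (auto intro!: DERIV_continuous[OF DERIV_subset[OF der]])
    fix t assume t: "a < t" "t < b"
    have "at t within {0..} = at t" by (rule at_within_interior) (use t assms in auto)
    then show "(m has_derivative (*) (f (m t))) (at t)"
      using der[of t] t assms by (simp add: has_field_derivative_def)
  qed auto
  then show ?thesis using that by (auto simp: mult.commute)
qed

subsection \<open>The mean square distance to the solution\<close>

text \<open>
  The common setting of the convergence proof: a solution \<open>m\<close> of the limit equation, the chains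
  for all \<open>N \<ge> p\<close>, and constants \<open>L\<close> and \<open>G\<close> for the drift. \<open>G\<close> is also a Lipschitz constant of
  \<open>m\<close>.
\<close>

locale curie_weiss_limit =
  fixes p :: nat and \<beta> :: real and m0 :: real and m :: "real \<Rightarrow> real" and L G :: real
    and P :: "nat \<Rightarrow> 'a measure" and \<sigma> :: "nat \<Rightarrow> nat \<Rightarrow> 'a \<Rightarrow> nat \<Rightarrow> real"
  assumes p: "1 \<le> p" and \<beta>: "0 \<le> \<beta>"
    and sol: "ode_solution (drift p \<beta>) {-1..1} m" and m_init: "m 0 = m0"
    and lip: "\<And>a b. a \<in> {-1..1} \<Longrightarrow> b \<in> {-1..1} \<Longrightarrow> \<bar>drift p \<beta> a - drift p \<beta> b\<bar> \<le> L * \<bar>a - b\<bar>"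
    and bdd: "\<And>a. a \<in> {-1..1} \<Longrightarrow> \<bar>drift p \<beta> a\<bar> \<le> G" and L: "0 \<le> L"
    and chain: "\<And>N. N \<ge> p \<Longrightarrow> markov_chain (P N) (spin_configs N) (batch_step N p \<beta>) (\<sigma> N)"
    and init: "weak_conv_m (\<lambda>N. distr (P N) borel (\<lambda>\<omega>. magnetization N (\<sigma> N 0 \<omega>))) (return borel m0)"
begin

definition msd :: "nat \<Rightarrow> nat \<Rightarrow> real" where
  "msd N n = (\<integral>\<omega>. (magnetization N (\<sigma> N n \<omega>) - m (n / N))\<^sup>2 \<partial>P N)"

definition step_error :: real where
  "step_error = 4 * (sampling_error p + L * G) + (2 + G)\<^sup>2"

lemma m_range: "t \<ge> 0 \<Longrightarrow> m t \<in> {-1..1}"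
  using sol by (auto simp: ode_solution_def)

lemma G_nonneg: "0 \<le> G" using bdd[of 0] by auto

lemma m_lipschitz: "0 \<le> a \<Longrightarrow> a \<le> b \<Longrightarrow> \<bar>m b - m a\<bar> \<le> G * (b - a)"
proof (cases "a = b")
  case False
  assume "0 \<le> a" "a \<le> b"
  with False have ab: "0 \<le> a" "a < b" by auto
  then obtain \<xi> where "a < \<xi>" "m b - m a = (b - a) * drift p \<beta> (m \<xi>)"
    using ode_mean_value[OF sol] by blast
  with ab bdd[OF m_range, of \<xi>] show ?thesis by (simp add: abs_mult mult.commute mult_left_mono)
qed simp

lemma m_increment:
  assumes "0 \<le> a" "a < b"
  shows "\<bar>m b - m a - (b - a) * drift p \<beta> (m a)\<bar> \<le> L * G * (b - a)\<^sup>2"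
proof -
  obtain \<xi> where \<xi>: "a < \<xi>" "\<xi> < b" "m b - m a = (b - a) * drift p \<beta> (m \<xi>)"
    using ode_mean_value[OF sol assms] by blast
  have "\<bar>drift p \<beta> (m \<xi>) - drift p \<beta> (m a)\<bar> \<le> L * \<bar>m \<xi> - m a\<bar>"
    using \<xi> assms by (intro lip m_range) auto
  also have "\<dots> \<le> L * (G * (\<xi> - a))"
    using \<xi> assms L by (intro mult_left_mono m_lipschitz) auto
  also have "\<dots> \<le> L * (G * (b - a))"
    using \<xi> L G_nonneg by (intro mult_left_mono) auto
  finally have "(b - a) * \<bar>drift p \<beta> (m \<xi>) - drift p \<beta> (m a)\<bar> \<le> (b - a) * (L * (G * (b - a)))"
    using assms by (intro mult_left_mono) auto
  moreover have "m b - m a - (b - a) * drift p \<beta> (m a) = (b - a) * (drift p \<beta> (m \<xi>) - drift p \<beta> (m a))"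
    using \<xi>(3) by (simp add: algebra_simps)
  ultimately show ?thesis using assms by (simp add: abs_mult power2_eq_square mult_ac)
qed

text \<open>
  Expanding the square, the cross term contains the expected increment minus the increment of \<open>m\<close>;
  by the Lipschitz property it contributes \<open>2 L / N\<close> times the square itself, up to \<open>O(1 / N\<^sup>2)\<close>. The
  square of the increments is \<open>O(1 / N\<^sup>2)\<close> as well.
\<close>

lemma one_step_square:
  assumes N: "N \<ge> p" and s: "s \<in> spin_configs N" and t: "t \<ge> 0"
  shows "measure_pmf.expectation (batch_step N p \<beta> s) (\<lambda>\<tau>. (magnetization N \<tau> - m (t + 1 / N))\<^sup>2)
    \<le> (1 + 2 * L / N) * (magnetization N s - m t)\<^sup>2 + step_error / (real N)\<^sup>2"
proof -
  define x where "x = magnetization N s"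
  define \<delta> where "\<delta> = m (t + 1 / N) - m t"
  define K where "K = batch_step N p \<beta> s"
  have N0: "N > 0" using N p by simp
  have fin: "finite (set_pmf K)"
    using batch_step_support[OF p N s] unfolding K_def
    by (intro finite_subset[OF _ finite_spin_configs[of N]]) auto
  have int: "integrable K f" for f :: "(nat \<Rightarrow> real) \<Rightarrow> real"
    using fin by (rule integrable_measure_pmf_finite)
  have xr: "x \<in> {-1..1}" unfolding x_def by (rule magnetization_bounds[OF s])
  have \<delta>: "\<bar>\<delta>\<bar> \<le> G / N"
    using m_lipschitz[of t "t + 1 / N"] t by (simp add: \<delta>_def)
  define d where "d = measure_pmf.expectation K (\<lambda>\<tau>. magnetization N \<tau> - x)"
  have E: "\<bar>d - drift p \<beta> x / N\<bar> \<le> sampling_error p / (real N)\<^sup>2"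
    unfolding d_def K_def x_def using expected_increment[OF p N \<beta> s] by simp
  have "measure_pmf.expectation K (\<lambda>\<tau>. (magnetization N \<tau> - m (t + 1 / N))\<^sup>2)
    \<le> measure_pmf.expectation K (\<lambda>\<tau>. (x - m t)\<^sup>2
        + 2 * (x - m t) * ((magnetization N \<tau> - x) - \<delta>) + (2 + G)\<^sup>2 / (real N)\<^sup>2)"
  proof (rule integral_mono_AE[OF int int], rule AE_pmfI)
    fix \<tau> assume "\<tau> \<in> set_pmf K"
    then have "\<bar>magnetization N \<tau> - x\<bar> \<le> 2 / N"
      using batch_step_support[OF p N s] unfolding K_def x_def by blast
    then have "\<bar>magnetization N \<tau> - x - \<delta>\<bar> \<le> 2 / N + G / N" using \<delta> by linarith
    then have "(magnetization N \<tau> - x - \<delta>)\<^sup>2 \<le> ((2 + G) / N)\<^sup>2"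
      by (simp add: add_divide_distrib abs_le_square_iff[symmetric] G_nonneg)
    then show "(magnetization N \<tau> - m (t + 1 / N))\<^sup>2
        \<le> (x - m t)\<^sup>2 + 2 * (x - m t) * ((magnetization N \<tau> - x) - \<delta>) + (2 + G)\<^sup>2 / (real N)\<^sup>2"
      by (simp add: \<delta>_def power_divide power2_eq_square algebra_simps)
  qed
  also have "\<dots> = (x - m t)\<^sup>2
      + 2 * (x - m t) * (d - \<delta>) + (2 + G)\<^sup>2 / (real N)\<^sup>2"
    by (simp add: d_def Bochner_Integration.integral_add Bochner_Integration.integral_diff int)
  also have "\<dots> \<le> (x - m t)\<^sup>2
      + (2 * L / N * (x - m t)\<^sup>2 + 4 * (sampling_error p + L * G) / (real N)\<^sup>2) + (2 + G)\<^sup>2 / (real N)\<^sup>2"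
  proof (intro add_mono order_refl)
    have "\<bar>\<delta> - drift p \<beta> (m t) / N\<bar> \<le> L * G / (real N)\<^sup>2"
      using m_increment[of t "t + 1 / N"] t N0 by (simp add: \<delta>_def power_divide)
    moreover have "\<bar>drift p \<beta> x / N - drift p \<beta> (m t) / N\<bar> \<le> L / N * \<bar>x - m t\<bar>"
      using lip[OF xr m_range[OF t]] N0 by (simp add: divide_right_mono flip: diff_divide_distrib)
    ultimately have "\<bar>d - \<delta>\<bar>
        \<le> L / N * \<bar>x - m t\<bar> + (sampling_error p + L * G) / (real N)\<^sup>2"
      using E by (simp add: add_divide_distrib)
    then have "2 * \<bar>x - m t\<bar> * \<bar>d - \<delta>\<bar>
        \<le> 2 * \<bar>x - m t\<bar> * (L / N * \<bar>x - m t\<bar> + (sampling_error p + L * G) / (real N)\<^sup>2)"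
      by (intro mult_left_mono) auto
    also have "\<dots> = 2 * L / N * (x - m t)\<^sup>2 + 2 * \<bar>x - m t\<bar> * ((sampling_error p + L * G) / (real N)\<^sup>2)"
      by (simp add: power2_eq_square algebra_simps add_divide_distrib diff_divide_distrib flip: abs_mult)
    also have "\<dots> \<le> 2 * L / N * (x - m t)\<^sup>2 + 2 * 2 * ((sampling_error p + L * G) / (real N)\<^sup>2)"
      using xr m_range[OF t] L G_nonneg
      by (intro add_left_mono mult_right_mono) (auto simp: sampling_error_def)
    finally have "2 * \<bar>x - m t\<bar> * \<bar>d - \<delta>\<bar>
        \<le> 2 * L / N * (x - m t)\<^sup>2 + 4 * (sampling_error p + L * G) / (real N)\<^sup>2" by simp
    moreover have "2 * (x - m t) * (d - \<delta>)
      \<le> 2 * \<bar>x - m t\<bar> * \<bar>d - \<delta>\<bar>"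
      by (metis abs_ge_self abs_mult abs_numeral)
    ultimately show "2 * (x - m t) * (d - \<delta>)
      \<le> 2 * L / N * (x - m t)\<^sup>2 + 4 * (sampling_error p + L * G) / (real N)\<^sup>2" by linarith
  qed
  also have "\<dots> = (1 + 2 * L / N) * (x - m t)\<^sup>2 + step_error / (real N)\<^sup>2"
    by (simp add: step_error_def add_divide_distrib algebra_simps)
  finally show ?thesis by (simp add: K_def x_def)
qed

lemma spin_measurable:
  assumes "N \<ge> p"
  shows "(\<lambda>\<omega>. f (\<sigma> N n \<omega>) :: real) \<in> borel_measurable (P N)"
proof (rule measurable_compose[where f = "\<sigma> N n" and g = f and N = "count_space (spin_configs N)"])
  show "\<sigma> N n \<in> P N \<rightarrow>\<^sub>M count_space (spin_configs N)"
    using chain[OF assms] by (simp add: markov_chain_def)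
qed simp

lemma spin_in: "N \<ge> p \<Longrightarrow> \<omega> \<in> space (P N) \<Longrightarrow> \<sigma> N n \<omega> \<in> spin_configs N"
  using chain[of N] measurable_space[of "\<sigma> N n" "P N" "count_space (spin_configs N)" \<omega>]
  by (simp add: markov_chain_def)

lemma prob_space_P: "N \<ge> p \<Longrightarrow> prob_space (P N)"
  using chain[of N] by (simp add: markov_chain_def)

lemma spin_integrable:
  assumes "N \<ge> p"
  shows "integrable (P N) (\<lambda>\<omega>. f (\<sigma> N n \<omega>) :: real)"
proof -
  interpret prob_space "P N" by (rule prob_space_P[OF assms])
  show ?thesis
  proof (rule integrable_const_bound[of _ "\<Sum>s\<in>spin_configs N. \<bar>f s\<bar>"])
    show "AE \<omega> in P N. norm (f (\<sigma> N n \<omega>)) \<le> (\<Sum>s\<in>spin_configs N. \<bar>f s\<bar>)"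
      using spin_in[OF assms] by (auto intro!: AE_I2 member_le_sum[of _ _ "\<lambda>s. \<bar>f s\<bar>"])
  qed (rule spin_measurable[OF assms])
qed

lemma integral_step:
  fixes h :: "(nat \<Rightarrow> real) \<Rightarrow> (nat \<Rightarrow> real) \<Rightarrow> real"
  assumes "N \<ge> p"
  shows "(\<integral>\<omega>. h (\<sigma> N n \<omega>) (\<sigma> N (Suc n) \<omega>) \<partial>P N)
    = (\<integral>\<omega>. measure_pmf.expectation (batch_step N p \<beta> (\<sigma> N n \<omega>)) (h (\<sigma> N n \<omega>)) \<partial>P N)"
  by (rule markov_chain_integral_step[where h = h and n = n, OF chain[OF assms] finite_spin_configs])
     (use batch_step_support[OF p assms] in blast)

lemma msd_step:
  assumes N: "N \<ge> p"
  shows "msd N (Suc n) \<le> (1 + 2 * L / N) * msd N n + step_error / (real N)\<^sup>2"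
proof -
  interpret prob_space "P N" by (rule prob_space_P[OF N])
  have N0: "N > 0" using N p by simp
  have eq: "real (Suc n) / N = n / N + 1 / N" by (simp add: add_divide_distrib)
  have "msd N (Suc n) = (\<integral>\<omega>. measure_pmf.expectation (batch_step N p \<beta> (\<sigma> N n \<omega>))
      (\<lambda>\<tau>. (magnetization N \<tau> - m (n / N + 1 / N))\<^sup>2) \<partial>P N)"
    unfolding msd_def eq using integral_step[OF N, of "\<lambda>_ \<tau>. (magnetization N \<tau> - m (n / N + 1 / N))\<^sup>2"] .
  also have "\<dots> \<le> (\<integral>\<omega>. (1 + 2 * L / N) * (magnetization N (\<sigma> N n \<omega>) - m (n / N))\<^sup>2
      + step_error / (real N)\<^sup>2 \<partial>P N)"
  proof (rule integral_mono)
    fix \<omega> assume "\<omega> \<in> space (P N)"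
    then show "measure_pmf.expectation (batch_step N p \<beta> (\<sigma> N n \<omega>))
        (\<lambda>\<tau>. (magnetization N \<tau> - m (n / N + 1 / N))\<^sup>2)
      \<le> (1 + 2 * L / N) * (magnetization N (\<sigma> N n \<omega>) - m (n / N))\<^sup>2 + step_error / (real N)\<^sup>2"
      by (intro one_step_square[OF N] spin_in[OF N]) auto
  qed (rule spin_integrable[OF N])+
  also have "\<dots> = (1 + 2 * L / N) * msd N n + step_error / (real N)\<^sup>2"
    unfolding msd_def
    by (subst Bochner_Integration.integral_add)
       (auto intro!: integrable_mult_right spin_integrable[OF N] simp: prob_space)
  finally show ?thesis .
qed

lemma step_error_nonneg: "0 \<le> step_error"
  using L G_nonneg by (auto simp: step_error_def sampling_error_def intro!: add_nonneg_nonneg mult_nonneg_nonneg)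

lemma msd_nonneg: "0 \<le> msd N n"
  unfolding msd_def by (rule Bochner_Integration.integral_nonneg) simp

text \<open>
  The discrete Gronwall inequality. Over \<open>N * T\<close> steps the errors of order \<open>1 / N\<^sup>2\<close> add up to order
  \<open>1 / N\<close>.
\<close>

lemma msd_bound:
  assumes N: "N \<ge> p" and n: "n \<le> N * T"
  shows "msd N n \<le> exp (2 * L * T) * (msd N 0 + T * step_error / N)"
proof -
  have N0: "N > 0" using N p by simp
  define r where "r = 1 + 2 * L / N"
  have r: "r \<ge> 1" using L by (simp add: r_def)
  have "msd N n \<le> r ^ n * (msd N 0 + n * (step_error / (real N)\<^sup>2))" for n
  proof (induction n)
    case (Suc n)
    have "msd N (Suc n) \<le> r * msd N n + step_error / (real N)\<^sup>2"
      using msd_step[OF N] by (simp add: r_def)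
    also have "\<dots> \<le> r * (r ^ n * (msd N 0 + n * (step_error / (real N)\<^sup>2))) + r ^ Suc n * (step_error / (real N)\<^sup>2)"
    proof (intro add_mono mult_left_mono Suc)
      have "1 * (step_error / (real N)\<^sup>2) \<le> r ^ Suc n * (step_error / (real N)\<^sup>2)"
        using r step_error_nonneg by (intro mult_right_mono one_le_power) auto
      then show "step_error / (real N)\<^sup>2 \<le> r ^ Suc n * (step_error / (real N)\<^sup>2)" by simp
    qed (use r in auto)
    also have "\<dots> = r ^ Suc n * (msd N 0 + Suc n * (step_error / (real N)\<^sup>2))"
      by (simp add: algebra_simps add_divide_distrib)
    finally show ?case .
  qed simp
  also have "r ^ n * (msd N 0 + n * (step_error / (real N)\<^sup>2)) \<le> exp (2 * L * T) * (msd N 0 + T * step_error / N)"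
  proof (intro mult_mono add_left_mono)
    have "r ^ n \<le> exp (2 * L / N) ^ n"
      using r exp_ge_add_one_self[of "2 * L / N"] by (intro power_mono) (auto simp: r_def)
    also have "\<dots> = exp (n * (2 * L / N))" unfolding exp_of_nat_mult ..
    also have "\<dots> \<le> exp (2 * L * T)"
    proof -
      have "n * (2 * L) \<le> (N * T) * (2 * L)" using n L by (intro mult_right_mono) auto
      then show ?thesis using N0 by (simp add: field_simps)
    qed
    finally show "r ^ n \<le> exp (2 * L * T)" .
    have "n * step_error \<le> N * T * step_error"
      using n step_error_nonneg by (intro mult_right_mono) auto
    then show "n * (step_error / (real N)\<^sup>2) \<le> T * step_error / N"
      using N0 by (simp add: field_simps power2_eq_square)
    show "0 \<le> msd N 0 + n * (step_error / (real N)\<^sup>2)"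
      using step_error_nonneg msd_nonneg by (intro add_nonneg_nonneg mult_nonneg_nonneg) auto
  qed auto
  finally show ?thesis .
qed

text \<open>
  Magnetizations and \<open>m0\<close> lie in \<open>[-1, 1]\<close>, so the squared distance agrees with the bounded continuous
  function \<open>(min 2 \<bar>x - m0\<bar>)\<^sup>2\<close>, to which weak convergence applies.
\<close>

lemma msd_initial: "(\<lambda>N. msd N 0) \<longlonglongrightarrow> 0"
proof -
  \<comment> \<open>shifted by \<open>p\<close>, since \<open>P N\<close> need not be a probability measure for \<open>N < p\<close>\<close>
  define \<mu> where "\<mu> N = distr (P (N + p)) borel (\<lambda>\<omega>. magnetization (N + p) (\<sigma> (N + p) 0 \<omega>))" for N
  define f where "f x = (min 2 \<bar>x - m0\<bar>)\<^sup>2" for x :: real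
  have f_borel: "f \<in> borel_measurable borel" unfolding f_def[abs_def] by (intro borel_measurable_continuous_onI continuous_intros)
  have rd: "real_distribution (\<mu> N)" for N
    unfolding \<mu>_def using prob_space.real_distribution_distr[OF prob_space_P spin_measurable, of "N + p"] by simp
  have conv: "weak_conv_m \<mu> (return borel m0)"
    using init unfolding weak_conv_m_def weak_conv_def \<mu>_def
    by (auto intro: LIMSEQ_ignore_initial_segment[where k = p])
  have ret: "real_distribution (return borel m0)"
    by (auto simp: real_distribution_def real_distribution_axioms_def intro!: prob_space_return)
  have "(\<lambda>N. integral\<^sup>L (\<mu> N) f) \<longlonglongrightarrow> integral\<^sup>L (return borel m0) f"
  proof (rule weak_conv_imp_integral_bdd_continuous_conv[OF rd ret conv])
    show "isCont f x" for x unfolding f_def by (intro continuous_intros)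
    show "norm (f x) \<le> 4" for x
    proof -
      have "(min 2 \<bar>x - m0\<bar>)\<^sup>2 \<le> 2\<^sup>2" by (intro power_mono) auto
      then show ?thesis by (simp add: f_def)
    qed
  qed
  moreover have "integral\<^sup>L (return borel m0) f = 0"
    by (subst integral_return[OF _ f_borel]) (auto simp: f_def)
  moreover have "integral\<^sup>L (\<mu> N) f = msd (N + p) 0" for N
  proof -
    have "integral\<^sup>L (\<mu> N) f = (\<integral>\<omega>. f (magnetization (N + p) (\<sigma> (N + p) 0 \<omega>)) \<partial>P (N + p))"
      unfolding \<mu>_def
      by (rule integral_distr[OF spin_measurable f_borel]) simp
    also have "\<dots> = msd (N + p) 0" unfolding msd_def
    proof (rule Bochner_Integration.integral_cong[OF refl])
      fix \<omega> assume "\<omega> \<in> space (P (N + p))"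
      let ?M = "magnetization (N + p) (\<sigma> (N + p) 0 \<omega>)"
      have "?M \<in> {-1..1}"
        using \<open>\<omega> \<in> _\<close> by (intro magnetization_bounds spin_in) auto
      moreover have "m0 \<in> {-1..1}" using m_range[of 0] m_init by simp
      ultimately have "\<bar>?M - m0\<bar> \<le> 2" by auto
      then show "f (?M)
          = (?M - m (real 0 / real (N + p)))\<^sup>2"
        by (simp add: f_def m_init min_absorb2)
    qed
    finally show ?thesis .
  qed
  ultimately have "(\<lambda>N. msd (N + p) 0) \<longlonglongrightarrow> 0" by simp
  then show ?thesis by (rule LIMSEQ_offset)
qed

lemma increments_AE:
  assumes N: "N \<ge> p"
  shows "AE \<omega> in P N. \<forall>n. \<bar>magnetization N (\<sigma> N (Suc n) \<omega>) - magnetization N (\<sigma> N n \<omega>)\<bar> \<le> 2 / N"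
  unfolding AE_all_countable
proof
  fix n
  interpret prob_space "P N" by (rule prob_space_P[OF N])
  define h where "h s \<tau> = (if \<bar>magnetization N \<tau> - magnetization N s\<bar> \<le> 2 / N then 0 else 1 :: real)" for s \<tau>
  have [measurable]: "(\<lambda>\<omega>. magnetization N (\<sigma> N n \<omega>)) \<in> borel_measurable (P N)" for n
    by (rule spin_measurable[OF N])
  have hm: "(\<lambda>\<omega>. h (\<sigma> N n \<omega>) (\<sigma> N (Suc n) \<omega>)) \<in> borel_measurable (P N)"
    unfolding h_def by measurable
  have "(\<integral>\<omega>. h (\<sigma> N n \<omega>) (\<sigma> N (Suc n) \<omega>) \<partial>P N) = (\<integral>\<omega>. 0 \<partial>P N)"
    unfolding integral_step[OF N]
  proof (rule Bochner_Integration.integral_cong[OF refl])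
    fix \<omega> assume \<omega>: "\<omega> \<in> space (P N)"
    let ?K = "batch_step N p \<beta> (\<sigma> N n \<omega>)"
    have "measure_pmf.expectation ?K (h (\<sigma> N n \<omega>)) = measure_pmf.expectation ?K (\<lambda>_. 0)"
      using batch_step_support[OF p N spin_in[OF N \<omega>]]
      by (intro integral_cong_AE) (auto simp: h_def intro!: AE_pmfI)
    then show "measure_pmf.expectation ?K (h (\<sigma> N n \<omega>)) = 0" by simp
  qed
  moreover have "integrable (P N) (\<lambda>\<omega>. h (\<sigma> N n \<omega>) (\<sigma> N (Suc n) \<omega>))"
    using hm by (rule integrable_const_bound[of _ 1, rotated]) (auto simp: h_def)
  ultimately have "AE \<omega> in P N. h (\<sigma> N n \<omega>) (\<sigma> N (Suc n) \<omega>) = 0"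
    by (subst integral_nonneg_eq_0_iff_AE[symmetric]) (auto simp: h_def)
  then show "AE \<omega> in P N. \<bar>magnetization N (\<sigma> N (Suc n) \<omega>) - magnetization N (\<sigma> N n \<omega>)\<bar> \<le> 2 / N"
    by eventually_elim (auto simp: h_def split: if_splits)
qed

text \<open>
  The exceptional event is that some increment exceeds \<open>2 / N\<close>, which has probability \<open>0\<close>, or that the
  magnetization is far from \<open>m\<close> at one of the grid times \<open>j h\<close>, which Chebyshev's inequality
  controls. Outside of it, neither the magnetization nor \<open>m\<close> can move far between neighbouring grid times.
\<close>

lemma closeness:
  assumes T: "T \<ge> 0" and \<delta>: "\<delta> > 0"
  shows "\<exists>A. (\<forall>N\<ge>p. A N \<in> sets (P N)) \<and> (\<lambda>N. measure (P N) (A N)) \<longlonglongrightarrow> 0 \<and>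
    (\<forall>\<^sub>F N in sequentially. \<forall>\<omega>\<in>space (P N) - A N. \<forall>t\<in>{0..T}.
      \<bar>magnetization N (\<sigma> N (nat \<lfloor>real N * t\<rfloor>) \<omega>) - m t\<bar> \<le> \<delta>)"
proof -
  \<comment> \<open>the difference of magnetization and solution changes by at most \<open>(2 + G) (h + 1 / N)\<close>
      between two grid times;
      this mesh makes it at most \<open>\<delta> / 2\<close> for large \<open>N\<close>\<close>
  define h where "h = \<delta> / (4 * (2 + G))"
  have h: "h > 0" "(2 + G) * h = \<delta> / 4" using \<delta> G_nonneg by (auto simp: h_def field_simps)
  define J where "J = nat \<lceil>T / h\<rceil>"
  define node where "node N j = nat \<lfloor>real N * (real j * h)\<rfloor>" for N j :: nat
  define E where "E N j = {\<omega> \<in> space (P N). \<bar>magnetization N (\<sigma> N (node N j) \<omega>) - m (node N j / N)\<bar> \<ge> \<delta> / 2}"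
    for N j
  define jump where "jump N = {\<omega> \<in> space (P N). \<not> (\<forall>n. \<bar>magnetization N (\<sigma> N (Suc n) \<omega>)
      - magnetization N (\<sigma> N n \<omega>)\<bar> \<le> 2 / N)}" for N
  define A where "A N = (\<Union>j\<in>{..J}. E N j) \<union> jump N" for N
  define R where "R N = exp (2 * L * (J * h)) * (msd N 0 + (J * h) * step_error / N)" for N
  have E_sets: "E N j \<in> sets (P N)" if "N \<ge> p" for N j
    unfolding E_def using spin_measurable[OF that, of "\<lambda>s. \<bar>magnetization N s - m (node N j / N)\<bar>"]
    by measurable
  have jump_sets: "jump N \<in> sets (P N)" if "N \<ge> p" for N
    unfolding jump_def using spin_measurable[OF that, of "magnetization N"] by measurable
  have A_sets: "A N \<in> sets (P N)" if "N \<ge> p" for N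
    unfolding A_def using E_sets jump_sets that by auto
  have A_prob: "measure (P N) (A N) \<le> (J + 1) * (R N / (\<delta> / 2)\<^sup>2)" if N: "N \<ge> p" for N
  proof -
    interpret prob_space "P N" by (rule prob_space_P[OF N])
    have "prob (E N j) \<le> R N / (\<delta> / 2)\<^sup>2" if "j \<le> J" for j
    proof -
      have "prob (E N j) \<le> msd N (node N j) / (\<delta> / 2)\<^sup>2"
        unfolding E_def msd_def
        by (rule second_moment_method[OF spin_measurable[OF N] spin_integrable[OF N]]) (use \<delta> in auto)
      also have "\<dots> \<le> R N / (\<delta> / 2)\<^sup>2"
      proof (intro divide_right_mono)
        have "real (node N j) \<le> N * (j * h)" using h by (simp add: node_def)
        also have "\<dots> \<le> N * (J * h)" using that h by (intro mult_left_mono mult_right_mono) auto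
        finally show "msd N (node N j) \<le> R N" unfolding R_def by (rule msd_bound[OF N])
      qed simp
      finally show ?thesis .
    qed
    then have "(\<Sum>j\<in>{..J}. prob (E N j)) \<le> (\<Sum>j\<in>{..J}. R N / (\<delta> / 2)\<^sup>2)"
      by (intro sum_mono) auto
    moreover have "prob (\<Union>j\<in>{..J}. E N j) \<le> (\<Sum>j\<in>{..J}. prob (E N j))"
      using E_sets[OF N] by (intro finite_measure_subadditive_finite) auto
    moreover have "prob (jump N) = 0"
    proof -
      have "emeasure (P N) (jump N) = 0"
        using increments_AE[OF N] jump_sets[OF N] unfolding jump_def
        by (subst (asm) AE_iff_measurable[OF _ refl]) auto
      then show ?thesis by (simp add: measure_def)
    qed
    moreover have "prob (A N) \<le> prob (\<Union>j\<in>{..J}. E N j) + prob (jump N)"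
      unfolding A_def using E_sets[OF N] jump_sets[OF N] by (intro measure_Un_le) auto
    ultimately show ?thesis by simp
  qed
  have R_lim: "R \<longlonglongrightarrow> 0"
  proof -
    have "(\<lambda>N. (J * h) * step_error / real N) \<longlonglongrightarrow> 0" by real_asymp
    then have "R \<longlonglongrightarrow> exp (2 * L * (J * h)) * (0 + 0)"
      unfolding R_def by (intro tendsto_mult tendsto_const tendsto_add msd_initial)
    then show ?thesis by simp
  qed
  have A_lim: "(\<lambda>N. measure (P N) (A N)) \<longlonglongrightarrow> 0"
  proof (rule real_tendsto_sandwich[OF _ _ tendsto_const])
    show "\<forall>\<^sub>F N in sequentially. measure (P N) (A N) \<le> (J + 1) * (R N / (\<delta> / 2)\<^sup>2)"
      using eventually_ge_at_top[of p] by eventually_elim (rule A_prob)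
    show "(\<lambda>N. (J + 1) * (R N / (\<delta> / 2)\<^sup>2)) \<longlonglongrightarrow> 0"
      by (rule tendsto_eq_intros R_lim refl | simp add: \<delta> less_imp_neq[symmetric])+
  qed simp
  have "\<forall>\<^sub>F N in sequentially. (2 + G) / real N < \<delta> / 4"
  proof (rule order_tendstoD(2)[of _ 0])
    show "(\<lambda>N. (2 + G) / real N) \<longlonglongrightarrow> 0" by real_asymp
  qed (use \<delta> in auto)
  then have "\<forall>\<^sub>F N in sequentially. \<forall>\<omega>\<in>space (P N) - A N. \<forall>t\<in>{0..T}.
      \<bar>magnetization N (\<sigma> N (nat \<lfloor>real N * t\<rfloor>) \<omega>) - m t\<bar> \<le> \<delta>"
    using eventually_ge_at_top[of p]
  proof eventually_elim
    case (elim N)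
    have N0: "N > 0" using elim p by simp
    show ?case
    proof safe
      fix \<omega> t assume \<omega>: "\<omega> \<in> space (P N)" "\<omega> \<notin> A N" and t: "t \<in> {0..T}"
      define v where "v n = magnetization N (\<sigma> N n \<omega>)" for n
      define j where "j = nat \<lfloor>t / h\<rfloor>"
      define n where "n = nat \<lfloor>real N * t\<rfloor>"
      define k where "k = node N j"
      have th: "0 \<le> t / h" using t h by simp
      then have j_bounds: "real j \<le> t / h" "t / h < real j + 1" by (auto simp: j_def)
      then have jt: "j * h \<le> t" "t < j * h + h" using h by (auto simp: field_simps)
      have "t / h \<le> T / h" using t h by (intro divide_right_mono) auto
      then have "j \<le> J" unfolding j_def J_def by linarith
      have n: "real n \<le> N * t" using t by (simp add: n_def)
      have kr: "real k \<le> N * (j * h)" "N * (j * h) < real k + 1"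
        using h by (auto simp: k_def node_def)
      have "k \<le> n" unfolding k_def node_def n_def
        using jt N0 by (intro nat_mono floor_mono mult_left_mono) auto
      have kn: "(real n - real k) / N \<le> h + 1 / N"
      proof -
        have "N * t \<le> N * (j * h + h)" using jt by (intro mult_left_mono) auto
        then have "real n - real k \<le> N * h + 1" using n kr by (simp add: algebra_simps)
        then have "(real n - real k) / N \<le> (N * h + 1) / N" by (intro divide_right_mono) auto
        then show ?thesis using N0 by (simp add: add_divide_distrib)
      qed
      have k_node: "real k / N \<le> t" "t - real k / N \<le> h + 1 / N"
      proof -
        have "real k / N \<le> N * (j * h) / N" using kr by (intro divide_right_mono) auto
        then show "real k / N \<le> t" using N0 jt by simp
        have "N * (j * h) / N \<le> (real k + 1) / N" using kr by (intro divide_right_mono) auto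
        then show "t - real k / N \<le> h + 1 / N" using N0 jt by (simp add: add_divide_distrib)
      qed
      have inc: "\<bar>v (Suc i) - v i\<bar> \<le> 2 / N" for i
        using \<omega> by (auto simp: A_def jump_def v_def)
      have "\<bar>v (k + i) - v k\<bar> \<le> i * (2 / N)" for i
      proof (induction i)
        case (Suc i)
        then show ?case using inc[of "k + i"] by (simp add: algebra_simps add_divide_distrib)
      qed simp
      from this[of "n - k"] have "\<bar>v n - v k\<bar> \<le> 2 * ((real n - real k) / N)"
        using \<open>k \<le> n\<close> by (simp add: of_nat_diff mult.commute)
      also have "\<dots> \<le> 2 * (h + 1 / N)" using kn by (rule mult_left_mono) simp
      finally have 1: "\<bar>v n - v k\<bar> \<le> 2 * (h + 1 / N)" .
      have 2: "\<bar>v k - m (k / N)\<bar> \<le> \<delta> / 2"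
        using \<omega> \<open>j \<le> J\<close> by (force simp: A_def E_def v_def k_def)
      have "\<bar>m t - m (k / N)\<bar> \<le> G * (t - k / N)"
        using k_node by (intro m_lipschitz) auto
      also have "\<dots> \<le> G * (h + 1 / N)" using k_node G_nonneg by (intro mult_left_mono) auto
      finally have 3: "\<bar>m t - m (k / N)\<bar> \<le> G * (h + 1 / N)" .
      have "2 * (h + 1 / N) + G * (h + 1 / N) = (2 + G) * h + (2 + G) / N"
        by (simp add: algebra_simps add_divide_distrib)
      also have "\<dots> \<le> \<delta> / 2" using h elim(1) by linarith
      finally show "\<bar>magnetization N (\<sigma> N (nat \<lfloor>real N * t\<rfloor>) \<omega>) - m t\<bar> \<le> \<delta>"
        using 1 2 3 unfolding v_def n_def by linarith
    qed
  qed
  with A_sets A_lim show ?thesis by blast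
qed

lemma rescaled_eq_step_path:
  "rescaled_magnetization N (\<sigma> N) = (\<lambda>\<omega>. step_path N (\<lambda>n. magnetization N (\<sigma> N n \<omega>)))"
  by (simp add: rescaled_magnetization_def step_path_def fun_eq_iff)

lemma rescaled_magnetization_measurable:
  assumes "N \<ge> p"
  shows "rescaled_magnetization N (\<sigma> N) \<in> P N \<rightarrow>\<^sub>M borel_of_topology skorokhod_topology"
  unfolding rescaled_eq_step_path
proof (rule measurable_step_path[where Y = "\<sigma> N" and v = "magnetization N" and S = "spin_configs N"])
  show "\<sigma> N n \<in> P N \<rightarrow>\<^sub>M count_space (spin_configs N)" for n
    using chain[OF assms] by (simp add: markov_chain_def)
qed (use assms p in \<open>auto intro: countable_finite\<close>)

lemma rescaled_magnetization_converges:
  "weak_conv_on skorokhod_topology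
    (\<lambda>N. distr (P N) (borel_of_topology skorokhod_topology) (rescaled_magnetization N (\<sigma> N)))
    (return (borel_of_topology skorokhod_topology) (restrict m {0..}))"
proof (rule weak_conv_to_deterministic_path[where ?N0.0 = p])
  show "restrict m {0..} \<in> cadlag_paths"
  proof (rule continuous_cadlag)
    show "continuous_on {0..} m"
      using sol unfolding continuous_on_eq_continuous_within ode_solution_def
      by (auto intro: DERIV_continuous)
  qed
  fix T \<delta> :: real assume "T \<ge> 0" "\<delta> > 0"
  then obtain A where A: "\<forall>N\<ge>p. A N \<in> sets (P N)" "(\<lambda>N. measure (P N) (A N)) \<longlonglongrightarrow> 0"
    "\<forall>\<^sub>F N in sequentially. \<forall>\<omega>\<in>space (P N) - A N. \<forall>t\<in>{0..T}.
      \<bar>magnetization N (\<sigma> N (nat \<lfloor>real N * t\<rfloor>) \<omega>) - m t\<bar> \<le> \<delta>"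
    using closeness by blast
  show "\<exists>A. (\<forall>N\<ge>p. A N \<in> sets (P N)) \<and> (\<lambda>N. measure (P N) (A N)) \<longlonglongrightarrow> 0 \<and>
    (\<forall>\<^sub>F N in sequentially. \<forall>\<omega>\<in>space (P N) - A N. \<forall>t\<in>{0..T}.
      \<bar>rescaled_magnetization N (\<sigma> N) \<omega> t - restrict m {0..} t\<bar> \<le> \<delta>)"
    using A by (intro exI[of _ A]) (simp add: rescaled_magnetization_def)
qed (use prob_space_P rescaled_magnetization_measurable in auto)

end

section \<open>The drift\<close>

lemma S1_eq: "S1 p \<beta> m = (\<Sum>k\<le>p-1. real ((p-1) choose k) * ((1 - m) / 2) ^ k * ((1 + m) / 2) ^ (p-1-k)
    * accept_up p \<beta> k)"
  by (simp add: S1_def accept_up_def atLeast0AtMost)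

text \<open>
  Exchanging the roles of plus and minus spins is the reindexing \<open>k \<mapsto> p - 1 - k\<close>.
\<close>

lemma S2_eq_S1:
  assumes "p \<ge> 1"
  shows "S2 p \<beta> m = S1 p \<beta> (- m)"
proof -
  define q where "q = p - 1"
  have "S2 p \<beta> m = (\<Sum>k\<le>q. real (q choose k) * ((1 - m) / 2) ^ k * ((1 + m) / 2) ^ (q-k)
    * accept_down p \<beta> k)"
    by (simp add: S2_def accept_down_def atLeast0AtMost q_def)
  also have "\<dots> = (\<Sum>k\<le>q. real (q choose (q-k)) * ((1 - m) / 2) ^ (q-k) * ((1 + m) / 2) ^ (q-(q-k))
    * accept_down p \<beta> (q-k))"
    by (rule sum.reindex_bij_witness[of _ "\<lambda>k. q - k" "\<lambda>k. q - k"]) auto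
  also have "\<dots> = (\<Sum>k\<le>q. real (q choose k) * ((1 - (- m)) / 2) ^ k * ((1 + (- m)) / 2) ^ (q-k)
    * accept_up p \<beta> k)"
  proof (rule sum.cong[OF refl])
    fix k assume "k \<in> {..q}"
    then have k: "k \<le> q" by simp
    have "real p - 1 - 2 * real (q - k) = 2 * real k + 1 - real p"
      using k assms by (simp add: of_nat_diff q_def)
    then have "accept_down p \<beta> (q - k) = accept_up p \<beta> k"
      unfolding accept_down_def accept_up_def by (simp only:)
    then show "real (q choose (q-k)) * ((1 - m) / 2) ^ (q-k) * ((1 + m) / 2) ^ (q-(q-k))
      * accept_down p \<beta> (q-k) = real (q choose k) * ((1 - (- m)) / 2) ^ k * ((1 + (- m)) / 2) ^ (q-k)
      * accept_up p \<beta> k"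
      using k by (simp add: binomial_symmetric[symmetric] mult_ac)
  qed
  also have "\<dots> = S1 p \<beta> (- m)" by (simp add: S1_eq q_def)
  finally show ?thesis .
qed

lemma drift_eq:
  assumes "p \<ge> 1"
  shows "drift p \<beta> m = (1 - m) * S1 p \<beta> m - (1 + m) * S1 p \<beta> (- m)"
  using S2_eq_S1[OF assms, of \<beta> m] by (simp add: drift_def algebra_simps)

lemma S1_nonneg: "m \<in> {-1..1} \<Longrightarrow> 0 \<le> S1 p \<beta> m"
  unfolding S1_eq by (intro sum_nonneg mult_nonneg_nonneg) (auto simp: accept_up_def)

lemma drift_inward:
  assumes "p \<ge> 1"
  shows "drift p \<beta> (-1) \<ge> 0" "drift p \<beta> 1 \<le> 0"
  using S1_nonneg[of "-1" p \<beta>] by (auto simp: drift_eq[OF assms])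

lemma drift_zero: "p \<ge> 1 \<Longrightarrow> drift p \<beta> 0 = 0"
  by (simp add: drift_eq)

lemma drift_polynomial: "\<exists>Q. drift p \<beta> = poly Q"
proof -
  define A where "A w = (\<Sum>k\<le>p-1. smult (real ((p-1) choose k) * w k)
      ([:1/2, -1/2:] ^ k * [:1/2, 1/2:] ^ (p-1-k)))" for w :: "nat \<Rightarrow> real"
  have A: "poly (A w) m = (\<Sum>k\<le>p-1. real ((p-1) choose k) * ((1 - m) / 2) ^ k * ((1 + m) / 2) ^ (p-1-k)
    * w k)" for w m
  proof -
    have factors: "poly [:1/2, -1/2:] m = (1 - m) / 2" "poly [:1/2, 1/2:] m = (1 + m) / 2"
      by (auto simp: field_simps)
    show ?thesis
      unfolding A_def poly_sum poly_smult poly_mult poly_power factors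
      by (rule sum.cong) (simp_all only: mult_ac)
  qed
  have S1: "S1 p \<beta> m = poly (A (accept_up p \<beta>)) m" for m unfolding A by (rule S1_eq)
  have S2: "S2 p \<beta> m = poly (A (accept_down p \<beta>)) m" for m
    unfolding A by (simp add: S2_def accept_down_def atLeast0AtMost)
  have "drift p \<beta> m = poly (A (accept_up p \<beta>) - A (accept_down p \<beta>)
      - [:0, 1:] * (A (accept_up p \<beta>) + A (accept_down p \<beta>))) m" for m
    unfolding drift_def S1 S2 by (simp add: algebra_simps)
  then show ?thesis by blast
qed

lemma drift_lipschitz:
  obtains L where "L > 0"
    "\<And>a b. a \<in> {-1..1} \<Longrightarrow> b \<in> {-1..1} \<Longrightarrow> \<bar>drift p \<beta> a - drift p \<beta> b\<bar> \<le> L * \<bar>a - b\<bar>"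
proof -
  obtain Q where Q: "drift p \<beta> = poly Q" using drift_polynomial by blast
  have "compact (poly (pderiv Q) ` {-1..1})"
    by (intro compact_continuous_image continuous_intros) auto
  then have "bounded (poly (pderiv Q) ` {-1..1})" by (rule compact_imp_bounded)
  then obtain C where "\<forall>y\<in>poly (pderiv Q) ` {-1..1}. norm y \<le> C"
    unfolding bounded_iff by blast
  then have C: "\<bar>poly (pderiv Q) x\<bar> \<le> C" if "x \<in> {-1..1}" for x using that by auto
  show ?thesis
  proof (rule that[of "\<bar>C\<bar> + 1"])
    fix a b :: real assume ab: "a \<in> {-1..1}" "b \<in> {-1..1}"
    have "norm (poly Q a - poly Q b) \<le> (\<bar>C\<bar> + 1) * norm (a - b)"
    proof (rule field_differentiable_bound[of "{-1..1}"])
      show "(poly Q has_field_derivative poly (pderiv Q) z) (at z within {-1..1})" for z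
        by (rule DERIV_subset[OF poly_DERIV]) simp
      show "norm (poly (pderiv Q) z) \<le> \<bar>C\<bar> + 1" if "z \<in> {-1..1}" for z
        using C[OF that] by simp
    qed (use ab in auto)
    then show "\<bar>drift p \<beta> a - drift p \<beta> b\<bar> \<le> (\<bar>C\<bar> + 1) * \<bar>a - b\<bar>" by (simp add: Q)
  qed simp
qed

lemma drift_bounded:
  obtains G where "\<And>a. a \<in> {-1..1} \<Longrightarrow> \<bar>drift p \<beta> a\<bar> \<le> G"
proof -
  obtain Q where Q: "drift p \<beta> = poly Q" using drift_polynomial by blast
  have "bounded (poly Q ` {-1..1})"
    by (intro compact_imp_bounded compact_continuous_image continuous_intros) auto
  then obtain G where "\<forall>y\<in>poly Q ` {-1..1}. norm y \<le> G" unfolding bounded_iff by blast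
  then show ?thesis using that[of G] by (auto simp: Q)
qed

lemma drift_solution_exists:
  assumes "p \<ge> 1" "y \<in> {-1..1}"
  shows "\<exists>x. ode_solution (drift p \<beta>) {-1..1} x \<and> x 0 = y"
proof -
  obtain L where L: "L > 0"
    "\<And>a b. a \<in> {-1..1} \<Longrightarrow> b \<in> {-1..1} \<Longrightarrow> \<bar>drift p \<beta> a - drift p \<beta> b\<bar> \<le> L * \<bar>a - b\<bar>"
    using drift_lipschitz[of p \<beta>] by blast
  from ode_solution_exists[OF L(2,1) drift_inward[OF assms(1)] assms(2)]
  show ?thesis by blast
qed

lemma drift_2: "drift 2 \<beta> m = - 2 * exp (- \<beta>) * m"
proof -
  have s: "{0..2 - 1} = {0, 1 :: nat}" by auto
  have vals: "S1 2 \<beta> m = (1 + m) / 2 + (1 - m) / 2 * exp (- \<beta>)"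
    "S2 2 \<beta> m = (1 + m) / 2 * exp (- \<beta>) + (1 - m) / 2"
    unfolding S1_def S2_def s by simp_all
  show ?thesis unfolding drift_def vals by (simp add: field_simps power2_eq_square)
qed

lemma drift_3:
  "drift 3 \<beta> m = - m * ((1 - m\<^sup>2) / 2 + exp (- 4 * \<beta> / 3) * (3 + m\<^sup>2) / 2)"
proof -
  have s: "{0..3 - 1} = {0, 1, 2 :: nat}" by auto
  have vals: "S1 3 \<beta> m = ((1 + m) / 2)\<^sup>2 + 2 * ((1 - m) / 2) * ((1 + m) / 2)
      + ((1 - m) / 2)\<^sup>2 * exp (- 4 * \<beta> / 3)"
    "S2 3 \<beta> m = ((1 + m) / 2)\<^sup>2 * exp (- 4 * \<beta> / 3) + 2 * ((1 - m) / 2) * ((1 + m) / 2)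
      + ((1 - m) / 2)\<^sup>2"
    unfolding S1_def S2_def s by (simp_all add: numeral_2_eq_2)
  show ?thesis unfolding drift_def vals by (simp add: field_simps power2_eq_square)
qed

section \<open>The slope of the drift at the origin\<close>

text \<open>
  Up to the factor \<open>2 / 2\<^bsup>p-1\<^esup>\<close>, the derivative of the drift at \<open>0\<close>; see \<open>drift_derivative_0\<close>.
\<close>

definition slope :: "nat \<Rightarrow> real \<Rightarrow> real" where
  "slope p \<beta> = (\<Sum>k\<le>p-1. real ((p-1) choose k) * (real (p-1) - 2 * real k - 1) * accept_up p \<beta> k)"

lemma S1_derivative_0:
  "(S1 p \<beta> has_real_derivative
    (\<Sum>k\<le>p-1. real ((p-1) choose k) * (real (p-1) - 2 * real k) * accept_up p \<beta> k) / 2 ^ (p-1)) (at 0)"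
proof -
  define q where "q = p - 1"
  have summand: "((\<lambda>m. real (q choose k) * ((1 - m) / 2) ^ k * ((1 + m) / 2) ^ (q - k) * accept_up p \<beta> k)
      has_real_derivative real (q choose k) * (real q - 2 * real k) * accept_up p \<beta> k / 2 ^ q) (at 0)"
    if "k \<le> q" for k
  proof -
    have pow: "real j * (1 / 2) ^ (j - 1) = real j * 2 / 2 ^ j" for j :: nat
      by (cases j) (auto simp: power_divide field_simps)
    have "((\<lambda>m. real (q choose k) * ((1 - m) / 2) ^ k * ((1 + m) / 2) ^ (q - k) * accept_up p \<beta> k)
      has_real_derivative real (q choose k) * (((1 / 2) ^ k * (real (q - k) * (1 / 2) ^ (q - k - 1) / 2)
        - (real k * (1 / 2) ^ (k - 1) / 2) * (1 / 2) ^ (q - k))) * accept_up p \<beta> k) (at 0)"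
      by (auto intro!: derivative_eq_intros simp: algebra_simps)
    also have "real (q choose k) * (((1 / 2) ^ k * (real (q - k) * (1 / 2) ^ (q - k - 1) / 2)
        - (real k * (1 / 2) ^ (k - 1) / 2) * (1 / 2) ^ (q - k))) * accept_up p \<beta> k
      = real (q choose k) * (real q - 2 * real k) * accept_up p \<beta> k / 2 ^ q"
      unfolding pow using that
      by (simp add: power_divide of_nat_diff field_simps flip: power_add)
    finally show ?thesis .
  qed
  have "((\<lambda>m. \<Sum>k\<le>q. real (q choose k) * ((1 - m) / 2) ^ k * ((1 + m) / 2) ^ (q - k) * accept_up p \<beta> k)
      has_real_derivative (\<Sum>k\<le>q. real (q choose k) * (real q - 2 * real k) * accept_up p \<beta> k / 2 ^ q)) (at 0)"
    by (intro DERIV_sum summand) simp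
  then show ?thesis unfolding S1_eq[abs_def] q_def sum_divide_distrib .
qed

lemma drift_derivative_0:
  assumes "p \<ge> 1"
  shows "(drift p \<beta> has_real_derivative 2 * slope p \<beta> / 2 ^ (p-1)) (at 0)"
proof -
  define q where "q = p - 1"
  define D where "D = (\<Sum>k\<le>q. real (q choose k) * (real q - 2 * real k) * accept_up p \<beta> k) / 2 ^ q"
  have D: "(S1 p \<beta> has_real_derivative D) (at 0)"
    using S1_derivative_0[of p \<beta>] by (simp add: D_def q_def)
  have D': "((\<lambda>m. S1 p \<beta> (- m)) has_real_derivative - D) (at 0)"
    using DERIV_chain2[where f = "S1 p \<beta>" and g = uminus and x = 0 and Da = D and Db = "-1"] D
    by (simp add: DERIV_minus[OF DERIV_ident])
  have S0: "S1 p \<beta> 0 = (\<Sum>k\<le>q. real (q choose k) * accept_up p \<beta> k) / 2 ^ q"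
    unfolding S1_eq q_def[symmetric] sum_divide_distrib
    by (intro sum.cong) (auto simp: power_divide mult_ac simp flip: power_add)
  have "((\<lambda>m. (1 - m) * S1 p \<beta> m - (1 + m) * S1 p \<beta> (- m)) has_real_derivative
      2 * (D - S1 p \<beta> 0)) (at 0)"
    using D D' by (auto intro!: derivative_eq_intros)
  also have "D - S1 p \<beta> 0 = slope p \<beta> / 2 ^ q"
    by (simp add: D_def S0 slope_def q_def algebra_simps sum_subtractf sum.distrib flip: diff_divide_distrib)
  finally show ?thesis
    unfolding drift_eq[OF assms, abs_def] q_def by simp
qed

lemma linearly_stable_drift_iff: "p \<ge> 1 \<Longrightarrow> linearly_stable (drift p \<beta>) 0 \<longleftrightarrow> slope p \<beta> \<le> 0"
  unfolding linearly_stable_iff DERIV_imp_deriv[OF drift_derivative_0]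
  by (simp add: pos_divide_le_eq)

lemma lyapunov_stable_drift:
  assumes "p \<ge> 1" "slope p \<beta> < 0"
  shows "lyapunov_stable (drift p \<beta>) {-1..1} 0"
  by (rule lyapunov_stable_if_deriv_neg[OF drift_derivative_0 drift_zero])
     (use assms in \<open>auto simp: divide_less_0_iff\<close>)

lemma not_lyapunov_stable_drift:
  assumes "p \<ge> 1" "slope p \<beta> > 0"
  shows "\<not> lyapunov_stable (drift p \<beta>) {-1..1} 0"
  by (rule not_lyapunov_stable_if_deriv_pos[OF drift_derivative_0 drift_zero, where \<epsilon> = 1])
     (use assms drift_solution_exists in auto)

subsection \<open>The critical inverse temperature\<close>

lemma accept_up_eq_1: "p \<ge> 1 \<Longrightarrow> 2 * k \<le> p - 1 \<Longrightarrow> accept_up p \<beta> k = 1"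
  by (auto simp: accept_up_def max_def divide_le_0_iff of_nat_diff)

lemma accept_up_eq_exp:
  assumes "p \<ge> 1" "p - 1 < 2 * k"
  shows "accept_up p \<beta> k = exp (- \<beta> * (2 * ((2 * real k + 1 - real p) / real p)))"
    and "(2 * real k + 1 - real p) / real p > 0"
proof -
  show "(2 * real k + 1 - real p) / real p > 0" using assms by (simp add: zero_less_divide_iff)
  then show "accept_up p \<beta> k = exp (- \<beta> * (2 * ((2 * real k + 1 - real p) / real p)))"
    by (simp add: accept_up_def max_def)
qed

text \<open>
  The terms with \<open>2 k \<le> p - 1\<close> do not depend on \<open>\<beta>\<close>. The others have a negative coefficient and a
  decreasing exponential, and \<open>k = p - 1\<close> is always one of them.
\<close>

lemma slope_strict_mono:
  assumes p: "p \<ge> 2"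
  shows "strict_mono (slope p)"
proof (rule strict_monoI)
  fix \<beta>1 \<beta>2 :: real assume b: "\<beta>1 < \<beta>2"
  let ?t = "\<lambda>\<beta> k. real ((p-1) choose k) * (real (p-1) - 2 * real k - 1) * accept_up p \<beta> k"
  have less: "?t \<beta>1 k < ?t \<beta>2 k" if k: "p - 1 < 2 * k" "k \<le> p - 1" for k
  proof -
    have "accept_up p \<beta>2 k < accept_up p \<beta>1 k"
    proof -
      define c where "c = 2 * ((2 * real k + 1 - real p) / real p)"
      have "c > 0" "\<And>\<beta>. accept_up p \<beta> k = exp (- \<beta> * c)"
        using accept_up_eq_exp[of p k] k p by (auto simp: c_def)
      then show ?thesis using b by simp
    qed
    moreover have "real ((p-1) choose k) * (real (p-1) - 2 * real k - 1) < 0"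
      using k by (intro mult_pos_neg) auto
    ultimately show ?thesis by (rule mult_strict_left_mono_neg)
  qed
  show "slope p \<beta>1 < slope p \<beta>2"
    unfolding slope_def
  proof (rule sum_strict_mono_ex1)
    show "\<forall>k\<in>{..p-1}. ?t \<beta>1 k \<le> ?t \<beta>2 k"
    proof
      fix k assume "k \<in> {..p-1}"
      then show "?t \<beta>1 k \<le> ?t \<beta>2 k"
        using less[of k] accept_up_eq_1[of p k] p by (cases "2 * k \<le> p - 1") auto
    qed
    show "\<exists>k\<in>{..p-1}. ?t \<beta>1 k < ?t \<beta>2 k"
      using less[of "p-1"] p by (intro bexI[of _ "p-1"]) auto
  qed simp
qed

lemma slope_continuous: "continuous_on A (slope p)"
  unfolding slope_def accept_up_def by (intro continuous_intros)

lemma choose_succ: "real (n choose Suc k) * (real k + 1) = real (n choose k) * (real n - real k)"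
proof (cases "k \<le> n")
  case True
  have "Suc k * (n choose Suc k) = (n choose k) * (n - k)"
    by (metis binomial_absorb_comp binomial_absorption mult.commute)
  then have "real (Suc k * (n choose Suc k)) = real ((n choose k) * (n - k))" by simp
  then show ?thesis using True by (simp add: of_nat_diff algebra_simps)
qed (simp add: binomial_eq_0)

text \<open>
  For odd \<open>q\<close> no term is negative. For \<open>q = 2 r\<close> the middle term \<open>- (2 r choose r)\<close> is the only negative
  one, and it is already outweighed by its two predecessors \<open>(2 r choose (r - 1))\<close> and
  \<open>3 (2 r choose (r - 2))\<close>. For \<open>q = 1\<close> and \<open>q = 2\<close> the sum is not positive, which is why there is no
  transition for batches of two or three spins.
\<close>

lemma lower_half_sum_pos:
  assumes "q \<ge> 3"
  shows "(\<Sum>k | k \<le> q \<and> 2 * k \<le> q. real (q choose k) * (real q - 2 * real k - 1)) > 0"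
proof (cases "even q")
  case False
  then obtain r where r: "q = 2 * r + 1" by (auto elim: oddE)
  show ?thesis
  proof (rule sum_pos2[of _ 0])
    fix k assume "k \<in> {k. k \<le> q \<and> 2 * k \<le> q}"
    then have "k \<le> r" using r by auto
    then show "0 \<le> real (q choose k) * (real q - 2 * real k - 1)"
      by (intro mult_nonneg_nonneg) (auto simp: r)
  qed (use assms in auto)
next
  case True
  then obtain r where r: "q = 2 * r" by auto
  have r2: "r \<ge> 2" using assms r by simp
  obtain s where s: "r = s + 2" using r2 by (metis add.commute le_iff_add)
  let ?t = "\<lambda>k. real (q choose k) * (real q - 2 * real k - 1)"
  \<comment> \<open>all three binomial coefficients are expressed through the smallest one\<close>
  define a where "a = real (q choose s)"
  have a: "a > 0" using r s by (simp add: a_def)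
  have c1: "real (q choose (s + 1)) * (real s + 1) = a * (real s + 4)"
    using choose_succ[of q s] by (simp add: a_def r s)
  have c2: "real (q choose (s + 2)) * (real s + 2) = real (q choose (s + 1)) * (real s + 3)"
    using choose_succ[of q "s + 1"] by (simp add: r s algebra_simps)
  have "real (q choose (s + 2)) < real (q choose (s + 1)) + 3 * a"
  proof -
    have "(real (q choose (s + 2)) - real (q choose (s + 1))) * (real s + 2) * (real s + 1)
        = real (q choose (s + 1)) * (real s + 1)"
      using c2 by (simp add: algebra_simps)
    also have "\<dots> = a * (real s + 4)" by (rule c1)
    also have "\<dots> < a * (3 * (real s + 2) * (real s + 1))"
      using a by (intro mult_strict_left_mono) (auto simp: algebra_simps add_pos_nonneg)
    finally have "(real (q choose (s + 2)) - real (q choose (s + 1))) * ((real s + 2) * (real s + 1))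
        < (3 * a) * ((real s + 2) * (real s + 1))" by (simp add: mult_ac)
    then have "real (q choose (s + 2)) - real (q choose (s + 1)) < 3 * a"
      by (rule mult_right_less_imp_less) auto
    then show ?thesis by simp
  qed
  then have "0 < ?t s + ?t (s + 1) + ?t (s + 2)"
    by (simp add: r s a_def algebra_simps)
  also have "\<dots> = (\<Sum>k\<in>{s, s + 1, s + 2}. ?t k)" by simp
  also have "\<dots> \<le> (\<Sum>k | k \<le> q \<and> 2 * k \<le> q. ?t k)"
  proof (rule sum_mono2)
    fix k assume "k \<in> {k. k \<le> q \<and> 2 * k \<le> q} - {s, s + 1, s + 2}"
    then have "k < s" using r s by auto
    then show "0 \<le> ?t k" by (intro mult_nonneg_nonneg) (auto simp: r s)
  qed (auto simp: r s)
  finally show ?thesis .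
qed

lemma slope_eventually_pos:
  assumes p: "p \<ge> 4"
  shows "\<exists>\<beta>>0. slope p \<beta> > 0"
proof -
  let ?c = "\<lambda>k. real ((p-1) choose k) * (real (p-1) - 2 * real k - 1)"
  have "((\<lambda>\<beta>. slope p \<beta>) \<longlongrightarrow> (\<Sum>k\<le>p-1. ?c k * (if 2 * k \<le> p - 1 then 1 else 0))) at_top"
    unfolding slope_def
  proof (intro tendsto_sum tendsto_mult tendsto_const)
    fix k
    show "((\<lambda>\<beta>. accept_up p \<beta> k) \<longlongrightarrow> (if 2 * k \<le> p - 1 then 1 else 0)) at_top"
    proof (cases "2 * k \<le> p - 1")
      case True
      then show ?thesis using accept_up_eq_1[of p k] p by simp
    next
      case False
      define c where "c = 2 * ((2 * real k + 1 - real p) / real p)"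
      have c: "c > 0" "accept_up p \<beta> k = exp (- \<beta> * c)" for \<beta>
        using accept_up_eq_exp[of p k] False p by (auto simp: c_def)
      have "((\<lambda>\<beta>. exp (- \<beta> * c)) \<longlongrightarrow> 0) at_top" using c(1) by real_asymp
      then show ?thesis using False by (simp add: c(2))
    qed
  qed
  also have "(\<Sum>k\<le>p-1. ?c k * (if 2 * k \<le> p - 1 then 1 else 0)) = (\<Sum>k | k \<le> p - 1 \<and> 2 * k \<le> p - 1. ?c k)"
    by (simp add: if_distrib sum.If_cases Int_def cong: if_cong)
  finally have "\<forall>\<^sub>F \<beta> in at_top. slope p \<beta> > 0"
    using lower_half_sum_pos[of "p - 1"] p by (intro order_tendstoD(1)) auto
  then have "\<forall>\<^sub>F \<beta> in at_top. slope p \<beta> > 0 \<and> \<beta> > 0"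
    using eventually_gt_at_top[of 0] by eventually_elim auto
  then show ?thesis using eventually_happens'[OF trivial_limit_at_top_linorder] by blast
qed

lemma binomial_sum_moment_1: "(\<Sum>k\<le>q. real (q choose k) * (real q - 2 * real k)) = 0"
proof -
  have "(\<Sum>k\<le>q. real (q choose k) * (real q - 2 * real k)) = (\<Sum>k\<le>q. real (q choose k) * (2 * real k - real q))"
    by (rule sum.reindex_bij_witness[of _ "\<lambda>k. q - k" "\<lambda>k. q - k"])
       (auto simp: binomial_symmetric[symmetric] of_nat_diff algebra_simps)
  also have "\<dots> = - (\<Sum>k\<le>q. real (q choose k) * (real q - 2 * real k))"
    by (simp add: algebra_simps flip: sum_negf)
  finally show ?thesis by simp
qed

lemma slope_at_0: "slope p 0 < 0"
proof -
  have "slope p 0 = (\<Sum>k\<le>p-1. real ((p-1) choose k) * (real (p-1) - 2 * real k)) - (\<Sum>k\<le>p-1. real ((p-1) choose k))"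
    by (simp add: slope_def accept_up_def algebra_simps sum_subtractf sum.distrib)
  also have "(\<Sum>k\<le>p-1. real ((p-1) choose k)) = 2 ^ (p-1)"
    by (simp add: choose_row_sum flip: of_nat_sum)
  finally show ?thesis by (simp add: binomial_sum_moment_1)
qed

text \<open>
  For \<open>p \<ge> 4\<close> the zero exists and is unique.
\<close>

definition critical_beta :: "nat \<Rightarrow> real" where
  "critical_beta p = (SOME \<beta>. slope p \<beta> = 0)"

lemma slope_critical_beta:
  assumes "p \<ge> 4"
  shows "slope p (critical_beta p) = 0"
proof -
  obtain b where b: "b > 0" "slope p b > 0" using slope_eventually_pos[OF assms] by blast
  have "\<exists>x. 0 \<le> x \<and> x \<le> b \<and> slope p x = 0"
    using b slope_at_0[of p] by (intro IVT' slope_continuous) auto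
  then show ?thesis unfolding critical_beta_def by (metis (mono_tags) someI)
qed

lemma slope_sign:
  assumes "p \<ge> 4"
  shows "slope p \<beta> > 0 \<longleftrightarrow> \<beta> > critical_beta p" "slope p \<beta> < 0 \<longleftrightarrow> \<beta> < critical_beta p"
proof -
  have mono: "strict_mono (slope p)" using assms by (intro slope_strict_mono) simp
  show "slope p \<beta> > 0 \<longleftrightarrow> \<beta> > critical_beta p"
    using strict_mono_less[OF mono, of "critical_beta p" \<beta>] slope_critical_beta[OF assms] by simp
  show "slope p \<beta> < 0 \<longleftrightarrow> \<beta> < critical_beta p"
    using strict_mono_less[OF mono, of \<beta> "critical_beta p"] slope_critical_beta[OF assms] by simp
qed

section \<open>Asymptotics of the critical inverse temperature\<close>

subsection \<open>Moments of a sum of independent signs\<close>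

text \<open>
  The expectation of \<open>\<phi> s\<close> for \<open>s\<close> the sum of \<open>q\<close> independent uniform signs, \<open>k\<close> of which are negative.
\<close>

definition sign_mean :: "nat \<Rightarrow> (real \<Rightarrow> real) \<Rightarrow> real" where
  "sign_mean q \<phi> = (\<Sum>k\<le>q. real (q choose k) * \<phi> (real q - 2 * real k)) / 2 ^ q"

lemma sign_mean_reflect: "sign_mean q (\<lambda>s. \<phi> (- s)) = sign_mean q \<phi>"
proof -
  have "(\<Sum>k\<le>q. real (q choose k) * \<phi> (- (real q - 2 * real k)))
      = (\<Sum>k\<le>q. real (q choose k) * \<phi> (real q - 2 * real k))"
    by (rule sum.reindex_bij_witness[of _ "\<lambda>k. q - k" "\<lambda>k. q - k"])
       (auto simp: binomial_symmetric[symmetric] of_nat_diff algebra_simps)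
  then show ?thesis by (simp add: sign_mean_def)
qed

lemma sign_mean_add: "sign_mean q (\<lambda>s. \<phi> s + \<psi> s) = sign_mean q \<phi> + sign_mean q \<psi>"
  by (simp add: sign_mean_def ring_distribs sum.distrib add_divide_distrib)

lemma sign_mean_cmult: "sign_mean q (\<lambda>s. c * \<phi> s) = c * sign_mean q \<phi>"
  by (simp add: sign_mean_def sum_distrib_left mult_ac)

lemma sign_mean_const: "sign_mean q (\<lambda>_. c) = c"
  by (simp add: sign_mean_def choose_row_sum flip: sum_distrib_right of_nat_sum)

lemma sign_mean_mono: "(\<And>s. \<phi> s \<le> \<psi> s) \<Longrightarrow> sign_mean q \<phi> \<le> sign_mean q \<psi>"
  unfolding sign_mean_def by (intro divide_right_mono sum_mono mult_left_mono) auto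

text \<open>
  Conditioning on the last sign.
\<close>

lemma sign_mean_Suc:
  "sign_mean (Suc q) \<phi> = sign_mean q (\<lambda>s. (\<phi> (s + 1) + \<phi> (s - 1)) / 2)"
proof -
  let ?a = "\<lambda>k. \<phi> (real (Suc q) - 2 * real k)"
  have "(\<Sum>k\<le>Suc q. real (Suc q choose k) * ?a k)
      = ?a 0 + (\<Sum>k\<le>q. (real (q choose k) + real (q choose Suc k)) * ?a (Suc k))"
    by (subst sum.atMost_Suc_shift) simp
  also have "\<dots> = (\<Sum>k\<le>q. real (q choose k) * ?a (Suc k)) + (?a 0 + (\<Sum>k\<le>q. real (q choose Suc k) * ?a (Suc k)))"
    by (simp add: ring_distribs sum.distrib)
  also have "?a 0 + (\<Sum>k\<le>q. real (q choose Suc k) * ?a (Suc k)) = (\<Sum>k\<le>Suc q. real (q choose k) * ?a k)"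
    by (subst sum.atMost_Suc_shift) simp
  also have "\<dots> = (\<Sum>k\<le>q. real (q choose k) * ?a k)" by (simp add: binomial_eq_0)
  also have "(\<Sum>k\<le>q. real (q choose k) * ?a (Suc k)) + (\<Sum>k\<le>q. real (q choose k) * ?a k)
      = (\<Sum>k\<le>q. real (q choose k) * (\<phi> (real q - 2 * real k + 1) + \<phi> (real q - 2 * real k - 1)))"
    unfolding sum.distrib[symmetric]
    by (intro sum.cong refl) (simp add: algebra_simps)
  finally show ?thesis unfolding sign_mean_def
    by (simp add: sum_divide_distrib)
qed

lemma sign_mean_square: "sign_mean q (\<lambda>s. s\<^sup>2) = q"
proof (induction q)
  case (Suc q)
  have "((s + 1)\<^sup>2 + (s - 1)\<^sup>2) / 2 = s\<^sup>2 + 1" for s :: real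
    by (simp add: power2_eq_square algebra_simps)
  then have "sign_mean (Suc q) (\<lambda>s. s\<^sup>2) = sign_mean q (\<lambda>s. s\<^sup>2 + 1)"
    by (simp only: sign_mean_Suc)
  then show ?case using Suc by (simp add: sign_mean_add sign_mean_const)
qed (simp add: sign_mean_def)

lemma sign_mean_fourth: "sign_mean q (\<lambda>s. s ^ 4) = 3 * (real q)\<^sup>2 - 2 * real q"
proof (induction q)
  case (Suc q)
  have "((s + 1) ^ 4 + (s - 1) ^ 4) / 2 = s ^ 4 + (6 * s\<^sup>2 + 1)" for s :: real
    by (simp add: power4_eq_xxxx power2_eq_square algebra_simps)
  then have "sign_mean (Suc q) (\<lambda>s. s ^ 4) = sign_mean q (\<lambda>s. s ^ 4 + (6 * s\<^sup>2 + 1))"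
    by (simp only: sign_mean_Suc)
  then show ?case using Suc
    by (simp add: sign_mean_add sign_mean_const sign_mean_cmult sign_mean_square)
       (simp add: power2_eq_square algebra_simps)
qed (simp add: sign_mean_def)

text \<open>
  By symmetry both signs of \<open>s\<close> contribute equally, and the positive one corresponds to \<open>2 k < q\<close>.
\<close>

lemma sign_mean_even:
  assumes "F 0 = 0"
  shows "sign_mean q (\<lambda>s. F \<bar>s\<bar>)
    = 2 * (\<Sum>k\<le>q div 2. real (q choose k) * F (real q - 2 * real k)) / 2 ^ q"
proof -
  define \<phi> where "\<phi> s = (if s > 0 then F s else 0)" for s :: real
  have "(\<lambda>s. F \<bar>s\<bar>) = (\<lambda>s. \<phi> s + \<phi> (- s))"
    using assms by (auto simp: \<phi>_def fun_eq_iff abs_if)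
  then have "sign_mean q (\<lambda>s. F \<bar>s\<bar>) = 2 * sign_mean q \<phi>"
    using sign_mean_reflect[of q \<phi>] by (simp add: sign_mean_add)
  also have "(\<Sum>k\<le>q. real (q choose k) * \<phi> (real q - 2 * real k))
      = (\<Sum>k\<le>q div 2. real (q choose k) * \<phi> (real q - 2 * real k))"
    by (rule sum.mono_neutral_right) (auto simp: \<phi>_def)
  then have "2 * sign_mean q \<phi>
      = 2 * (\<Sum>k\<le>q div 2. real (q choose k) * \<phi> (real q - 2 * real k)) / 2 ^ q"
    by (simp add: sign_mean_def)
  also have "(\<Sum>k\<le>q div 2. real (q choose k) * \<phi> (real q - 2 * real k))
      = (\<Sum>k\<le>q div 2. real (q choose k) * F (real q - 2 * real k))"
  proof (rule sum.cong[OF refl])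
    fix k assume "k \<in> {..q div 2}"
    then have "0 \<le> real q - 2 * real k" by auto
    then show "real (q choose k) * \<phi> (real q - 2 * real k) = real (q choose k) * F (real q - 2 * real k)"
      using assms by (auto simp: \<phi>_def)
  qed
  finally show ?thesis .
qed

text \<open>
  The sum telescopes, as \<open>k (q choose k) = (q - k + 1) (q choose (k - 1))\<close>.
\<close>

lemma lower_sum_1:
  "(\<Sum>k\<le>n. real (q choose k) * (real q - 2 * real k)) = (real q - real n) * real (q choose n)"
proof (induction n)
  case (Suc n)
  show ?case using Suc choose_succ[of q n] by (simp add: algebra_simps)
qed simp

text \<open>
  Telescopes like \<open>lower_sum_1\<close>: the factor \<open>s\<^sup>2 - 2 s + 2 q\<close> with \<open>s = q - 2 n\<close> is the quadratic
  polynomial for which the successive differences of the right-hand side are the terms with cubes.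
\<close>

lemma lower_sum_3:
  "(\<Sum>k\<le>n. real (q choose k) * (real q - 2 * real k) ^ 3)
    = ((real q - 2 * real n)\<^sup>2 - 2 * (real q - 2 * real n) + 2 * real q) * ((real q - real n) * real (q choose n))"
proof (induction n)
  case (Suc n)
  define X where "X = real (q choose Suc n)"
  define s where "s = real q - 2 * real n"
  have X: "(real q - real n) * real (q choose n) = (real n + 1) * X"
    using choose_succ[of q n] by (simp add: X_def mult.commute)
  have last: "real q - 2 * real (Suc n) = s - 2" by (simp add: s_def)
  have "(\<Sum>k\<le>Suc n. real (q choose k) * (real q - 2 * real k) ^ 3)
      = (s\<^sup>2 - 2 * s + 2 * real q) * ((real n + 1) * X) + X * (s - 2) ^ 3"
    unfolding sum.atMost_Suc last Suc X s_def[symmetric] X_def[symmetric] ..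
  also have "\<dots> = ((s - 2)\<^sup>2 - 2 * (s - 2) + 2 * real q) * ((real q - real n - 1) * X)"
    by (simp add: s_def power2_eq_square power3_eq_cube algebra_simps)
  finally show ?case by (simp add: X_def s_def algebra_simps)
qed (simp add: power2_eq_square power3_eq_cube algebra_simps)

text \<open>
  The probability that \<open>2 r\<close> independent uniform signs sum to \<open>0\<close>.
\<close>

definition central :: "nat \<Rightarrow> real" where
  "central r = real ((2 * r) choose r) / 4 ^ r"

lemma sign_mean_abs: "sign_mean q (\<lambda>s. \<bar>s\<bar>) = real q * central (q div 2)"
proof -
  have eq: "sign_mean q (\<lambda>s. \<bar>s\<bar>) = 2 * ((real q - real (q div 2)) * real (q choose (q div 2))) / 2 ^ q"
    using sign_mean_even[of "\<lambda>s. s" q] by (simp add: lower_sum_1)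
  show ?thesis
  proof (cases "even q")
    case True
    then obtain r where "q = 2 * r" by auto
    then show ?thesis unfolding eq by (simp add: central_def power_mult)
  next
    case False
    then obtain r where q: "q = 2 * r + 1" by (auto elim: oddE)
    have "Suc (2 * r) * ((2 * r) choose r) = (Suc (2 * r) choose Suc r) * Suc r"
      by (rule Suc_times_binomial_eq)
    moreover have "(Suc (2 * r) choose Suc r) = (Suc (2 * r) choose r)"
      using binomial_symmetric[of "Suc r" "Suc (2 * r)"] by simp
    ultimately have "real (Suc (2 * r) * ((2 * r) choose r)) = real ((Suc (2 * r) choose r) * Suc r)" by simp
    then have "(real r + 1) * real (Suc (2 * r) choose r) = (2 * real r + 1) * real ((2 * r) choose r)"
      by (simp add: algebra_simps)
    then show ?thesis unfolding eq by (simp add: q central_def power_mult del: binomial_Suc_Suc)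
  qed
qed

text \<open>
  At \<open>n = q div 2\<close> the number \<open>s = q - 2 n\<close> is the parity of \<open>q\<close>, and \<open>s\<^sup>2 - 2 s + 2 q = 2 q - s\<close>.
\<close>

lemma sign_mean_cube:
  "sign_mean q (\<lambda>s. \<bar>s\<bar> ^ 3) = (2 * real q - real (q mod 2)) * sign_mean q (\<lambda>s. \<bar>s\<bar>)"
proof -
  define s where "s = real q - 2 * real (q div 2)"
  have "q = 2 * (q div 2) + q mod 2" by simp
  then have "real q = 2 * real (q div 2) + real (q mod 2)" by (metis of_nat_add of_nat_mult of_nat_numeral)
  then have s: "s = real (q mod 2)" by (simp add: s_def)
  have s2: "s\<^sup>2 - 2 * s = - s"
    unfolding s by (cases "even q") (auto simp: odd_iff_mod_2_eq_one)
  have "sign_mean q (\<lambda>s. \<bar>s\<bar> ^ 3) = (s\<^sup>2 - 2 * s + 2 * real q)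
      * (2 * ((real q - real (q div 2)) * real (q choose (q div 2))) / 2 ^ q)"
    using sign_mean_even[of "\<lambda>s. s ^ 3" q] by (simp add: lower_sum_3 s_def)
  also have "2 * ((real q - real (q div 2)) * real (q choose (q div 2))) / 2 ^ q = sign_mean q (\<lambda>s. \<bar>s\<bar>)"
    using sign_mean_even[of "\<lambda>s. s" q] by (simp add: lower_sum_1)
  finally show ?thesis unfolding s2 by (simp add: s)
qed

text \<open>
  The partial products of Wallis' formula are the reciprocals of \<open>(central n)\<^sup>2 (2 n + 1)\<close>.
\<close>

lemma wallis_central:
  "(\<Prod>k=1..n. (4 * real k^2) / (4 * real k^2 - 1)) * ((central n)\<^sup>2 * (2 * real n + 1)) = 1"
proof (induction n)
  case (Suc n)
  have c: "central (Suc n) = central n * ((2 * real n + 1) / (2 * real n + 2))"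
  proof -
    have B: "real ((2 * n) choose n) = fact (2 * n) / (fact n * fact n)" for n
      using binomial_fact[of n "2 * n", where 'a = real] by simp
    have F: "fact (2 * Suc n) = (2 * real n + 2) * ((2 * real n + 1) * fact (2 * n))"
      by (simp add: algebra_simps)
    have "fact (Suc n) = (real n + 1) * fact n" by (simp add: algebra_simps)
    note F = F this
    show ?thesis unfolding central_def B F by (simp add: divide_simps) (simp add: algebra_simps)
  qed
  have f: "4 * (real (Suc n))\<^sup>2 - 1 = (2 * real n + 1) * (2 * real n + 3)"
    by (simp add: power2_eq_square algebra_simps)
  define W where "W = (\<Prod>k=1..n. (4 * real k^2) / (4 * real k^2 - 1))"
  have "W * ((4 * (real (Suc n))\<^sup>2) / ((2 * real n + 1) * (2 * real n + 3)))
      * ((central n * ((2 * real n + 1) / (2 * real n + 2)))\<^sup>2 * (2 * real n + 3))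
    = W * ((central n)\<^sup>2 * (2 * real n + 1))"
  proof -
    have "2 * real n + 1 \<noteq> 0" "2 * real n + 3 \<noteq> 0" "2 * real n + 2 \<noteq> 0" by linarith+
    moreover have "4 * (real (Suc n))\<^sup>2 = (2 * real n + 2)\<^sup>2"
      by (simp add: power2_eq_square algebra_simps)
    ultimately show ?thesis by (simp add: power_divide power_mult_distrib power2_eq_square)
  qed
  then show ?case using Suc unfolding c
    by (simp add: f[unfolded of_nat_Suc] W_def mult.commute add.commute)
qed (simp add: central_def)

lemma central_asymptotics: "(\<lambda>n. (central n)\<^sup>2 * (2 * real n + 1)) \<longlonglongrightarrow> 2 / pi"
proof -
  have "(\<lambda>n. inverse (\<Prod>k=1..n. (4 * real k^2) / (4 * real k^2 - 1))) \<longlonglongrightarrow> inverse (pi / 2)"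
    by (intro tendsto_inverse wallis) simp
  moreover have "inverse (\<Prod>k=1..n. (4 * real k^2) / (4 * real k^2 - 1)) = (central n)\<^sup>2 * (2 * real n + 1)" for n
    using wallis_central[of n] by (rule inverse_unique)
  ultimately show ?thesis by simp
qed

lemma sign_mean_abs_asymptotics:
  "(\<lambda>q. sign_mean q (\<lambda>s. \<bar>s\<bar>) / sqrt (real (Suc q))) \<longlonglongrightarrow> sqrt (2 / pi)"
proof -
  define o2 where "o2 q = real (q mod 2)" for q :: nat
  have o2: "0 \<le> o2 q" "o2 q \<le> 1" for q by (auto simp: o2_def)
  have "filterlim (\<lambda>q::nat. q div 2) at_top at_top"
    unfolding filterlim_at_top
  proof
    fix Z :: nat
    show "\<forall>\<^sub>F q in at_top. Z \<le> q div 2"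
      using eventually_ge_at_top[of "2 * Z"] by eventually_elim auto
  qed
  then have c: "(\<lambda>q. (central (q div 2))\<^sup>2 * (2 * real (q div 2) + 1)) \<longlonglongrightarrow> 2 / pi"
    by (rule filterlim_compose[OF central_asymptotics])
  have r: "2 * real (q div 2) + 1 = real q + 1 - o2 q" for q
  proof -
    have "q = 2 * (q div 2) + q mod 2" by simp
    then have "real q = 2 * real (q div 2) + real (q mod 2)" by (metis of_nat_add of_nat_mult of_nat_numeral)
    then show ?thesis by (simp add: o2_def)
  qed
  define ratio where "ratio q = (real q)\<^sup>2 / ((real q + 1) * (real q + 1 - o2 q))" for q :: nat
  have ratio: "ratio \<longlonglongrightarrow> 1"
  unfolding ratio_def
  proof (rule real_tendsto_sandwich)
    show "\<forall>\<^sub>F q in sequentially. (real q)\<^sup>2 / ((real q + 1) * (real q + 1))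
        \<le> (real q)\<^sup>2 / ((real q + 1) * (real q + 1 - o2 q))"
      using eventually_gt_at_top[of 0]
    proof eventually_elim
      case (elim q)
      then show ?case using o2[of q]
        by (intro divide_left_mono mult_left_mono mult_pos_pos) auto
    qed
    show "\<forall>\<^sub>F q in sequentially. (real q)\<^sup>2 / ((real q + 1) * (real q + 1 - o2 q))
        \<le> (real q)\<^sup>2 / ((real q + 1) * real q)"
      using eventually_gt_at_top[of 0]
    proof eventually_elim
      case (elim q)
      then show ?case using o2[of q]
        by (intro divide_left_mono mult_left_mono mult_pos_pos) auto
    qed
    show "(\<lambda>q. (real q)\<^sup>2 / ((real q + 1) * (real q + 1))) \<longlonglongrightarrow> 1" by real_asymp
    show "(\<lambda>q. (real q)\<^sup>2 / ((real q + 1) * real q)) \<longlonglongrightarrow> 1" by real_asymp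
  qed
  have lim: "(\<lambda>q. sqrt ((central (q div 2))\<^sup>2 * (2 * real (q div 2) + 1)
      * (ratio q))) \<longlonglongrightarrow> sqrt (2 / pi * 1)"
    by (intro tendsto_real_sqrt tendsto_mult c ratio)
  have "sqrt ((central (q div 2))\<^sup>2 * (2 * real (q div 2) + 1)
      * (ratio q)) = sign_mean q (\<lambda>s. \<bar>s\<bar>) / sqrt (real (Suc q))"
    if "q > 0" for q
  proof -
    have pos: "real q + 1 - o2 q > 0" using o2[of q] that by auto
    have "(central (q div 2))\<^sup>2 * (2 * real (q div 2) + 1)
      * (ratio q) = (real q * central (q div 2))\<^sup>2 / (real q + 1)"
      using pos unfolding r ratio_def by (simp add: power_mult_distrib)
    moreover have "real q * central (q div 2) \<ge> 0" by (simp add: central_def)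
    ultimately show ?thesis by (simp add: real_sqrt_divide sign_mean_abs add.commute)
  qed
  then have "\<forall>\<^sub>F q in sequentially. sqrt ((central (q div 2))\<^sup>2 * (2 * real (q div 2) + 1)
      * (ratio q)) = sign_mean q (\<lambda>s. \<bar>s\<bar>) / sqrt (real (Suc q))"
    by (rule eventually_mono[OF eventually_gt_at_top[of 0]])
  with lim show ?thesis by (simp add: Lim_transform_eventually)
qed

subsection \<open>Expansion of the slope\<close>

lemma exp_minus_bounds:
  fixes u :: real
  assumes "u \<ge> 0"
  shows "1 - u \<le> exp (- u)" "exp (- u) \<le> 1 - u + u\<^sup>2 / 2" "1 - u + u\<^sup>2 / 2 - u ^ 3 / 6 \<le> exp (- u)"
proof -
  have 1: "1 - v \<le> exp (- v)" for v :: real using exp_ge_add_one_self[of "- v"] by simp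
  show "1 - u \<le> exp (- u)" by (rule 1)
  have 2: "exp (- v) \<le> 1 - v + v\<^sup>2 / 2" if "v \<ge> 0" for v :: real
  proof -
    have "(\<lambda>v. 1 - v + v\<^sup>2 / 2 - exp (- v)) 0 \<le> (\<lambda>v. 1 - v + v\<^sup>2 / 2 - exp (- v)) v"
      using that
    proof (rule DERIV_nonneg_imp_nondecreasing)
      fix w :: real
      have "((\<lambda>v. 1 - v + v\<^sup>2 / 2 - exp (- v)) has_real_derivative exp (- w) - (1 - w)) (at w)"
        by (auto intro!: derivative_eq_intros)
      then show "\<exists>y. ((\<lambda>v. 1 - v + v\<^sup>2 / 2 - exp (- v)) has_real_derivative y) (at w) \<and> 0 \<le> y"
        using 1[of w] by (intro exI[of _ "exp (- w) - (1 - w)"]) auto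
    qed
    then show ?thesis by simp
  qed
  then show "exp (- u) \<le> 1 - u + u\<^sup>2 / 2" using assms by simp
  have "(\<lambda>v. exp (- v) - (1 - v + v\<^sup>2 / 2 - v ^ 3 / 6)) 0 \<le> (\<lambda>v. exp (- v) - (1 - v + v\<^sup>2 / 2 - v ^ 3 / 6)) u"
    using assms
  proof (rule DERIV_nonneg_imp_nondecreasing)
    fix w :: real assume w: "0 \<le> w"
    have "((\<lambda>v. exp (- v) - (1 - v + v\<^sup>2 / 2 - v ^ 3 / 6)) has_real_derivative
        (1 - w + w\<^sup>2 / 2) - exp (- w)) (at w)"
      by (auto intro!: derivative_eq_intros simp: power2_eq_square)
    then show "\<exists>y. ((\<lambda>v. exp (- v) - (1 - v + v\<^sup>2 / 2 - v ^ 3 / 6)) has_real_derivative y) (at w) \<and> 0 \<le> y"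
      using 2[OF w] by (intro exI[of _ "(1 - w + w\<^sup>2 / 2) - exp (- w)"]) auto
  qed
  then show "1 - u + u\<^sup>2 / 2 - u ^ 3 / 6 \<le> exp (- u)" by simp
qed

definition slope_integrand :: "real \<Rightarrow> real \<Rightarrow> real" where
  "slope_integrand b z = z * (1 - exp (- b * z)) - (1 + exp (- b * z))"

text \<open>
  With \<open>s = q - 2 k\<close>, \<open>slope (Suc q) \<beta> / 2\<^sup>q\<close> is the mean of \<open>(s - 1) w s\<close>, where \<open>w s = 1\<close> for \<open>s \<ge> 0\<close> and
  \<open>w s = exp (2 \<beta> s / (q + 1))\<close> for \<open>s \<le> 0\<close>. Adding the reflected function gives the
  integrand, which depends only on \<open>\<bar>s\<bar>\<close>.
\<close>

lemma slope_as_sign_mean: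
  "2 * slope (Suc q) \<beta> / 2 ^ q = sign_mean q (\<lambda>s. slope_integrand (2 * \<beta> / Suc q) \<bar>s\<bar>)"
proof -
  define w where "w s = exp (- 2 * \<beta> * max (- s / Suc q) 0)" for s :: real
  define \<phi> where "\<phi> s = (s - 1) * w s" for s
  have acc: "accept_up (Suc q) \<beta> k = w (real q - 2 * real k)" for k
    by (simp add: accept_up_def w_def)
  have "slope (Suc q) \<beta> / 2 ^ q = sign_mean q \<phi>"
    unfolding sign_mean_def slope_def \<phi>_def acc by (simp add: mult.assoc)
  then have "2 * slope (Suc q) \<beta> / 2 ^ q = sign_mean q \<phi> + sign_mean q (\<lambda>s. \<phi> (- s))"
    using sign_mean_reflect[of q \<phi>] by simp
  also have "\<dots> = sign_mean q (\<lambda>s. \<phi> s + \<phi> (- s))" by (rule sign_mean_add[symmetric])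
  also have "(\<lambda>s. \<phi> s + \<phi> (- s)) = (\<lambda>s. slope_integrand (2 * \<beta> / Suc q) \<bar>s\<bar>)"
  proof
    fix s :: real
    have pos: "w s = 1" "w (- s) = exp (- (2 * \<beta> / Suc q) * s)" if "s \<ge> 0" for s
      using that by (auto simp: w_def max_def divide_le_0_iff)
    show "\<phi> s + \<phi> (- s) = slope_integrand (2 * \<beta> / Suc q) \<bar>s\<bar>"
    proof (cases "s \<ge> 0")
      case True
      then show ?thesis unfolding \<phi>_def pos[OF True] slope_integrand_def by (simp add: algebra_simps)
    next
      case False
      then have "- s \<ge> 0" by simp
      from pos[OF this] False show ?thesis
        unfolding \<phi>_def slope_integrand_def by (simp add: algebra_simps)
    qed
  qed
  finally show ?thesis .
qed

text \<open>
  The exponential is expanded to second order where it has the factor \<open>z\<close> and to first order where it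
  has not, as \<open>z\<close> is of order \<open>1 / \<surd>b\<close>; both errors are then of order \<open>b\<close>.
\<close>

lemma slope_integrand_bounds:
  assumes "b \<ge> 0" "z \<ge> 0"
  defines "\<Phi> \<equiv> b * z\<^sup>2 - b\<^sup>2 * z ^ 3 / 2 - 2 + b * z"
  shows "\<Phi> - b\<^sup>2 * z\<^sup>2 / 2 \<le> slope_integrand b z" "slope_integrand b z \<le> \<Phi> + b ^ 3 * z ^ 4 / 6"
proof -
  define u where "u = b * z"
  have u: "u \<ge> 0" using assms by (simp add: u_def)
  define e where "e = exp (- u)"
  have e: "1 - u \<le> e" "e \<le> 1 - u + u\<^sup>2 / 2" "1 - u + u\<^sup>2 / 2 - u ^ 3 / 6 \<le> e"
    using exp_minus_bounds[OF u] by (simp_all add: e_def)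
  have I: "slope_integrand b z = z * (1 - e) - (1 + e)" by (simp add: slope_integrand_def e_def u_def)
  have "z * (u - u\<^sup>2 / 2) \<le> z * (1 - e)" using e assms by (intro mult_left_mono) auto
  then have "z * (u - u\<^sup>2 / 2) - (2 - u + u\<^sup>2 / 2) \<le> slope_integrand b z" unfolding I using e by linarith
  then show "\<Phi> - b\<^sup>2 * z\<^sup>2 / 2 \<le> slope_integrand b z"
    by (simp add: \<Phi>_def u_def power2_eq_square power3_eq_cube algebra_simps)
  have "z * (1 - e) \<le> z * (u - u\<^sup>2 / 2 + u ^ 3 / 6)" using e assms by (intro mult_left_mono) auto
  then have "slope_integrand b z \<le> z * (u - u\<^sup>2 / 2 + u ^ 3 / 6) - (2 - u)" unfolding I using e by linarith
  then show "slope_integrand b z \<le> \<Phi> + b ^ 3 * z ^ 4 / 6"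
    by (simp add: \<Phi>_def u_def power2_eq_square power3_eq_cube power4_eq_xxxx algebra_simps)
qed

lemma slope_bounds:
  fixes q :: nat
  assumes "\<beta> \<ge> 0"
  defines "b \<equiv> 2 * \<beta> / Suc q" and "a \<equiv> sign_mean q (\<lambda>s. \<bar>s\<bar>)"
  defines "E \<equiv> b * real q - b\<^sup>2 / 2 * ((2 * real q - real (q mod 2)) * a) - 2 + b * a"
  shows "E - b\<^sup>2 / 2 * real q \<le> 2 * slope (Suc q) \<beta> / 2 ^ q"
    "2 * slope (Suc q) \<beta> / 2 ^ q \<le> E + b ^ 3 / 6 * (3 * (real q)\<^sup>2 - 2 * real q)"
proof -
  have b: "b \<ge> 0" using assms by simp
  define \<Phi> where "\<Phi> s = b * s\<^sup>2 + ((- b\<^sup>2 / 2) * \<bar>s\<bar> ^ 3 + (- 2 + b * \<bar>s\<bar>))" for s :: real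
  have E: "sign_mean q \<Phi> = E"
    unfolding \<Phi>_def[abs_def] sign_mean_add sign_mean_cmult sign_mean_const sign_mean_square sign_mean_cube
    by (simp add: E_def a_def)
  have bounds: "\<Phi> s + (- b\<^sup>2 / 2) * s\<^sup>2 \<le> slope_integrand b \<bar>s\<bar>"
    "slope_integrand b \<bar>s\<bar> \<le> \<Phi> s + b ^ 3 / 6 * s ^ 4" for s
    using slope_integrand_bounds[OF b, of "\<bar>s\<bar>"] by (simp_all add: \<Phi>_def algebra_simps)
  have "sign_mean q (\<lambda>s. \<Phi> s + (- b\<^sup>2 / 2) * s\<^sup>2) \<le> sign_mean q (\<lambda>s. slope_integrand b \<bar>s\<bar>)"
    by (rule sign_mean_mono) (rule bounds)
  then show "E - b\<^sup>2 / 2 * real q \<le> 2 * slope (Suc q) \<beta> / 2 ^ q"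
    unfolding slope_as_sign_mean sign_mean_add sign_mean_cmult sign_mean_square E b_def[symmetric] by simp
  have "sign_mean q (\<lambda>s. slope_integrand b \<bar>s\<bar>) \<le> sign_mean q (\<lambda>s. \<Phi> s + b ^ 3 / 6 * s ^ 4)"
    by (rule sign_mean_mono) (rule bounds)
  then show "2 * slope (Suc q) \<beta> / 2 ^ q \<le> E + b ^ 3 / 6 * (3 * (real q)\<^sup>2 - 2 * real q)"
    unfolding slope_as_sign_mean sign_mean_add sign_mean_cmult sign_mean_fourth E b_def[symmetric] .
qed

text \<open>
  For \<open>\<beta> = 1 + x / \<surd>p\<close> the second moment and the constant \<open>- 2\<close> contribute \<open>2 x / \<surd>p\<close>
  to \<open>2 slope p \<beta> / 2\<^sup>q\<close>, the third moment \<open>- 4 \<surd>(2 / \<pi>) / \<surd>p\<close> and the first one \<open>2 \<surd>(2 / \<pi>) / \<surd>p\<close>, up to smaller terms.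
\<close>

lemma slope_asymptotics:
  "(\<lambda>q. sqrt (Suc q) * (2 * slope (Suc q) (1 + x / sqrt (Suc q)) / 2 ^ q))
    \<longlonglongrightarrow> 2 * (x - sqrt (2 / pi))"
proof -
  define r where "r q = sqrt (real (Suc q))" for q
  define \<beta> where "\<beta> q = 1 + x / r q" for q
  define b where "b q = 2 * \<beta> q / Suc q" for q
  define A where "A q = sign_mean q (\<lambda>s. \<bar>s\<bar>) / r q" for q
  have r: "r q > 0" "r q * r q = Suc q" for q by (auto simp: r_def)
  have \<beta>_lim: "\<beta> \<longlonglongrightarrow> 1" unfolding \<beta>_def[abs_def] r_def by real_asymp
  have A_lim: "A \<longlonglongrightarrow> sqrt (2 / pi)"
    unfolding A_def[abs_def] r_def by (rule sign_mean_abs_asymptotics)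
  define o2 where "o2 q = (2 * real q - real (q mod 2)) / Suc q" for q
  have o2_lim: "o2 \<longlonglongrightarrow> 2"
  proof (rule real_tendsto_sandwich)
    show "\<forall>\<^sub>F q in sequentially. (2 * real q - 1) / Suc q \<le> o2 q"
    proof (rule always_eventually, rule allI)
      fix q :: nat
      have "q mod 2 \<le> 1" by simp
      then show "(2 * real q - 1) / Suc q \<le> o2 q" unfolding o2_def by (intro divide_right_mono) auto
    qed
    show "\<forall>\<^sub>F q in sequentially. o2 q \<le> 2 * real q / Suc q"
      unfolding o2_def by (intro always_eventually allI divide_right_mono) auto
    show "(\<lambda>q. (2 * real q - 1) / Suc q) \<longlonglongrightarrow> 2" by real_asymp
    show "(\<lambda>q. 2 * real q / Suc q) \<longlonglongrightarrow> 2" by real_asymp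
  qed
  define E where "E q = (r q * (2 * \<beta> q / Suc q * real q - 2)) - 2 * (\<beta> q)\<^sup>2 * (o2 q * A q) + 2 * \<beta> q * A q" for q
  have main: "(\<lambda>q. r q * (2 * \<beta> q / Suc q * real q - 2)) \<longlonglongrightarrow> 2 * x"
    unfolding \<beta>_def r_def by real_asymp
  have "E \<longlonglongrightarrow> 2 * x - 2 * 1\<^sup>2 * (2 * sqrt (2 / pi)) + 2 * 1 * sqrt (2 / pi)"
    unfolding E_def[abs_def] by (intro tendsto_add tendsto_diff main tendsto_mult tendsto_power tendsto_const \<beta>_lim A_lim o2_lim)
  then have E_lim: "E \<longlonglongrightarrow> 2 * (x - sqrt (2 / pi))" by (simp add: algebra_simps)
  have E_eq: "r q * (b q * real q - (b q)\<^sup>2 / 2 * ((2 * real q - real (q mod 2)) * sign_mean q (\<lambda>s. \<bar>s\<bar>)) - 2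
      + b q * sign_mean q (\<lambda>s. \<bar>s\<bar>)) = E q" for q
  proof -
    have a: "sign_mean q (\<lambda>s. \<bar>s\<bar>) = A q * r q" using r[of q] by (simp add: A_def)
    have o: "2 * real q - real (q mod 2) = o2 q * (r q * r q)" unfolding r by (simp add: o2_def)
    have b: "b q = 2 * \<beta> q / (r q * r q)" unfolding r by (simp add: b_def)
    have E: "E q = (r q * (2 * \<beta> q / (r q * r q) * real q - 2)) - 2 * (\<beta> q)\<^sup>2 * (o2 q * A q) + 2 * \<beta> q * A q"
      unfolding r E_def ..
    show ?thesis unfolding a o b E using r(1)[of q]
      by (simp add: field_simps power2_eq_square)
  qed
  have pos: "\<forall>\<^sub>F q in sequentially. \<beta> q > 0"
    using \<beta>_lim by (rule order_tendstoD) simp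
  show ?thesis
  proof (rule real_tendsto_sandwich)
    show "\<forall>\<^sub>F q in sequentially. E q - r q * ((b q)\<^sup>2 / 2 * real q)
        \<le> sqrt (Suc q) * (2 * slope (Suc q) (1 + x / sqrt (Suc q)) / 2 ^ q)"
      using pos
    proof eventually_elim
      case (elim q)
      then have "\<beta> q \<ge> 0" by simp
      from mult_left_mono[OF slope_bounds(1)[OF this, of q, folded b_def], of "r q"] r(1)[of q]
      show ?case unfolding E_eq[symmetric] r_def[symmetric] \<beta>_def[symmetric]
        by (simp only: right_diff_distrib[symmetric] less_imp_le)
    qed
    show "\<forall>\<^sub>F q in sequentially. sqrt (Suc q) * (2 * slope (Suc q) (1 + x / sqrt (Suc q)) / 2 ^ q)
        \<le> E q + r q * ((b q) ^ 3 / 6 * (3 * (real q)\<^sup>2 - 2 * real q))"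
      using pos
    proof eventually_elim
      case (elim q)
      then have "\<beta> q \<ge> 0" by simp
      from mult_left_mono[OF slope_bounds(2)[OF this, of q, folded b_def], of "r q"] r(1)[of q]
      show ?case unfolding E_eq[symmetric] r_def[symmetric] \<beta>_def[symmetric]
        by (simp only: distrib_left[symmetric] less_imp_le)
    qed
    have "(\<lambda>q. r q * ((b q)\<^sup>2 / 2 * real q)) \<longlonglongrightarrow> 0"
      unfolding b_def \<beta>_def r_def by real_asymp
    from tendsto_diff[OF E_lim this]
    show "(\<lambda>q. E q - r q * ((b q)\<^sup>2 / 2 * real q)) \<longlonglongrightarrow> 2 * (x - sqrt (2 / pi))" by simp
    have "(\<lambda>q. r q * ((b q) ^ 3 / 6 * (3 * (real q)\<^sup>2 - 2 * real q))) \<longlonglongrightarrow> 0"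
      unfolding b_def \<beta>_def r_def by real_asymp
    from tendsto_add[OF E_lim this]
    show "(\<lambda>q. E q + r q * ((b q) ^ 3 / 6 * (3 * (real q)\<^sup>2 - 2 * real q)))
      \<longlonglongrightarrow> 2 * (x - sqrt (2 / pi))" by simp
  qed
qed

lemma slope_sign_near_critical:
  "x > sqrt (2 / pi) \<Longrightarrow> \<forall>\<^sub>F p in sequentially. slope p (1 + x / sqrt p) > 0"
  "x < sqrt (2 / pi) \<Longrightarrow> \<forall>\<^sub>F p in sequentially. slope p (1 + x / sqrt p) < 0"
proof -
  assume "x > sqrt (2 / pi)"
  then have "\<forall>\<^sub>F q in sequentially. sqrt (Suc q) * (2 * slope (Suc q) (1 + x / sqrt (Suc q)) / 2 ^ q) > 0"
    by (intro order_tendstoD(1)[OF slope_asymptotics]) simp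
  then have "\<forall>\<^sub>F q in sequentially. slope (Suc q) (1 + x / sqrt (Suc q)) > 0"
    by eventually_elim (simp add: zero_less_mult_iff zero_less_divide_iff)
  then show "\<forall>\<^sub>F p in sequentially. slope p (1 + x / sqrt p) > 0"
    by (subst (asm) eventually_sequentially_Suc)
next
  assume "x < sqrt (2 / pi)"
  then have "\<forall>\<^sub>F q in sequentially. sqrt (Suc q) * (2 * slope (Suc q) (1 + x / sqrt (Suc q)) / 2 ^ q) < 0"
    by (intro order_tendstoD(2)[OF slope_asymptotics]) simp
  then have "\<forall>\<^sub>F q in sequentially. slope (Suc q) (1 + x / sqrt (Suc q)) < 0"
    by eventually_elim (simp add: mult_less_0_iff divide_less_0_iff)
  then show "\<forall>\<^sub>F p in sequentially. slope p (1 + x / sqrt p) < 0"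
    by (subst (asm) eventually_sequentially_Suc)
qed

text \<open>
  The slope changes its sign at \<open>critical_beta p\<close>, and for large \<open>p\<close> its values at
  \<open>1 + (\<surd>(2 / \<pi>) \<plusminus> c) / \<surd>p\<close> have opposite signs.
\<close>

lemma critical_beta_asymptotics:
  "(\<lambda>p. critical_beta p - (1 + sqrt (2 / (real p * pi)))) \<in> o(\<lambda>p. 1 / sqrt (real p))"
proof (rule landau_o.smallI)
  fix c :: real assume c: "c > 0"
  have "\<forall>\<^sub>F p in sequentially. slope p (1 + (sqrt (2 / pi) + c) / sqrt p) > 0"
    using c by (intro slope_sign_near_critical) simp
  moreover have "\<forall>\<^sub>F p in sequentially. slope p (1 + (sqrt (2 / pi) - c) / sqrt p) < 0"
    using c by (intro slope_sign_near_critical) simp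
  ultimately show "\<forall>\<^sub>F p in sequentially. norm (critical_beta p - (1 + sqrt (2 / (real p * pi))))
      \<le> c * norm (1 / sqrt (real p))"
    using eventually_ge_at_top[of 4]
  proof eventually_elim
    case (elim p)
    have s: "sqrt (2 / (real p * pi)) = sqrt (2 / pi) / sqrt p"
      by (simp add: real_sqrt_divide real_sqrt_mult)
    have "critical_beta p < 1 + (sqrt (2 / pi) + c) / sqrt p"
      "1 + (sqrt (2 / pi) - c) / sqrt p < critical_beta p"
      using slope_sign[OF elim(3)] elim(1,2) by auto
    then have "\<bar>critical_beta p - (1 + sqrt (2 / (real p * pi)))\<bar> \<le> c / sqrt p"
      unfolding s by (simp add: add_divide_distrib diff_divide_distrib abs_le_iff)
    then show ?case by simp
  qed
qed

section \<open>Small batches\<close>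

text \<open>
  The drift is \<open>- m * c\<close> with \<open>c\<close> positive for \<open>m \<in> {-1..1}\<close>, by the closed forms for two and three spins.
\<close>

lemma small_batch_equilibria:
  assumes "p \<in> {2, 3}"
  shows "equilibrium p \<beta> m \<longleftrightarrow> m = 0"
    and "m \<in> {-1..1} \<Longrightarrow> m * drift p \<beta> m \<le> 0"
proof -
  obtain c where c: "m \<in> {-1..1} \<Longrightarrow> c > 0" "drift p \<beta> m = - m * c"
  proof (cases "p = 2")
    case True
    then show ?thesis using that[of "2 * exp (- \<beta>)"] by (simp add: drift_2)
  next
    case False
    then have p: "p = 3" using assms by auto
    define c where "c = (1 - m\<^sup>2) / 2 + exp (- 4 * \<beta> / 3) * (3 + m\<^sup>2) / 2"
    have "c > 0" if "m \<in> {-1..1}"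
    proof -
      have "m\<^sup>2 \<le> 1" using that by (auto simp: abs_square_le_1)
      then show ?thesis unfolding c_def by (intro add_nonneg_pos) (auto intro!: mult_pos_pos add_pos_nonneg)
    qed
    then show ?thesis using that[of c] by (simp add: drift_3 p c_def)
  qed
  show "equilibrium p \<beta> m \<longleftrightarrow> m = 0"
    using c by (auto simp: equilibrium_def)
  show "m * drift p \<beta> m \<le> 0" if "m \<in> {-1..1}"
    using c(1)[OF that] unfolding c(2) by (simp add: mult_nonneg_nonneg flip: mult.assoc)
qed

lemma small_batch_stable:
  assumes "p \<in> {2, 3}"
  shows "lyapunov_stable (drift p \<beta>) {-1..1} 0" "linearly_stable (drift p \<beta>) 0"
proof -
  show st: "lyapunov_stable (drift p \<beta>) {-1..1} 0"
    by (rule lyapunov_stable_if_inward[of 1]) (use small_batch_equilibria(2)[OF assms] in auto)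
  have "p \<ge> 1" using assms by auto
  then show "linearly_stable (drift p \<beta>) 0"
    using st not_lyapunov_stable_drift[of p \<beta>] by (auto simp: linearly_stable_drift_iff not_less[symmetric])
qed

section \<open>The mean field limit and the phase transition\<close>

lemma mean_field_limit:
  fixes P :: "nat \<Rightarrow> 'a measure" and \<sigma> :: "nat \<Rightarrow> nat \<Rightarrow> 'a \<Rightarrow> nat \<Rightarrow> real"
  assumes "p \<ge> 1" "\<beta> \<ge> 0" and sol: "ode_solution (drift p \<beta>) {-1..1} m"
    and "\<And>N. N \<ge> p \<Longrightarrow> markov_chain (P N) (spin_configs N) (batch_step N p \<beta>) (\<sigma> N)"
    and "weak_conv_m (\<lambda>N. distr (P N) borel (\<lambda>\<omega>. magnetization N (\<sigma> N 0 \<omega>))) (return borel (m 0))"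
  shows "N \<ge> p \<Longrightarrow> rescaled_magnetization N (\<sigma> N) \<in> P N \<rightarrow>\<^sub>M borel_of_topology skorokhod_topology"
      (is "_ \<Longrightarrow> ?meas")
    and "weak_conv_on skorokhod_topology
      (\<lambda>N. distr (P N) (borel_of_topology skorokhod_topology) (rescaled_magnetization N (\<sigma> N)))
      (return (borel_of_topology skorokhod_topology) (restrict m {0..}))" (is ?conv)
proof -
  obtain L where L: "L > 0"
    "\<And>a b. a \<in> {-1..1} \<Longrightarrow> b \<in> {-1..1} \<Longrightarrow> \<bar>drift p \<beta> a - drift p \<beta> b\<bar> \<le> L * \<bar>a - b\<bar>"
    using drift_lipschitz[of p \<beta>] by blast
  obtain G where G: "\<And>a. a \<in> {-1..1} \<Longrightarrow> \<bar>drift p \<beta> a\<bar> \<le> G"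
    using drift_bounded[of p \<beta>] by blast
  interpret curie_weiss_limit p \<beta> "m 0" m L G P \<sigma>
    by unfold_locales (use assms L G in auto)
  show "?meas" if "N \<ge> p" using that by (rule rescaled_magnetization_measurable)
  show ?conv
    by (rule rescaled_magnetization_converges)
qed

lemma drift_solution_unique:
  assumes "ode_solution (drift p \<beta>) {-1..1} x" "ode_solution (drift p \<beta>) {-1..1} y" "x 0 = y 0" "t \<ge> 0"
  shows "x t = y t"
proof -
  obtain L where "L > 0"
    and lip: "\<And>a b. a \<in> {-1..1} \<Longrightarrow> b \<in> {-1..1} \<Longrightarrow> \<bar>drift p \<beta> a - drift p \<beta> b\<bar> \<le> L * \<bar>a - b\<bar>"
    using drift_lipschitz[of p \<beta>] by blast
  show ?thesis by (rule ode_solution_unique[OF lip assms])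
qed

theorem theorem1:
  shows
   "(\<forall>(p::nat)\<ge>2. \<forall>\<beta>::real. \<beta> > 0 \<longrightarrow>
      (\<forall>m0\<in>{-1..1}. \<exists>m.
         ode_solution (drift p \<beta>) {-1..1} m \<and> m 0 = m0 \<and>
         (\<forall>y. ode_solution (drift p \<beta>) {-1..1} y \<and> y 0 = m0 \<longrightarrow> (\<forall>t\<ge>0. y t = m t)) \<and>
         (\<forall>(P :: nat \<Rightarrow> 'a measure) (\<sigma> :: nat \<Rightarrow> nat \<Rightarrow> 'a \<Rightarrow> nat \<Rightarrow> real).
            (\<forall>N\<ge>p. markov_chain (P N) (spin_configs N) (batch_step N p \<beta>) (\<sigma> N)) \<and>
            weak_conv_m (\<lambda>N. distr (P N) borel (\<lambda>\<omega>. magnetization N (\<sigma> N 0 \<omega>))) (return borel m0)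
            \<longrightarrow>
            (\<forall>N\<ge>p. rescaled_magnetization N (\<sigma> N)
                     \<in> P N \<rightarrow>\<^sub>M borel_of_topology skorokhod_topology) \<and>
            weak_conv_on skorokhod_topology
              (\<lambda>N. distr (P N) (borel_of_topology skorokhod_topology)
                     (rescaled_magnetization N (\<sigma> N)))
              (return (borel_of_topology skorokhod_topology) (restrict m {0..})))) \<and>
      equilibrium p \<beta> 0) \<and>
    (\<forall>p\<in>{2, 3::nat}. \<forall>\<beta>::real. \<beta> > 0 \<longrightarrow>
      (\<forall>m. equilibrium p \<beta> m \<longleftrightarrow> m = 0) \<and>
      lyapunov_stable (drift p \<beta>) {-1..1} 0 \<and> linearly_stable (drift p \<beta>) 0) \<and>
    (\<exists>\<beta>c :: nat \<Rightarrow> real.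
      (\<forall>p\<ge>4. \<forall>\<beta>>0.
        (\<beta> > \<beta>c p \<longrightarrow> \<not> linearly_stable (drift p \<beta>) 0 \<and> \<not> lyapunov_stable (drift p \<beta>) {-1..1} 0) \<and>
        (\<beta> \<le> \<beta>c p \<longrightarrow> linearly_stable (drift p \<beta>) 0) \<and>
        (\<beta> < \<beta>c p \<longrightarrow> lyapunov_stable (drift p \<beta>) {-1..1} 0)) \<and>
      (\<lambda>p. \<beta>c p - (1 + sqrt (2 / (real p * pi)))) \<in> o(\<lambda>p. 1 / sqrt (real p)))"
proof (intro conjI allI ballI impI, goal_cases)
  case (1 p \<beta> m0)
  then have p1: "1 \<le> p" and \<beta>: "0 \<le> \<beta>" by auto
  obtain m where m: "ode_solution (drift p \<beta>) {-1..1} m" "m 0 = m0"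
    using drift_solution_exists[OF p1] 1(3) by blast
  show ?case
  proof (intro exI[of _ m] conjI allI impI m)
    fix y and t :: real
    assume "ode_solution (drift p \<beta>) {-1..1} y \<and> y 0 = m0" "0 \<le> t"
    then show "y t = m t" using m drift_solution_unique[of p \<beta> y m t] by auto
  next
    fix P :: "nat \<Rightarrow> 'a measure" and \<sigma> :: "nat \<Rightarrow> nat \<Rightarrow> 'a \<Rightarrow> nat \<Rightarrow> real"
    assume "(\<forall>N\<ge>p. markov_chain (P N) (spin_configs N) (batch_step N p \<beta>) (\<sigma> N)) \<and>
      weak_conv_m (\<lambda>N. distr (P N) borel (\<lambda>\<omega>. magnetization N (\<sigma> N 0 \<omega>))) (return borel m0)"
    then have chain: "\<And>N. N \<ge> p \<Longrightarrow> markov_chain (P N) (spin_configs N) (batch_step N p \<beta>) (\<sigma> N)"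
      and init: "weak_conv_m (\<lambda>N. distr (P N) borel (\<lambda>\<omega>. magnetization N (\<sigma> N 0 \<omega>))) (return borel (m 0))"
      by (auto simp: m(2))
    show "rescaled_magnetization N (\<sigma> N) \<in> P N \<rightarrow>\<^sub>M borel_of_topology skorokhod_topology"
      if "p \<le> N" for N
      by (rule mean_field_limit(1)[OF p1 \<beta> m(1) chain init that])
    show "weak_conv_on skorokhod_topology
      (\<lambda>N. distr (P N) (borel_of_topology skorokhod_topology) (rescaled_magnetization N (\<sigma> N)))
      (return (borel_of_topology skorokhod_topology) (restrict m {0..}))"
      by (rule mean_field_limit(2)[OF p1 \<beta> m(1) chain init])
  qed
next
  case (2 p \<beta>)
  then show ?case by (simp add: equilibrium_def drift_zero)
next
  case (3 p \<beta> m)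
  then show ?case by (intro small_batch_equilibria)
next
  case (4 p \<beta>)
  then show ?case by (intro small_batch_stable)
next
  case (5 p \<beta>)
  then show ?case by (intro small_batch_stable)
next
  case 6
  show ?case
  proof (intro exI[of _ critical_beta] conjI allI impI critical_beta_asymptotics)
    fix p :: nat and \<beta> :: real
    assume p: "4 \<le> p"
    then have p1: "1 \<le> p" by simp
    note sign = slope_sign[OF p, of \<beta>]
    show "\<not> linearly_stable (drift p \<beta>) 0" if "critical_beta p < \<beta>"
      using that sign by (simp add: linearly_stable_drift_iff[OF p1])
    show "\<not> lyapunov_stable (drift p \<beta>) {-1..1} 0" if "critical_beta p < \<beta>"
      using that sign by (intro not_lyapunov_stable_drift[OF p1]) simp
    show "linearly_stable (drift p \<beta>) 0" if "\<beta> \<le> critical_beta p"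
      using that sign by (auto simp: linearly_stable_drift_iff[OF p1] not_less[symmetric])
    show "lyapunov_stable (drift p \<beta>) {-1..1} 0" if "\<beta> < critical_beta p"
      using that sign by (intro lyapunov_stable_drift[OF p1]) simp
  qed
qed

end
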